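(* Each of the theories $\mathrm{PAI}^{\circ}$, $\mathrm{PAI}$, and $\mathrm{PAI}+\alpha$ is nowhere solid (in particular, none of them is solid).
   Context: $\mathcal{L}_{\mathrm{A}}=\{+,\cdot,\mathrm{S},<,0\}$. $\mathrm{PAI}$ is the $\mathcal{L}_{\mathrm{A}}\cup\{I\}$-theory with axioms: (1) $\mathrm{PA}$ with induction for all $\mathcal{L}_{\mathrm{A}}\cup\{I\}$-formulae; (2) "$I$ is unbounded"; (3) for each $\mathcal{L}_{\mathrm{A}}$-formula $\varphi(v_1,\dots,v_n)$: for all $x_1<\dots<x_n$ and $y_1<\dots<y_n$ in $I$, $\varphi(\bar x)\leftrightarrow\varphi(\bar y)$. $\mathrm{PAI}^{\circ}$ is the same except that in (3) the equivalence is required only when also $\ulcorner\varphi\urcorner<x_1$ and $\ulcorner\varphi\urcorner<y_1$. The sentence $\alpha$: for the recursive transformation of an $\mathcal{L}_{\mathrm{A}}$-formula $\varphi(\bar x)$ (built with $\neg,\vee,\exists$) into a $\Delta_0$-formula $\varphi^*(\bar x,z_1,\dots,z_k)$ given by $\varphi^*=\varphi$ for atomic $\varphi$, $(\neg\varphi)^*=\neg\varphi^*$, $(\varphi_1\vee\varphi_2)^*=\varphi_1^*\vee\varphi_2^*$, $(\exists y\,\varphi)^*=\exists y<z_1\,\widetilde{\varphi^*}$ (where $\varphi^*=\varphi^*(\bar x,y,z_1,\dots,z_k)$ and $\widetilde{\varphi^*}$ replaces each $z_i$ by $z_{i+1}$), let $\sigma(x)$ express: $x=\langle\varphi,\bar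 a\rangle$ and, with $j$ the least element of $I$ exceeding $\ulcorner\varphi\urcorner$ and all $a_s$ and $i_1<\dots<i_k$ the next $k$ elements of $I$ above $j$, $\varphi^*(\bar a,i_1,\dots,i_k)$ holds according to the canonical $\Sigma_1$ satisfaction predicate for $\Delta_0$-formulae. $\alpha$ says "the set defined by $\sigma$ satisfies Tarski's satisfaction clauses for all $\mathcal{L}_{\mathrm{A}}$-formulae of the model". For structures, $\mathcal{M}\trianglerighteq\mathcal{N}$ means the universe of $\mathcal{N}$ and interpretations of all its symbols are definable (with parameters) in $\mathcal{M}$. A theory $U$ is nowhere solid if for every model $\mathcal{M}$ of $U$ there exist models $\mathcal{M}^*,\mathcal{N}$ of $U$ with $\mathcal{M}\trianglerighteq\mathcal{N}\trianglerighteq\mathcal{M}^*$ and an $\mathcal{M}$-definable isomorphism $\mathcal{M}\to\mathcal{M}^*$, but no $\mathcal{M}$-definable isomorphism $\mathcal{M}\to\mathcal{N}$. $U$ is solid if for all models $\mathcal{M},\mathcal{M}^*,\mathcal{N}$ of $U$ with $\mathcal{M}\trianglerighteq\mathcal{N}\trianglerighteq\mathcal{M}^*$ and an $\mathcal{M}$-definable isomorphism $\mathcal{M}\to\mathcal{M}^*$, there is an $\mathcal{M}$-definable isomorphism $\mathcal{M}\to\mathcal{N}$. *)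

theory Defs
  imports Main
begin

section \<open>Syntax\<close>

datatype tm = Var nat | Zero | Succ tm | Plus tm tm | Times tm tm

text \<open>Formulae of \<open>\<L>\<^sub>A \<union> {I}\<close>, with named variables; \<open>InI t\<close> is \<open>I(t)\<close>.\<close>

datatype fm = Eq tm tm | Less tm tm | InI tm | Neg fm | Or fm fm | Ex nat fm

definition And :: "fm \<Rightarrow> fm \<Rightarrow> fm" where "And p q = Neg (Or (Neg p) (Neg q))"
definition Imp :: "fm \<Rightarrow> fm \<Rightarrow> fm" where "Imp p q = Or (Neg p) q"
definition Iff :: "fm \<Rightarrow> fm \<Rightarrow> fm" where "Iff p q = And (Imp p q) (Imp q p)"
definition All :: "nat \<Rightarrow> fm \<Rightarrow> fm" where "All i p = Neg (Ex i (Neg p))"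

primrec num :: "nat \<Rightarrow> tm" where
  "num 0 = Zero"
| "num (Suc k) = Succ (num k)"

primrec fv_tm :: "tm \<Rightarrow> nat set" where
  "fv_tm (Var i) = {i}"
| "fv_tm Zero = {}"
| "fv_tm (Succ t) = fv_tm t"
| "fv_tm (Plus t u) = fv_tm t \<union> fv_tm u"
| "fv_tm (Times t u) = fv_tm t \<union> fv_tm u"

primrec fv :: "fm \<Rightarrow> nat set" where
  "fv (Eq t u) = fv_tm t \<union> fv_tm u"
| "fv (Less t u) = fv_tm t \<union> fv_tm u"
| "fv (InI t) = fv_tm t"
| "fv (Neg p) = fv p"
| "fv (Or p q) = fv p \<union> fv q"
| "fv (Ex i p) = fv p - {i}"

text \<open>\<open>arith p\<close>: \<open>p\<close> is an \<open>\<L>\<^sub>A\<close>-formula, i.e. \<open>I\<close> does not occur in it.\<close>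

primrec arith :: "fm \<Rightarrow> bool" where
  "arith (Eq t u) = True"
| "arith (Less t u) = True"
| "arith (InI t) = False"
| "arith (Neg p) = arith p"
| "arith (Or p q) = (arith p \<and> arith q)"
| "arith (Ex i p) = arith p"

primrec subst_tm :: "nat \<Rightarrow> tm \<Rightarrow> tm \<Rightarrow> tm" where
  "subst_tm x r (Var i) = (if i = x then r else Var i)"
| "subst_tm x r Zero = Zero"
| "subst_tm x r (Succ t) = Succ (subst_tm x r t)"
| "subst_tm x r (Plus t u) = Plus (subst_tm x r t) (subst_tm x r u)"
| "subst_tm x r (Times t u) = Times (subst_tm x r t) (subst_tm x r u)"

text \<open>Substitution of \<open>r\<close> for the free occurrences of \<open>x\<close>.  It does not rename bound variables, and
  is only used with \<open>fv_tm r \<subseteq> {x}\<close>, where no capture is possible.\<close>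

primrec subst :: "nat \<Rightarrow> tm \<Rightarrow> fm \<Rightarrow> fm" where
  "subst x r (Eq t u) = Eq (subst_tm x r t) (subst_tm x r u)"
| "subst x r (Less t u) = Less (subst_tm x r t) (subst_tm x r u)"
| "subst x r (InI t) = InI (subst_tm x r t)"
| "subst x r (Neg p) = Neg (subst x r p)"
| "subst x r (Or p q) = Or (subst x r p) (subst x r q)"
| "subst x r (Ex i p) = (if i = x then Ex i p else Ex i (subst x r p))"

primrec shift_tm :: "nat \<Rightarrow> tm \<Rightarrow> tm" where
  "shift_tm n (Var i) = Var (n + i)"
| "shift_tm n Zero = Zero"
| "shift_tm n (Succ t) = Succ (shift_tm n t)"
| "shift_tm n (Plus t u) = Plus (shift_tm n t) (shift_tm n u)"
| "shift_tm n (Times t u) = Times (shift_tm n t) (shift_tm n u)"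

text \<open>\<open>shift n p\<close> renames all variables of \<open>p\<close>, free and bound, by the injection \<open>v\<^sub>i \<mapsto> v\<^sub>n\<^sub>+\<^sub>i\<close>.  So if
  \<open>p\<close> is \<open>\<phi>(v\<^sub>0,\<dots>,v\<^sub>n\<^sub>-\<^sub>1)\<close> then \<open>shift n p\<close> is (a variant of) \<open>\<phi>(v\<^sub>n,\<dots>,v\<^sub>2\<^sub>n\<^sub>-\<^sub>1)\<close>.\<close>

primrec shift :: "nat \<Rightarrow> fm \<Rightarrow> fm" where
  "shift n (Eq t u) = Eq (shift_tm n t) (shift_tm n u)"
| "shift n (Less t u) = Less (shift_tm n t) (shift_tm n u)"
| "shift n (InI t) = InI (shift_tm n t)"
| "shift n (Neg p) = Neg (shift n p)"
| "shift n (Or p q) = Or (shift n p) (shift n q)"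
| "shift n (Ex i p) = Ex (n + i) (shift n p)"

text \<open>Goedel numbers.  The pairing function is a (non-surjective) injection given by an
  \<open>\<L>\<^sub>A\<close>-term, and strictly exceeds both arguments.\<close>

definition npair :: "nat \<Rightarrow> nat \<Rightarrow> nat" where
  "npair x y = Suc ((x + y) * (x + y) + x)"

primrec gn_tm :: "tm \<Rightarrow> nat" where
  "gn_tm (Var i) = npair 0 i"
| "gn_tm Zero = npair 1 0"
| "gn_tm (Succ t) = npair 2 (gn_tm t)"
| "gn_tm (Plus t u) = npair 3 (npair (gn_tm t) (gn_tm u))"
| "gn_tm (Times t u) = npair 4 (npair (gn_tm t) (gn_tm u))"

primrec gn :: "fm \<Rightarrow> nat" where
  "gn (Eq t u) = npair 5 (npair (gn_tm t) (gn_tm u))"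
| "gn (Less t u) = npair 6 (npair (gn_tm t) (gn_tm u))"
| "gn (Neg p) = npair 7 (gn p)"
| "gn (Or p q) = npair 8 (npair (gn p) (gn q))"
| "gn (Ex i p) = npair 9 (npair i (gn p))"
| "gn (InI t) = npair 10 (gn_tm t)"


section \<open>Structures, satisfaction, models\<close>

text \<open>Only the restriction of the operations and relations to \<open>univ\<close> matters.\<close>

record 'a struct =
  univ :: "'a set"
  zer :: "'a"
  suc :: "'a \<Rightarrow> 'a"
  add :: "'a \<Rightarrow> 'a \<Rightarrow> 'a"
  mul :: "'a \<Rightarrow> 'a \<Rightarrow> 'a"
  lt :: "'a \<Rightarrow> 'a \<Rightarrow> bool"
  ind :: "'a set"

definition is_struct :: "'a struct \<Rightarrow> bool" where
  "is_struct M \<longleftrightarrow>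
     zer M \<in> univ M \<and>
     (\<forall>x\<in>univ M. suc M x \<in> univ M) \<and>
     (\<forall>x\<in>univ M. \<forall>y\<in>univ M. add M x y \<in> univ M \<and> mul M x y \<in> univ M) \<and>
     ind M \<subseteq> univ M"

primrec val :: "'a struct \<Rightarrow> (nat \<Rightarrow> 'a) \<Rightarrow> tm \<Rightarrow> 'a" where
  "val M s (Var i) = s i"
| "val M s Zero = zer M"
| "val M s (Succ t) = suc M (val M s t)"
| "val M s (Plus t u) = add M (val M s t) (val M s u)"
| "val M s (Times t u) = mul M (val M s t) (val M s u)"

primrec sat :: "'a struct \<Rightarrow> (nat \<Rightarrow> 'a) \<Rightarrow> fm \<Rightarrow> bool" where
  "sat M s (Eq t u) \<longleftrightarrow> val M s t = val M s u"
| "sat M s (Less t u) \<longleftrightarrow> lt M (val M s t) (val M s u)"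
| "sat M s (InI t) \<longleftrightarrow> val M s t \<in> ind M"
| "sat M s (Neg p) \<longleftrightarrow> \<not> sat M s p"
| "sat M s (Or p q) \<longleftrightarrow> sat M s p \<or> sat M s q"
| "sat M s (Ex i p) \<longleftrightarrow> (\<exists>a\<in>univ M. sat M (s(i := a)) p)"

text \<open>A theory is a set of formulae; each stands for its universal closure.\<close>

definition models :: "'a struct \<Rightarrow> fm set \<Rightarrow> bool" where
  "models M U \<longleftrightarrow> is_struct M \<and> (\<forall>p\<in>U. \<forall>s. range s \<subseteq> univ M \<longrightarrow> sat M s p)"


section \<open>Definability, interpretations, solidity\<close>

text \<open>\<open>definable M k R\<close>: the restriction of \<open>R\<close> to \<open>k\<close>-tuples from \<open>M\<close> is definable in \<open>M\<close>.  The
  variables \<open>v\<^sub>k, v\<^sub>k\<^sub>+\<^sub>1, \<dots>\<close> of the defining formula are assigned parameters.\<close>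

definition definable :: "'a struct \<Rightarrow> nat \<Rightarrow> ('a list \<Rightarrow> bool) \<Rightarrow> bool" where
  "definable M k R \<longleftrightarrow>
     (\<exists>p q. range q \<subseteq> univ M \<and>
        (\<forall>xs. length xs = k \<and> set xs \<subseteq> univ M \<longrightarrow>
           (R xs \<longleftrightarrow> sat M (\<lambda>i. if i < k then xs ! i else q i) p)))"

definition interprets :: "'a struct \<Rightarrow> 'a struct \<Rightarrow> bool" (infix "\<unrhd>" 50) where
  "M \<unrhd> N \<longleftrightarrow>
     univ N \<subseteq> univ M \<and>
     definable M 1 (\<lambda>xs. xs ! 0 \<in> univ N) \<and>
     definable M 1 (\<lambda>xs. xs ! 0 = zer N) \<and>
     definable M 2 (\<lambda>xs. set xs \<subseteq> univ N \<and> xs ! 1 = suc N (xs ! 0)) \<and>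
     definable M 3 (\<lambda>xs. set xs \<subseteq> univ N \<and> xs ! 2 = add N (xs ! 0) (xs ! 1)) \<and>
     definable M 3 (\<lambda>xs. set xs \<subseteq> univ N \<and> xs ! 2 = mul N (xs ! 0) (xs ! 1)) \<and>
     definable M 2 (\<lambda>xs. set xs \<subseteq> univ N \<and> lt N (xs ! 0) (xs ! 1)) \<and>
     definable M 1 (\<lambda>xs. set xs \<subseteq> univ N \<and> xs ! 0 \<in> ind N)"

definition isomorphism :: "'a struct \<Rightarrow> 'a struct \<Rightarrow> ('a \<Rightarrow> 'a) \<Rightarrow> bool" where
  "isomorphism M N f \<longleftrightarrow>
     bij_betw f (univ M) (univ N) \<and>
     f (zer M) = zer N \<and>
     (\<forall>x\<in>univ M. f (suc M x) = suc N (f x)) \<and>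
     (\<forall>x\<in>univ M. \<forall>y\<in>univ M. f (add M x y) = add N (f x) (f y)) \<and>
     (\<forall>x\<in>univ M. \<forall>y\<in>univ M. f (mul M x y) = mul N (f x) (f y)) \<and>
     (\<forall>x\<in>univ M. \<forall>y\<in>univ M. lt M x y \<longleftrightarrow> lt N (f x) (f y)) \<and>
     (\<forall>x\<in>univ M. x \<in> ind M \<longleftrightarrow> f x \<in> ind N)"

definition definably_iso :: "'a struct \<Rightarrow> 'a struct \<Rightarrow> bool" where
  "definably_iso M N \<longleftrightarrow>
     (\<exists>f. isomorphism M N f \<and> definable M 2 (\<lambda>xs. xs ! 1 = f (xs ! 0)))"

text \<open>The universe of a structure interpreted in \<open>M\<close> is a subset of that of \<open>M\<close>, so all three
  structures live on one type.  The type argument restricts attention to models whose universe is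
  a subset of that type; the notions themselves are the ones obtained by letting the type vary.
  Hence \<open>U\<close> is nowhere solid iff \<open>nowhere_solid TYPE('a) U\<close> holds for an arbitrary type \<open>'a\<close>,
  while \<open>\<not> solid TYPE('a) U\<close> for a single type \<open>'a\<close> suffices to refute the solidity of \<open>U\<close>.\<close>

definition nowhere_solid :: "'a itself \<Rightarrow> fm set \<Rightarrow> bool" where
  "nowhere_solid _ U \<longleftrightarrow>
     (\<forall>M :: 'a struct. models M U \<longrightarrow>
        (\<exists>M' N. models M' U \<and> models N U \<and> M \<unrhd> N \<and> N \<unrhd> M' \<and>
           definably_iso M M' \<and> \<not> definably_iso M N))"

definition solid :: "'a itself \<Rightarrow> fm set \<Rightarrow> bool" where
  "solid _ U \<longleftrightarrow>
     (\<forall>(M :: 'a struct) M' N. models M U \<and> models M' U \<and> models N U \<and> M \<unrhd> N \<and> N \<unrhd> M' \<and>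
        definably_iso M M' \<longrightarrow> definably_iso M N)"


section \<open>The theories \<open>PAI\<close> and \<open>PAI\<degree>\<close>\<close>

definition PA_basic :: "fm set" where
  "PA_basic =
     (let x = Var 0; y = Var 1 in
      {Neg (Eq (Succ x) Zero),
       Imp (Eq (Succ x) (Succ y)) (Eq x y),
       Eq (Plus x Zero) x,
       Eq (Plus x (Succ y)) (Succ (Plus x y)),
       Eq (Times x Zero) Zero,
       Eq (Times x (Succ y)) (Plus (Times x y) x),
       Neg (Less x Zero),
       Iff (Less x (Succ y)) (Or (Less x y) (Eq x y))})"

definition Induct :: "nat \<Rightarrow> fm \<Rightarrow> fm" where
  "Induct x p =
     Imp (And (subst x Zero p) (All x (Imp p (subst x (Succ (Var x)) p)))) (All x p)"

definition Unbounded :: fm where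
  "Unbounded = All 0 (Ex 1 (And (Less (Var 0) (Var 1)) (InI (Var 1))))"

text \<open>\<open>IncrI i m\<close> says \<open>v\<^sub>i < \<dots> < v\<^sub>i\<^sub>+\<^sub>m\<close> are elements of \<open>I\<close>.\<close>

primrec IncrI :: "nat \<Rightarrow> nat \<Rightarrow> fm" where
  "IncrI i 0 = InI (Var i)"
| "IncrI i (Suc m) =
     And (IncrI i m) (And (InI (Var (i + Suc m))) (Less (Var (i + m)) (Var (i + Suc m))))"

text \<open>Indiscernibility for \<open>p = \<phi>(v\<^sub>0,\<dots>,v\<^sub>m)\<close>, with \<open>x\<^sub>1,\<dots>,x\<^sub>n\<close> being \<open>v\<^sub>0,\<dots>,v\<^sub>m\<close> and \<open>y\<^sub>1,\<dots>,y\<^sub>n\<close>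
  being \<open>v\<^sub>n,\<dots>,v\<^sub>n\<^sub>+\<^sub>m\<close>, where \<open>n = m + 1\<close>.\<close>

definition Indisc :: "nat \<Rightarrow> fm \<Rightarrow> fm" where
  "Indisc m p = Imp (And (IncrI 0 m) (IncrI (Suc m) m)) (Iff p (shift (Suc m) p))"

definition Indisc0 :: "nat \<Rightarrow> fm \<Rightarrow> fm" where
  "Indisc0 m p =
     Imp (And (And (IncrI 0 m) (IncrI (Suc m) m))
              (And (Less (num (gn p)) (Var 0)) (Less (num (gn p)) (Var (Suc m)))))
         (Iff p (shift (Suc m) p))"

definition PAI :: "fm set" where
  "PAI = PA_basic \<union> {Induct x p | x p. True} \<union> {Unbounded} \<union>
         {Indisc m p | m p. arith p \<and> fv p \<subseteq> {..m}}"

definition PAI0 :: "fm set" where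
  "PAI0 = PA_basic \<union> {Induct x p | x p. True} \<union> {Unbounded} \<union>
          {Indisc0 m p | m p. arith p \<and> fv p \<subseteq> {..m}}"


section \<open>A notation for long formulae\<close>

text \<open>To write the sentence \<open>\<alpha>\<close> legibly, formulae are built as functions of the index of the next
  unused variable, which a quantifier binds: \<open>\<^bold>\<exists>x. B x\<close> at \<open>n\<close> is \<open>Ex n (B (Var n))\<close>, with the
  body built at \<open>n + 1\<close>.\<close>

type_synonym scheme = "nat \<Rightarrow> fm"

definition eqS :: "tm \<Rightarrow> tm \<Rightarrow> scheme" (infix "\<doteq>" 50) where "t \<doteq> u = (\<lambda>n. Eq t u)"
definition ltS :: "tm \<Rightarrow> tm \<Rightarrow> scheme" (infix "\<prec>" 50) where "t \<prec> u = (\<lambda>n. Less t u)"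
definition inI :: "tm \<Rightarrow> scheme" where "inI t = (\<lambda>n. InI t)"
definition notS :: "scheme \<Rightarrow> scheme" ("\<^bold>\<not> _" [40] 40) where "(\<^bold>\<not> P) = (\<lambda>n. Neg (P n))"
definition orS :: "scheme \<Rightarrow> scheme \<Rightarrow> scheme" (infixr "\<^bold>\<or>" 30)
  where "(P \<^bold>\<or> Q) = (\<lambda>n. Or (P n) (Q n))"
definition andS :: "scheme \<Rightarrow> scheme \<Rightarrow> scheme" (infixr "\<^bold>\<and>" 35)
  where "(P \<^bold>\<and> Q) = (\<lambda>n. And (P n) (Q n))"
definition impS :: "scheme \<Rightarrow> scheme \<Rightarrow> scheme" (infixr "\<^bold>\<longrightarrow>" 25)
  where "(P \<^bold>\<longrightarrow> Q) = (\<lambda>n. Imp (P n) (Q n))"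
definition iffS :: "scheme \<Rightarrow> scheme \<Rightarrow> scheme" (infixr "\<^bold>\<longleftrightarrow>" 25)
  where "(P \<^bold>\<longleftrightarrow> Q) = (\<lambda>n. Iff (P n) (Q n))"
definition exS :: "(tm \<Rightarrow> scheme) \<Rightarrow> scheme" (binder "\<^bold>\<exists>" 10)
  where "exS B = (\<lambda>n. Ex n (B (Var n) (Suc n)))"
definition allS :: "(tm \<Rightarrow> scheme) \<Rightarrow> scheme" (binder "\<^bold>\<forall>" 10)
  where "allS B = (\<lambda>n. All n (B (Var n) (Suc n)))"
definition exlt :: "tm \<Rightarrow> (tm \<Rightarrow> scheme) \<Rightarrow> scheme"
  where "exlt t B = (\<^bold>\<exists>x. x \<prec> t \<^bold>\<and> B x)"
definition alllt :: "tm \<Rightarrow> (tm \<Rightarrow> scheme) \<Rightarrow> scheme"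
  where "alllt t B = (\<^bold>\<forall>x. x \<prec> t \<^bold>\<longrightarrow> B x)"


section \<open>Coding inside a model\<close>

definition pair :: "tm \<Rightarrow> tm \<Rightarrow> tm" where
  "pair x y = Succ (Plus (Times (Plus x y) (Plus x y)) x)"
definition triple :: "tm \<Rightarrow> tm \<Rightarrow> tm \<Rightarrow> tm" where
  "triple x y z = pair x (pair y z)"

text \<open>The tags agree with those in \<open>gn_tm\<close> and \<open>gn\<close>.\<close>

definition cVar :: "tm \<Rightarrow> tm" where "cVar i = pair (num 0) i"
definition cZero :: tm where "cZero = pair (num 1) (num 0)"
definition cSucc :: "tm \<Rightarrow> tm" where "cSucc t = pair (num 2) t"
definition cPlus :: "tm \<Rightarrow> tm \<Rightarrow> tm" where "cPlus t u = pair (num 3) (pair t u)"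
definition cTimes :: "tm \<Rightarrow> tm \<Rightarrow> tm" where "cTimes t u = pair (num 4) (pair t u)"
definition cEq :: "tm \<Rightarrow> tm \<Rightarrow> tm" where "cEq t u = pair (num 5) (pair t u)"
definition cLess :: "tm \<Rightarrow> tm \<Rightarrow> tm" where "cLess t u = pair (num 6) (pair t u)"
definition cNeg :: "tm \<Rightarrow> tm" where "cNeg p = pair (num 7) p"
definition cOr :: "tm \<Rightarrow> tm \<Rightarrow> tm" where "cOr p q = pair (num 8) (pair p q)"
definition cEx :: "tm \<Rightarrow> tm \<Rightarrow> tm" where "cEx i p = pair (num 9) (pair i p)"
definition cAnd :: "tm \<Rightarrow> tm \<Rightarrow> tm" where "cAnd p q = cNeg (cOr (cNeg p) (cNeg q))"

text \<open>Sequences are coded by Goedel's \<open>\<beta>\<close>-function: \<open>\<langle>l,\<langle>c,d\<rangle>\<rangle>\<close> codes the sequence of length \<open>l\<close>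
  with \<open>i\<close>-th entry \<open>c mod (1 + (i + 1) d)\<close>.  The bounds on quantifiers exclude nothing, as a code
  exceeds its components; they make the formulae \<open>\<Delta>\<^sub>0\<close>.\<close>

definition seqS :: "tm \<Rightarrow> tm \<Rightarrow> scheme" where
  "seqS s l = exlt s (\<lambda>c. exlt s (\<lambda>d. s \<doteq> pair l (pair c d)))"

definition nthS :: "tm \<Rightarrow> tm \<Rightarrow> tm \<Rightarrow> scheme" where
  "nthS s i x =
     exlt s (\<lambda>l. exlt s (\<lambda>c. exlt s (\<lambda>d. exlt s (\<lambda>q.
       s \<doteq> pair l (pair c d) \<^bold>\<and> i \<prec> l \<^bold>\<and>
       c \<doteq> Plus (Times q (Succ (Times (Succ i) d))) x \<^bold>\<and> x \<prec> Succ (Times (Succ i) d)))))"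

text \<open>A sequence also serves as a code of the finite set of its entries.\<close>

definition mem :: "tm \<Rightarrow> tm \<Rightarrow> scheme" where
  "mem x C = exlt C (\<lambda>i. nthS C i x)"
definition exin :: "tm \<Rightarrow> (tm \<Rightarrow> scheme) \<Rightarrow> scheme" where
  "exin C B = exlt C (\<lambda>x. mem x C \<^bold>\<and> B x)"
definition allin :: "tm \<Rightarrow> (tm \<Rightarrow> scheme) \<Rightarrow> scheme" where
  "allin C B = alllt C (\<lambda>x. mem x C \<^bold>\<longrightarrow> B x)"

text \<open>\<open>b\<close> is a sequence that results from the sequence \<open>a\<close> by changing the \<open>i\<close>-th entry to \<open>y\<close>.\<close>

definition updS :: "tm \<Rightarrow> tm \<Rightarrow> tm \<Rightarrow> tm \<Rightarrow> scheme" where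
  "updS a i y b =
     exlt a (\<lambda>l. seqS a l \<^bold>\<and> seqS b l \<^bold>\<and> nthS b i y \<^bold>\<and>
       alllt l (\<lambda>k. \<^bold>\<not> (k \<doteq> i) \<^bold>\<longrightarrow> alllt a (\<lambda>x. nthS a k x \<^bold>\<longrightarrow> nthS b k x)))"

text \<open>\<open>tmS n x\<close> and \<open>fmS n x\<close>: \<open>x\<close> codes an \<open>\<L>\<^sub>A\<close>-term (\<open>\<L>\<^sub>A\<close>-formula) all of whose variables, free
  and bound, are among \<open>v\<^sub>0,\<dots>,v\<^sub>n\<^sub>-\<^sub>1\<close>.  Here and below, a recursion on syntax is expressed by the
  existence of a coded set \<open>C\<close> each of whose elements is obtained by some clause of the recursion
  from other elements of \<open>C\<close>.\<close>

definition tmS :: "tm \<Rightarrow> tm \<Rightarrow> scheme" where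
  "tmS n x =
     (\<^bold>\<exists>C. mem x C \<^bold>\<and> allin C (\<lambda>u.
        exlt n (\<lambda>i. u \<doteq> cVar i) \<^bold>\<or>
        u \<doteq> cZero \<^bold>\<or>
        exin C (\<lambda>s. u \<doteq> cSucc s) \<^bold>\<or>
        exin C (\<lambda>s. exin C (\<lambda>t. u \<doteq> cPlus s t \<^bold>\<or> u \<doteq> cTimes s t))))"

definition fmS :: "tm \<Rightarrow> tm \<Rightarrow> scheme" where
  "fmS n x =
     (\<^bold>\<exists>C. mem x C \<^bold>\<and> allin C (\<lambda>u.
        (\<^bold>\<exists>s. \<^bold>\<exists>t. tmS n s \<^bold>\<and> tmS n t \<^bold>\<and> (u \<doteq> cEq s t \<^bold>\<or> u \<doteq> cLess s t)) \<^bold>\<or>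
        exin C (\<lambda>p. u \<doteq> cNeg p) \<^bold>\<or>
        exin C (\<lambda>p. exin C (\<lambda>q. u \<doteq> cOr p q)) \<^bold>\<or>
        exlt n (\<lambda>i. exin C (\<lambda>p. u \<doteq> cEx i p))))"


section \<open>The transformation \<open>\<phi> \<mapsto> \<phi>\<^sup>*\<close>\<close>

text \<open>A formula \<open>\<phi>\<close> with variables among \<open>v\<^sub>0,\<dots>,v\<^sub>n\<^sub>-\<^sub>1\<close> is transformed into \<open>\<phi>\<^sup>*\<close> with \<open>v\<^sub>n\<close>, \<open>v\<^sub>n\<^sub>+\<^sub>1\<close>,
  \<dots> in the role of \<open>z\<^sub>1, z\<^sub>2, \<dots>\<close>; these are never bound in \<open>\<phi>\<^sup>*\<close>.  \<open>tildeS n x y\<close>: \<open>y\<close> results from \<open>x\<close>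
  by replacing each \<open>z\<^sub>i\<close> by \<open>z\<^sub>i\<^sub>+\<^sub>1\<close>.\<close>

definition tildeS :: "tm \<Rightarrow> tm \<Rightarrow> tm \<Rightarrow> scheme" where
  "tildeS n x y =
     (\<^bold>\<exists>C. mem (pair x y) C \<^bold>\<and> allin C (\<lambda>w. \<^bold>\<exists>u. \<^bold>\<exists>v. w \<doteq> pair u v \<^bold>\<and>
        ((\<^bold>\<exists>i. i \<prec> n \<^bold>\<and> u \<doteq> cVar i \<^bold>\<and> v \<doteq> cVar i) \<^bold>\<or>
         (\<^bold>\<exists>i. \<^bold>\<not> (i \<prec> n) \<^bold>\<and> u \<doteq> cVar i \<^bold>\<and> v \<doteq> cVar (Succ i)) \<^bold>\<or>
         (u \<doteq> cZero \<^bold>\<and> v \<doteq> cZero) \<^bold>\<or>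
         (\<^bold>\<exists>p. \<^bold>\<exists>p'. mem (pair p p') C \<^bold>\<and>
            (u \<doteq> cSucc p \<^bold>\<and> v \<doteq> cSucc p' \<^bold>\<or>
             u \<doteq> cNeg p \<^bold>\<and> v \<doteq> cNeg p' \<^bold>\<or>
             (\<^bold>\<exists>i. i \<prec> n \<^bold>\<and> u \<doteq> cEx i p \<^bold>\<and> v \<doteq> cEx i p'))) \<^bold>\<or>
         (\<^bold>\<exists>p. \<^bold>\<exists>p'. \<^bold>\<exists>q. \<^bold>\<exists>q'. mem (pair p p') C \<^bold>\<and> mem (pair q q') C \<^bold>\<and>
            (u \<doteq> cPlus p q \<^bold>\<and> v \<doteq> cPlus p' q' \<^bold>\<or>
             u \<doteq> cTimes p q \<^bold>\<and> v \<doteq> cTimes p' q' \<^bold>\<or>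
             u \<doteq> cEq p q \<^bold>\<and> v \<doteq> cEq p' q' \<^bold>\<or>
             u \<doteq> cLess p q \<^bold>\<and> v \<doteq> cLess p' q' \<^bold>\<or>
             u \<doteq> cOr p q \<^bold>\<and> v \<doteq> cOr p' q')))))"

text \<open>\<open>starS n x y k\<close>: \<open>y\<close> codes \<open>\<phi>\<^sup>* = \<phi>\<^sup>*(\<dots>,z\<^sub>1,\<dots>,z\<^sub>k)\<close> for the formula \<open>\<phi>\<close> with code \<open>x\<close>.  The
  bounded quantifier \<open>\<exists>v\<^sub>i < z\<^sub>1 \<theta>\<close> is \<open>\<exists>v\<^sub>i (v\<^sub>i < z\<^sub>1 \<and> \<theta>)\<close>.\<close>

definition starS :: "tm \<Rightarrow> tm \<Rightarrow> tm \<Rightarrow> tm \<Rightarrow> scheme" where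
  "starS n x y k =
     (\<^bold>\<exists>C. mem (triple x y k) C \<^bold>\<and> allin C (\<lambda>w. \<^bold>\<exists>u. \<^bold>\<exists>v. \<^bold>\<exists>m. w \<doteq> triple u v m \<^bold>\<and>
        ((\<^bold>\<exists>s. \<^bold>\<exists>t. (u \<doteq> cEq s t \<^bold>\<or> u \<doteq> cLess s t) \<^bold>\<and> v \<doteq> u \<^bold>\<and> m \<doteq> Zero) \<^bold>\<or>
         (\<^bold>\<exists>p. \<^bold>\<exists>p'. mem (triple p p' m) C \<^bold>\<and> u \<doteq> cNeg p \<^bold>\<and> v \<doteq> cNeg p') \<^bold>\<or>
         (\<^bold>\<exists>p. \<^bold>\<exists>p'. \<^bold>\<exists>k1. \<^bold>\<exists>q. \<^bold>\<exists>q'. \<^bold>\<exists>k2.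
            mem (triple p p' k1) C \<^bold>\<and> mem (triple q q' k2) C \<^bold>\<and>
            u \<doteq> cOr p q \<^bold>\<and> v \<doteq> cOr p' q' \<^bold>\<and>
            (m \<doteq> k1 \<^bold>\<and> \<^bold>\<not> (k1 \<prec> k2) \<^bold>\<or> m \<doteq> k2 \<^bold>\<and> k1 \<prec> k2)) \<^bold>\<or>
         (\<^bold>\<exists>i. \<^bold>\<exists>p. \<^bold>\<exists>p'. \<^bold>\<exists>k1. \<^bold>\<exists>r.
            mem (triple p p' k1) C \<^bold>\<and> tildeS n p' r \<^bold>\<and>
            u \<doteq> cEx i p \<^bold>\<and> v \<doteq> cEx i (cAnd (cLess (cVar i) (cVar n)) r) \<^bold>\<and>
            m \<doteq> Succ k1))))"


section \<open>\<open>\<Sigma>\<^sub>1\<close> satisfaction for \<open>\<Delta>\<^sub>0\<close>-formulae\<close>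

text \<open>\<open>truthS v P\<close>: \<open>v\<close> is the truth value (1 or 0) of \<open>P\<close>.\<close>

definition truthS :: "tm \<Rightarrow> scheme \<Rightarrow> scheme" where
  "truthS v P = (v \<doteq> num 1 \<^bold>\<and> P \<^bold>\<or> v \<doteq> num 0 \<^bold>\<and> \<^bold>\<not> P)"

text \<open>\<open>evalS x b v\<close>: under the assignment \<open>v\<^sub>i \<mapsto> b\<^sub>i\<close> given by the sequence \<open>b\<close>, the term coded by \<open>x\<close>
  has value \<open>v\<close>, or the \<open>\<Delta>\<^sub>0\<close>-formula coded by \<open>x\<close> has truth value \<open>v\<close>.  The bounded quantifiers of
  \<open>\<Delta>\<^sub>0\<close>-formulae are \<open>\<exists>v\<^sub>i < v\<^sub>j\<close> with \<open>i \<noteq> j\<close>.  All quantifiers after \<open>\<exists>C\<close> are bounded.\<close>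

definition evalS :: "tm \<Rightarrow> tm \<Rightarrow> tm \<Rightarrow> scheme" where
  "evalS x0 b0 v0 =
     (\<^bold>\<exists>C. mem (triple x0 b0 v0) C \<^bold>\<and>
       allin C (\<lambda>w. exlt C (\<lambda>x. exlt C (\<lambda>b. exlt C (\<lambda>v. w \<doteq> triple x b v \<^bold>\<and>
        (exlt C (\<lambda>i. x \<doteq> cVar i \<^bold>\<and> nthS b i v) \<^bold>\<or>
         x \<doteq> cZero \<^bold>\<and> v \<doteq> Zero \<^bold>\<or>
         exlt C (\<lambda>y. exlt C (\<lambda>p. mem (triple y b p) C \<^bold>\<and>
           (x \<doteq> cSucc y \<^bold>\<and> v \<doteq> Succ p \<^bold>\<or>
            x \<doteq> cNeg y \<^bold>\<and> truthS v (\<^bold>\<not> (p \<doteq> num 1))))) \<^bold>\<or>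
         exlt C (\<lambda>y. exlt C (\<lambda>p. exlt C (\<lambda>z. exlt C (\<lambda>q.
           mem (triple y b p) C \<^bold>\<and> mem (triple z b q) C \<^bold>\<and>
           (x \<doteq> cPlus y z \<^bold>\<and> v \<doteq> Plus p q \<^bold>\<or>
            x \<doteq> cTimes y z \<^bold>\<and> v \<doteq> Times p q \<^bold>\<or>
            x \<doteq> cEq y z \<^bold>\<and> truthS v (p \<doteq> q) \<^bold>\<or>
            x \<doteq> cLess y z \<^bold>\<and> truthS v (p \<prec> q) \<^bold>\<or>
            x \<doteq> cOr y z \<^bold>\<and> truthS v (p \<doteq> num 1 \<^bold>\<or> q \<doteq> num 1)))))) \<^bold>\<or>
         exlt C (\<lambda>i. exlt C (\<lambda>j. exlt C (\<lambda>y. exlt C (\<lambda>p.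
           x \<doteq> cEx i (cAnd (cLess (cVar i) (cVar j)) y) \<^bold>\<and> \<^bold>\<not> (i \<doteq> j) \<^bold>\<and> nthS b j p \<^bold>\<and>
           (v \<doteq> num 1 \<^bold>\<and>
              exlt p (\<lambda>a. exlt C (\<lambda>b'. updS b i a b' \<^bold>\<and> mem (triple y b' (num 1)) C)) \<^bold>\<or>
            v \<doteq> num 0 \<^bold>\<and>
              alllt p (\<lambda>a. exlt C (\<lambda>b'. updS b i a b' \<^bold>\<and> mem (triple y b' (num 0)) C)))))))))))))"

definition satD0 :: "tm \<Rightarrow> tm \<Rightarrow> scheme" where
  "satD0 x b = evalS x b (num 1)"


section \<open>The sentence \<open>\<alpha>\<close>\<close>

text \<open>\<open>j\<close> exceeds \<open>\<phi>\<close> and all entries of the sequence \<open>a\<close>.\<close>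

definition exceeds :: "tm \<Rightarrow> tm \<Rightarrow> tm \<Rightarrow> scheme" where
  "exceeds j phi a = (phi \<prec> j \<^bold>\<and> (\<^bold>\<forall>s. \<^bold>\<forall>x. nthS a s x \<^bold>\<longrightarrow> x \<prec> j))"

definition nextI :: "tm \<Rightarrow> tm \<Rightarrow> scheme" where
  "nextI x y = (inI y \<^bold>\<and> x \<prec> y \<^bold>\<and> \<^bold>\<not> (\<^bold>\<exists>z. inI z \<^bold>\<and> x \<prec> z \<^bold>\<and> z \<prec> y))"

text \<open>In \<open>\<langle>\<phi>,a\<rangle>\<close>, \<open>a\<close> is a sequence whose length \<open>n\<close> is such that \<open>\<phi>\<close> is a formula in the variables
  \<open>v\<^sub>0,\<dots>,v\<^sub>n\<^sub>-\<^sub>1\<close>.  The sequence \<open>e\<close> below is \<open>j < i\<^sub>1 < \<dots> < i\<^sub>k\<close>, and \<open>b\<close> is the concatenation of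
  \<open>a\<close> and \<open>i\<^sub>1,\<dots>,i\<^sub>k\<close>.\<close>

definition sigma :: "tm \<Rightarrow> scheme" where
  "sigma x =
     (\<^bold>\<exists>phi. \<^bold>\<exists>a. \<^bold>\<exists>n. \<^bold>\<exists>psi. \<^bold>\<exists>k. \<^bold>\<exists>j. \<^bold>\<exists>e. \<^bold>\<exists>b.
        x \<doteq> pair phi a \<^bold>\<and> seqS a n \<^bold>\<and> fmS n phi \<^bold>\<and> starS n phi psi k \<^bold>\<and>
        inI j \<^bold>\<and> exceeds j phi a \<^bold>\<and> \<^bold>\<not> (\<^bold>\<exists>j'. inI j' \<^bold>\<and> exceeds j' phi a \<^bold>\<and> j' \<prec> j) \<^bold>\<and>
        seqS e (Succ k) \<^bold>\<and> nthS e Zero j \<^bold>\<and>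
        (\<^bold>\<forall>s. s \<prec> k \<^bold>\<longrightarrow> (\<^bold>\<exists>y. \<^bold>\<exists>z. nthS e s y \<^bold>\<and> nthS e (Succ s) z \<^bold>\<and> nextI y z)) \<^bold>\<and>
        seqS b (Plus n k) \<^bold>\<and>
        (\<^bold>\<forall>s. s \<prec> n \<^bold>\<longrightarrow> (\<^bold>\<exists>y. nthS a s y \<^bold>\<and> nthS b s y)) \<^bold>\<and>
        (\<^bold>\<forall>s. s \<prec> k \<^bold>\<longrightarrow> (\<^bold>\<exists>y. nthS e (Succ s) y \<^bold>\<and> nthS b (Plus n s) y)) \<^bold>\<and>
        satD0 psi b)"

definition tarskiS :: "(tm \<Rightarrow> scheme) \<Rightarrow> scheme" where
  "tarskiS S =
     (\<^bold>\<forall>n. \<^bold>\<forall>a. seqS a n \<^bold>\<longrightarrow>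
        (\<^bold>\<forall>s. \<^bold>\<forall>t. tmS n s \<^bold>\<and> tmS n t \<^bold>\<longrightarrow>
           (S (pair (cEq s t) a) \<^bold>\<longleftrightarrow> (\<^bold>\<exists>y. \<^bold>\<exists>z. evalS s a y \<^bold>\<and> evalS t a z \<^bold>\<and> y \<doteq> z)) \<^bold>\<and>
           (S (pair (cLess s t) a) \<^bold>\<longleftrightarrow> (\<^bold>\<exists>y. \<^bold>\<exists>z. evalS s a y \<^bold>\<and> evalS t a z \<^bold>\<and> y \<prec> z))) \<^bold>\<and>
        (\<^bold>\<forall>p. fmS n p \<^bold>\<longrightarrow>
           (S (pair (cNeg p) a) \<^bold>\<longleftrightarrow> \<^bold>\<not> S (pair p a))) \<^bold>\<and>
        (\<^bold>\<forall>p. \<^bold>\<forall>q. fmS n p \<^bold>\<and> fmS n q \<^bold>\<longrightarrow>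
           (S (pair (cOr p q) a) \<^bold>\<longleftrightarrow> S (pair p a) \<^bold>\<or> S (pair q a))) \<^bold>\<and>
        (\<^bold>\<forall>i. \<^bold>\<forall>p. i \<prec> n \<^bold>\<and> fmS n p \<^bold>\<longrightarrow>
           (S (pair (cEx i p) a) \<^bold>\<longleftrightarrow> (\<^bold>\<exists>y. \<^bold>\<exists>b. updS a i y b \<^bold>\<and> S (pair p b)))))"

definition alpha :: fm where
  "alpha = tarskiS sigma 0"

end

theory Submission
  imports Defs "HOL-Library.Ramsey" "HOL-Library.Diagonal_Subsequence" "HOL-Library.Countable_Set"
begin

text \<open>
  Given a model \<open>M\<close>, let \<open>N\<close> be \<open>M\<close> with the least element \<open>c\<close> of \<open>I\<close> removed from \<open>I\<close>.  Then \<open>M\<close> and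
  \<open>N\<close> define each other with the parameter \<open>c\<close>, so that \<open>M\<close> itself serves as \<open>M\<^sup>*\<close>.  An \<open>M\<close>-definable
  isomorphism \<open>M \<rightarrow> N\<close> preserves \<open>0\<close> and the successor, hence is the identity by induction in \<open>M\<close>,
  which is absurd since \<open>c\<close> lies in \<open>I\<close> in \<open>M\<close> but not in \<open>N\<close>.

  The difficulty is that \<open>N\<close> satisfies \<open>\<alpha>\<close> if \<open>M\<close> does.  By an induction inside \<open>M\<close> on the possibly
  nonstandard \<open>\<phi>\<close>, the value of \<open>\<phi>\<^sup>*(a, i\<^sub>1, \<dots>, i\<^sub>k)\<close> is the same for every \<open>j \<in> I\<close> exceeding \<open>\<phi>\<close> and \<open>a\<close>,
  not just for the least one: by the clause for \<open>\<exists>\<close>, a witness that exists at all already exists below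
  the bound belonging to the least \<open>j\<close>.  Therefore every definable final segment of \<open>I\<close> defines the
  same satisfaction class.

  Failure of solidity needs in addition a model of the strongest theory.  A sufficiently sparse
  subset of the natural numbers gives \<open>\<alpha>\<close>, and by Ramsey's theorem it can be thinned out so as to be
  indiscernible above each formula.  In a countable definable ultrapower along a cohesive sequence,
  the elements of the extended set above an infinite element are indiscernible for all formulas.
\<close>

section \<open>Renaming and substitution\<close>

text \<open>Two obstacles shape the proof. Inside \<open>M\<close> a formula may be nonstandard, so
  recursion and induction on syntax must be carried out by definable means; hence the locales for
  definability and the certificates for recursions. The internal induction,
  \<open>represents\<close>, is stated for any satisfaction class \<open>S\<close> and any set
  \<open>J\<close> in which true existential formulae have witnesses below the next element, because
  it serves twice: for \<open>sig I\<close> in a model of \<alpha>, and for true arithmetic in the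
  standard model, where the growth of \<open>J\<close> supplies the witnesses. In the standard model
  every element is definable, so no unbounded set is indiscernible for all formulae at once:
  thresholds depending on the formula are unavoidable, and \<open>PAI\<close> has only nonstandard
  models. An infinite element lies above all thresholds. Cutting \<open>I\<close> off there gives a
  final segment, so the result on final segments is used again to preserve \<alpha>. The model is
  built on \<open>nat\<close>, where solidity is to be refuted, which is why the ultrapower must be
  countable.\<close>

primrec rn_tm :: "(nat \<Rightarrow> nat) \<Rightarrow> tm \<Rightarrow> tm" where
  "rn_tm r (Var i) = Var (r i)"
| "rn_tm r Zero = Zero"
| "rn_tm r (Succ t) = Succ (rn_tm r t)"
| "rn_tm r (Plus t u) = Plus (rn_tm r t) (rn_tm r u)"
| "rn_tm r (Times t u) = Times (rn_tm r t) (rn_tm r u)"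

primrec rn :: "(nat \<Rightarrow> nat) \<Rightarrow> fm \<Rightarrow> fm" where
  "rn r (Eq t u) = Eq (rn_tm r t) (rn_tm r u)"
| "rn r (Less t u) = Less (rn_tm r t) (rn_tm r u)"
| "rn r (InI t) = InI (rn_tm r t)"
| "rn r (Neg p) = Neg (rn r p)"
| "rn r (Or p q) = Or (rn r p) (rn r q)"
| "rn r (Ex i p) = Ex (r i) (rn r p)"

lemma val_rn: "val M s (rn_tm r t) = val M (s \<circ> r) t"
  by (induction t) auto

text \<open>Bound variables are renamed along with the free ones, so an injective renaming cannot
  capture; updating \<open>r i\<close> then amounts to updating \<open>i\<close> before
  renaming.\<close>

lemma sat_rn: "inj r \<Longrightarrow> sat M s (rn r p) \<longleftrightarrow> sat M (s \<circ> r) p"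
proof (induction p arbitrary: s)
  case (Ex i p)
  have "s(r i := a) \<circ> r = (s \<circ> r)(i := a)" for a
    using Ex.prems by (auto simp: fun_eq_iff inj_eq)
  then show ?case using Ex by (simp del: fun_upd_apply o_apply)
qed (simp_all add: val_rn)

lemma shift_tm_eq_rn_tm: "shift_tm n t = rn_tm ((+) n) t"
  by (induction t) auto

lemma shift_eq_rn: "shift n p = rn ((+) n) p"
  by (induction p) (auto simp: shift_tm_eq_rn_tm)

lemma sat_shift: "sat M s (shift n p) \<longleftrightarrow> sat M (\<lambda>i. s (n + i)) p"
  by (simp add: shift_eq_rn sat_rn comp_def)

lemma val_cong: "(\<And>i. i \<in> fv_tm t \<Longrightarrow> s i = s' i) \<Longrightarrow> val M s t = val M s' t"
  by (induction t) auto

lemma sat_cong: "(\<And>i. i \<in> fv p \<Longrightarrow> s i = s' i) \<Longrightarrow> sat M s p \<longleftrightarrow> sat M s' p"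
proof (induction p arbitrary: s s')
  case (Eq t u)
  have "val M s t = val M s' t" "val M s u = val M s' u"
    by (rule val_cong, use Eq in simp)+
  then show ?case by simp
next
  case (Less t u)
  have "val M s t = val M s' t" "val M s u = val M s' u"
    by (rule val_cong, use Less in simp)+
  then show ?case by simp
next
  case (InI t)
  have "val M s t = val M s' t"
    by (rule val_cong) (use InI in simp)
  then show ?case by simp
next
  case (Neg p)
  have "sat M s p \<longleftrightarrow> sat M s' p"
    by (rule Neg.IH) (use Neg.prems in simp)
  then show ?case by simp
next
  case (Or p q)
  have "sat M s p \<longleftrightarrow> sat M s' p" "sat M s q \<longleftrightarrow> sat M s' q"
    by (rule Or.IH, use Or.prems in simp)+
  then show ?case by simp
next
  case (Ex i p)
  have "sat M (s(i := a)) p \<longleftrightarrow> sat M (s'(i := a)) p" for a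
    by (rule Ex.IH) (use Ex.prems in auto)
  then show ?case by simp
qed

lemma finite_fv_tm [simp]: "finite (fv_tm t)"
  by (induction t) auto

lemma finite_fv [simp]: "finite (fv p)"
  by (induction p) auto

lemma fv_bounded: "\<exists>N. \<forall>i\<in>fv p. i < N"
  using finite_nat_set_iff_bounded[of "fv p"] by simp

lemma val_subst_tm: "val M s (subst_tm x r t) = val M (s(x := val M s r)) t"
  by (induction t) auto

lemma sat_subst:
  "fv_tm r \<subseteq> {x} \<Longrightarrow> sat M s (subst x r p) \<longleftrightarrow> sat M (s(x := val M s r)) p"
proof (induction p arbitrary: s)
  case (Ex i p)
  have "val M (s(i := a)) r = val M s r" if "i \<noteq> x" for a
    by (rule val_cong) (use that Ex.prems in auto)
  then show ?case using Ex by (auto simp: fun_upd_twist simp del: fun_upd_apply)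
qed (simp_all add: val_subst_tm)

lemma sat_And [simp]: "sat M s (And p q) \<longleftrightarrow> sat M s p \<and> sat M s q"
  by (simp add: And_def)

lemma sat_Imp [simp]: "sat M s (Imp p q) \<longleftrightarrow> (sat M s p \<longrightarrow> sat M s q)"
  by (simp add: Imp_def)

lemma sat_Iff [simp]: "sat M s (Iff p q) \<longleftrightarrow> (sat M s p \<longleftrightarrow> sat M s q)"
  by (auto simp: Iff_def)

lemma sat_All [simp]: "sat M s (All i p) \<longleftrightarrow> (\<forall>a\<in>univ M. sat M (s(i := a)) p)"
  by (simp add: All_def)

lemma sat_Induct:
  "sat M s (Induct x p) \<longleftrightarrow>
     (sat M (s(x := zer M)) p \<and>
      (\<forall>a\<in>univ M. sat M (s(x := a)) p \<longrightarrow> sat M (s(x := suc M a)) p) \<longrightarrow>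
      (\<forall>a\<in>univ M. sat M (s(x := a)) p))"
  by (simp add: Induct_def sat_subst)

lemma sat_IncrI:
  "sat M s (IncrI i m) \<longleftrightarrow>
     (\<forall>k\<le>m. s (i + k) \<in> ind M) \<and> (\<forall>k<m. lt M (s (i + k)) (s (i + Suc k)))"
  by (induction m) (auto simp: le_Suc_eq less_Suc_eq)

lemma range_upd: "range s \<subseteq> A \<Longrightarrow> a \<in> A \<Longrightarrow> range (s(i := a)) \<subseteq> A"
  by auto

lemma val_in_univ: "is_struct M \<Longrightarrow> range s \<subseteq> univ M \<Longrightarrow> val M s t \<in> univ M"
  by (induction t) (auto simp: is_struct_def)

text \<open>The hypotheses spell out \<open>isomorphism\<close>, which relates structures over one
  type, whereas \<open>h\<close> here may lead to another type.\<close>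

lemma sat_iso:
  assumes M: "is_struct M" and bij: "bij_betw h (univ M) (univ N)"
    and ops: "h (zer M) = zer N" "\<And>x. x \<in> univ M \<Longrightarrow> h (suc M x) = suc N (h x)"
      "\<And>x y. x \<in> univ M \<Longrightarrow> y \<in> univ M \<Longrightarrow> h (add M x y) = add N (h x) (h y)"
      "\<And>x y. x \<in> univ M \<Longrightarrow> y \<in> univ M \<Longrightarrow> h (mul M x y) = mul N (h x) (h y)"
      "\<And>x y. x \<in> univ M \<Longrightarrow> y \<in> univ M \<Longrightarrow> lt M x y \<longleftrightarrow> lt N (h x) (h y)"
      "\<And>x. x \<in> univ M \<Longrightarrow> x \<in> ind M \<longleftrightarrow> h x \<in> ind N"
    and s: "range s \<subseteq> univ M"
  shows "sat N (h \<circ> s) p \<longleftrightarrow> sat M s p"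
proof -
  have val: "val N (h \<circ> s) t = h (val M s t)" if "range s \<subseteq> univ M" for s t
    using that
  proof (induction t)
    case (Var x)
    then show ?case by simp
  next
    case Zero
    then show ?case by (simp add: ops)
  next
    case (Succ t)
    then show ?case by (simp add: ops val_in_univ[OF M])
  next
    case (Plus t u)
    then show ?case by (simp add: ops val_in_univ[OF M])
  next
    case (Times t u)
    then show ?case by (simp add: ops val_in_univ[OF M])
  qed
  have inj: "h x = h y \<longleftrightarrow> x = y" if "x \<in> univ M" "y \<in> univ M" for x y
    using bij that by (auto simp: bij_betw_def inj_on_eq_iff)
  show ?thesis using s
  proof (induction p arbitrary: s)
    case (Ex i p)
    have "(\<exists>b\<in>univ N. sat N ((h \<circ> s)(i := b)) p) \<longleftrightarrow> (\<exists>a\<in>univ M. sat N ((h \<circ> s)(i := h a)) p)"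
      using bij unfolding bij_betw_def by (metis imageE imageI)
    moreover have "(h \<circ> s)(i := h a) = h \<circ> (s(i := a))" for a by auto
    ultimately show ?case using Ex.IH[OF range_upd[OF Ex.prems]] by (simp del: fun_upd_apply o_apply)
  qed (simp_all add: val val_in_univ[OF M] inj flip: ops)
qed


section \<open>Definability with parameters\<close>

text \<open>A predicate on assignments is read as a predicate with de Bruijn variables: \<open>s 0\<close> is the
  variable bound by the innermost quantifier.\<close>

locale dclass =
  fixes U :: "'a set" and D :: "((nat \<Rightarrow> 'a) \<Rightarrow> bool) \<Rightarrow> bool"
  assumes D_Not: "D P \<Longrightarrow> D (\<lambda>s. \<not> P s)"
    and D_or: "D P \<Longrightarrow> D Q \<Longrightarrow> D (\<lambda>s. P s \<or> Q s)"
    and D_bex: "D (\<lambda>s. F (\<lambda>i. s (Suc i)) (s 0)) \<Longrightarrow> D (\<lambda>s. \<exists>y\<in>U. F s y)"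
    and D_rename: "D P \<Longrightarrow> inj r \<Longrightarrow> D (\<lambda>s. P (\<lambda>i. s (r i)))"
    and D_eq_var: "D (\<lambda>s. s i = s j)"
    and D_eq_const: "c \<in> U \<Longrightarrow> D (\<lambda>s. s i = c)"
    and D_cong: "(\<And>s. range s \<subseteq> U \<Longrightarrow> P s \<longleftrightarrow> Q s) \<Longrightarrow> D P \<Longrightarrow> D Q"
begin

lemma D_and: "D P \<Longrightarrow> D Q \<Longrightarrow> D (\<lambda>s. P s \<and> Q s)"
  using D_Not[OF D_or[OF D_Not D_Not], of P Q] by simp

lemma D_imp: "D P \<Longrightarrow> D Q \<Longrightarrow> D (\<lambda>s. P s \<longrightarrow> Q s)"
  unfolding imp_conv_disj by (intro D_or D_Not)

lemma D_iff: "D P \<Longrightarrow> D Q \<Longrightarrow> D (\<lambda>s. P s \<longleftrightarrow> Q s)"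
  unfolding iff_conv_conj_imp by (intro D_and D_imp)

lemma D_ball: "D (\<lambda>s. F (\<lambda>i. s (Suc i)) (s 0)) \<Longrightarrow> D (\<lambda>s. \<forall>y\<in>U. F s y)"
  using D_Not[OF D_bex[of "\<lambda>s y. \<not> F s y", OF D_Not]] by simp

lemma D_bool: "D (\<lambda>s. b)"
proof -
  have "D (\<lambda>s. s 0 = s 0)" by (rule D_eq_var)
  then have T: "D (\<lambda>s. True)" by simp
  then show ?thesis using D_Not[OF T] by (cases b) auto
qed

text \<open>The graph of \<open>f\<close> has the value in variable 0 and the arguments moved up by
  one, the shape in which \<open>D_bex\<close> quantifies over an intermediate value.\<close>

definition Fn :: "((nat \<Rightarrow> 'a) \<Rightarrow> 'a) \<Rightarrow> bool" where
  "Fn f \<longleftrightarrow> (\<forall>s. range s \<subseteq> U \<longrightarrow> f s \<in> U) \<and> D (\<lambda>s. s 0 = f (\<lambda>i. s (Suc i)))"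

lemma Fn_in: "Fn f \<Longrightarrow> range s \<subseteq> U \<Longrightarrow> f s \<in> U"
  by (simp add: Fn_def)

lemma range_case_nat: "range s \<subseteq> U \<Longrightarrow> a \<in> U \<Longrightarrow> range (case_nat a s) \<subseteq> U"
  by (auto simp: image_subset_iff split: nat.splits)

lemma case_nat_eta: "case_nat (s 0) (\<lambda>i. s (Suc i)) = (s :: nat \<Rightarrow> 'b)"
  by (auto simp: fun_eq_iff split: nat.splits)

lemma Fn_var: "Fn (\<lambda>s. s i)"
  by (auto simp: Fn_def intro: D_eq_var)

lemma Fn_const: "c \<in> U \<Longrightarrow> Fn (\<lambda>s. c)"
  by (auto simp: Fn_def intro: D_eq_const)

lemma Fn_shift: "Fn f \<Longrightarrow> Fn (\<lambda>s. f (\<lambda>i. s (Suc i)))"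
proof -
  assume f: "Fn f"
  define r where "r = case_nat (0::nat) (\<lambda>i. Suc (Suc i))"
  have r: "inj r" by (auto simp: r_def inj_on_def split: nat.splits)
  have "D (\<lambda>s. s 0 = f (\<lambda>i. s (Suc i)))" using f by (simp add: Fn_def)
  from D_rename[OF this r] have "D (\<lambda>s. s 0 = f (\<lambda>i. s (Suc (Suc i))))" by (simp add: r_def)
  moreover have "f (\<lambda>i. s (Suc i)) \<in> U" if "range s \<subseteq> U" for s
    using that by (intro Fn_in[OF f]) auto
  ultimately show ?thesis by (simp add: Fn_def)
qed

text \<open>A definable function is substituted by quantifying over its value: some \<open>y\<close>
  equals \<open>f s\<close> and satisfies \<open>P\<close>. Through this and the variants of
  \<open>D_app1\<close>, definability proofs become a mere descent through the expression.\<close>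

lemma D_subst:
  assumes P: "D P" and f: "Fn f" shows "D (\<lambda>s. P (case_nat (f s) s))"
proof -
  have "D (\<lambda>s. s 0 = f (\<lambda>i. s (Suc i)) \<and> P s)"
    using f P by (auto simp: Fn_def intro: D_and)
  then have "D (\<lambda>s. \<exists>y\<in>U. y = f s \<and> P (case_nat y s))"
    by (intro D_bex) (simp add: case_nat_eta)
  then show ?thesis
    by (rule D_cong[rotated]) (use Fn_in[OF f] in auto)
qed

lemma D_subst': "D (\<lambda>s. Q (s 0) (\<lambda>i. s (Suc i))) \<Longrightarrow> Fn f \<Longrightarrow> D (\<lambda>s. Q (f s) s)"
  by (drule D_subst) simp_all

lemma D_app1: "D (\<lambda>s. R (s 0)) \<Longrightarrow> Fn f \<Longrightarrow> D (\<lambda>s. R (f s))"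
  by (rule D_subst')

lemma D_app2:
  assumes R: "D (\<lambda>s. R (s 1) (s 0))" and f: "Fn f" and g: "Fn g"
  shows "D (\<lambda>s. R (f s) (g s))"
proof (rule D_subst'[where Q = "\<lambda>y s. R y (g s)", OF _ f])
  show "D (\<lambda>s. R (s 0) (g (\<lambda>i. s (Suc i))))"
    by (rule D_subst'[where Q = "\<lambda>y s. R (s 0) y", OF _ Fn_shift[OF g]]) (use R in simp)
qed

lemma D_app3:
  assumes R: "D (\<lambda>s. R (s 2) (s 1) (s 0))" and f: "Fn f" and g: "Fn g" and h: "Fn h"
  shows "D (\<lambda>s. R (f s) (g s) (h s))"
proof (rule D_subst'[where Q = "\<lambda>y s. R y (g s) (h s)", OF _ f])
  have "D (\<lambda>s. R (s 1) (s 0) (h (\<lambda>i. s (Suc (Suc i)))))"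
    by (rule D_subst'[where Q = "\<lambda>y s. R (s 1) (s 0) y", OF _ Fn_shift[OF Fn_shift[OF h]]])
      (use R in \<open>simp add: numeral_2_eq_2\<close>)
  then show "D (\<lambda>s. R (s 0) (g (\<lambda>i. s (Suc i))) (h (\<lambda>i. s (Suc i))))"
    by (intro D_subst'[where Q = "\<lambda>y s. R (s 0) y (h (\<lambda>i. s (Suc i)))", OF _ Fn_shift[OF g]]) simp
qed

lemma D_app4:
  assumes R: "D (\<lambda>s. R (s 3) (s 2) (s 1) (s 0))" and f: "Fn f" and g: "Fn g" and h: "Fn h" and k: "Fn k"
  shows "D (\<lambda>s. R (f s) (g s) (h s) (k s))"
proof (rule D_subst'[where Q = "\<lambda>y s. R y (g s) (h s) (k s)", OF _ f])
  have "D (\<lambda>s. R (s 2) (s 1) (s 0) (k (\<lambda>i. s (Suc (Suc (Suc i))))))"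
    by (rule D_subst'[where Q = "\<lambda>y s. R (s 2) (s 1) (s 0) y", OF _ Fn_shift[OF Fn_shift[OF Fn_shift[OF k]]]])
      (use R in \<open>simp add: eval_nat_numeral\<close>)
  then have "D (\<lambda>s. R (s 1) (s 0) (h (\<lambda>i. s (Suc (Suc i)))) (k (\<lambda>i. s (Suc (Suc i)))))"
    by (intro D_subst'[where Q = "\<lambda>y s. R (s 1) (s 0) y (k (\<lambda>i. s (Suc (Suc i))))",
        OF _ Fn_shift[OF Fn_shift[OF h]]]) (simp add: eval_nat_numeral)
  then show "D (\<lambda>s. R (s 0) (g (\<lambda>i. s (Suc i))) (h (\<lambda>i. s (Suc i))) (k (\<lambda>i. s (Suc i))))"
    by (intro D_subst'[where Q = "\<lambda>y s. R (s 0) y (h (\<lambda>i. s (Suc i))) (k (\<lambda>i. s (Suc i)))",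
        OF _ Fn_shift[OF g]]) simp
qed

lemma D_eq: "Fn f \<Longrightarrow> Fn g \<Longrightarrow> D (\<lambda>s. f s = g s)"
  by (rule D_app2) (rule D_eq_var)

lemma Fn_app1:
  assumes h: "Fn (\<lambda>s. h (s 0))" and f: "Fn f" shows "Fn (\<lambda>s. h (f s))"
  unfolding Fn_def
proof (intro conjI allI impI)
  show "h (f s) \<in> U" if "range s \<subseteq> U" for s
    using Fn_in[OF h range_case_nat[OF that Fn_in[OF f that]]] by simp
  have "D (\<lambda>s. s 1 = h (s 0))"
    using D_app2[where R = "\<lambda>x y. y = h x", of "\<lambda>s. s 0" "\<lambda>s. s 1"] Fn_var h by (simp add: Fn_def)
  from D_subst'[where Q = "\<lambda>y s. s 0 = h y", OF _ Fn_shift[OF f]] this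
  show "D (\<lambda>s. s 0 = h (f (\<lambda>i. s (Suc i))))" by simp
qed

lemma Fn_app2:
  assumes h: "Fn (\<lambda>s. h (s 1) (s 0))" and f: "Fn f" and g: "Fn g" shows "Fn (\<lambda>s. h (f s) (g s))"
  unfolding Fn_def
proof (intro conjI allI impI)
  show "h (f s) (g s) \<in> U" if s: "range s \<subseteq> U" for s
    using Fn_in[OF h range_case_nat[OF range_case_nat[OF s Fn_in[OF f s]] Fn_in[OF g s]]] by simp
  have h': "D (\<lambda>s. s 0 = h (s 2) (s 1))"
    using h by (simp add: Fn_def numeral_2_eq_2)
  show "D (\<lambda>s. s 0 = h (f (\<lambda>i. s (Suc i))) (g (\<lambda>i. s (Suc i))))"
    using D_app3[where R = "\<lambda>x y z. z = h x y", OF h' Fn_shift[OF f] Fn_shift[OF g] Fn_var[of 0]] by simp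
qed

end

text \<open>\<open>N\<close> is kept apart from the structure that generates \<open>D\<close>, so
  that \<open>N\<close> can be an expansion of it by a definable set.\<close>

locale dstruct = dclass U D for U :: "'a set" and D +
  fixes N :: "'a struct"
  assumes univ_N: "univ N = U" and struct_N: "is_struct N"
    and Fn_suc: "Fn (\<lambda>s. suc N (s 0))"
    and Fn_add: "Fn (\<lambda>s. add N (s 1) (s 0))"
    and Fn_mul: "Fn (\<lambda>s. mul N (s 1) (s 0))"
    and D_lt: "D (\<lambda>s. lt N (s 1) (s 0))"
    and D_ind: "D (\<lambda>s. s 0 \<in> ind N)"
begin

lemma Fn_val: "(\<And>i. Fn (f i)) \<Longrightarrow> Fn (\<lambda>s. val N (\<lambda>i. f i s) t)"
proof (induction t)
  case Zero
  have "zer N \<in> U" using struct_N univ_N by (simp add: is_struct_def)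
  then show ?case by (simp add: Fn_const)
next
  case (Succ t)
  show ?case by (simp, rule Fn_app1[OF Fn_suc Succ.IH[OF Succ.prems]])
next
  case (Plus t u)
  show ?case by (simp, rule Fn_app2[OF Fn_add Plus.IH(1)[OF Plus.prems] Plus.IH(2)[OF Plus.prems]])
next
  case (Times t u)
  show ?case by (simp, rule Fn_app2[OF Fn_mul Times.IH(1)[OF Times.prems] Times.IH(2)[OF Times.prems]])
qed simp

text \<open>This translates named variables into de Bruijn indices: \<open>f i\<close> is the
  definable value currently given to the variable numbered \<open>i\<close>. Letting these values be
  functions makes the induction pass through quantifiers.\<close>

lemma D_sat: "(\<And>i. Fn (f i)) \<Longrightarrow> D (\<lambda>s. sat N (\<lambda>i. f i s) p)"
proof (induction p arbitrary: f)
  case (Eq t u)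
  show ?case by (simp, rule D_eq[OF Fn_val Fn_val]) (rule Eq)+
next
  case (Less t u)
  show ?case by (simp, rule D_app2[OF D_lt Fn_val Fn_val]) (rule Less)+
next
  case (InI t)
  show ?case by (simp, rule D_app1[where R = "\<lambda>x. x \<in> ind N", OF D_ind Fn_val]) (rule InI)
next
  case (Neg p)
  show ?case by (simp, rule D_Not[OF Neg.IH]) (rule Neg)
next
  case (Or p q)
  show ?case by (simp, rule D_or[OF Or.IH]) (rule Or)+
next
  case (Ex v p)
  \<comment> \<open>The bound variable takes over index 0, and every other value is read past
    it.\<close>
  define f' where "f' i = (if i = v then (\<lambda>s. s 0) else (\<lambda>s. f i (\<lambda>j. s (Suc j))))" for i
  have "Fn (f' i)" for i
    using Ex.prems by (auto simp: f'_def intro: Fn_var Fn_shift)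
  from Ex.IH[OF this] have "D (\<lambda>s. sat N (\<lambda>i. f' i s) p)" .
  moreover have "(\<lambda>i. f' i s) = (\<lambda>i. f i (\<lambda>j. s (Suc j)))(v := s 0)" for s
    by (auto simp: f'_def)
  ultimately have "D (\<lambda>s. sat N ((\<lambda>i. f i (\<lambda>j. s (Suc j)))(v := s 0)) p)" by simp
  then show ?case unfolding sat.simps univ_N by (rule D_bex)
qed

end

definition env :: "'a list \<Rightarrow> (nat \<Rightarrow> 'a) \<Rightarrow> nat \<Rightarrow> 'a" where
  "env cs s i = (if i < length cs then cs ! i else s (i - length cs))"

text \<open>Parameters form a finite list, unlike the assignment \<open>q\<close> in
  \<open>definable\<close>: two lists merge by appending, and with all of \<open>nat\<close> as
  universe only countably many predicates arise.\<close>

definition Df :: "'a struct \<Rightarrow> ((nat \<Rightarrow> 'a) \<Rightarrow> bool) \<Rightarrow> bool" where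
  "Df M P \<longleftrightarrow> (\<exists>cs p. set cs \<subseteq> univ M \<and>
     (\<forall>s. range s \<subseteq> univ M \<longrightarrow> (P s \<longleftrightarrow> sat M (env cs s) p)))"

lemma Df_I:
  assumes "set cs \<subseteq> univ M" "\<And>s. range s \<subseteq> univ M \<Longrightarrow> P s \<longleftrightarrow> sat M (env cs s) p"
  shows "Df M P"
  using assms unfolding Df_def by blast

lemma Df_E:
  assumes "Df M P"
  obtains cs p where "set cs \<subseteq> univ M" "\<forall>s. range s \<subseteq> univ M \<longrightarrow> (P s \<longleftrightarrow> sat M (env cs s) p)"
  using assms unfolding Df_def by blast

lemma range_env: "set cs \<subseteq> A \<Longrightarrow> range s \<subseteq> A \<Longrightarrow> range (env cs s) \<subseteq> A"
  by (auto simp: env_def image_subset_iff)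

lemma Df_or:
  assumes "Df M P" "Df M Q" shows "Df M (\<lambda>s. P s \<or> Q s)"
proof -
  obtain cs p where cs: "set cs \<subseteq> univ M" and p: "\<forall>s. range s \<subseteq> univ M \<longrightarrow> (P s \<longleftrightarrow> sat M (env cs s) p)"
    by (rule Df_E[OF assms(1)])
    note p = p[rule_format]
  obtain ds q where ds: "set ds \<subseteq> univ M" and q: "\<forall>s. range s \<subseteq> univ M \<longrightarrow> (Q s \<longleftrightarrow> sat M (env ds s) q)"
    by (rule Df_E[OF assms(2)])
    note q = q[rule_format]
  \<comment> \<open>In \<open>cs @ ds\<close> the block \<open>cs\<close> stays in place and
    everything after it moves past \<open>ds\<close>; for \<open>q\<close> all variables move past
    \<open>cs\<close>.\<close>
  define r1 where "r1 i = (if i < length cs then i else i + length ds)" for i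
  define r2 where "r2 i = i + length cs" for i :: nat
  have "inj r1" "inj r2" by (auto simp: r1_def r2_def inj_on_def split: if_splits)
  moreover have "env (cs @ ds) s \<circ> r1 = env cs s" "env (cs @ ds) s \<circ> r2 = env ds s" for s
    by (auto simp: env_def r1_def r2_def nth_append fun_eq_iff)
  ultimately show ?thesis using cs ds p q
    by (intro Df_I[of "cs @ ds" M _ "Or (rn r1 p) (rn r2 q)"]) (simp_all add: sat_rn)
qed

lemma Df_bex:
  assumes "Df M (\<lambda>s. F (\<lambda>i. s (Suc i)) (s 0))" shows "Df M (\<lambda>s. \<exists>y\<in>univ M. F s y)"
proof -
  obtain cs p where cs: "set cs \<subseteq> univ M"
    and p: "\<forall>s. range s \<subseteq> univ M \<longrightarrow> (F (\<lambda>i. s (Suc i)) (s 0) \<longleftrightarrow> sat M (env cs s) p)"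
    by (rule Df_E[OF assms])
    note p = p[rule_format]
  obtain N0 where "\<forall>i\<in>fv p. i < N0" using fv_bounded by blast
  define k where "k = length cs"
  define N where "N = N0 + Suc k"
  have N: "\<And>i. i \<in> fv p \<Longrightarrow> i < N" "k < N"
    using \<open>\<forall>i\<in>fv p. i < N0\<close> by (auto simp: N_def)
  \<comment> \<open>Variable \<open>k\<close> carries the de Bruijn index 0, so it is renamed to the
    fresh variable \<open>N\<close>, and the variables from \<open>k + 1\<close> to \<open>N\<close>
    close the gap. Being a cycle on \<open>k\<close>, ..., \<open>N\<close>, the renaming is
    injective; variables from \<open>N\<close> on do not occur free in \<open>p\<close>.\<close>
  define r where "r i = (if i < k then i else if i = k then N else if i \<le> N then i - 1 else i)" for i
  have r: "inj r" using N(2) by (auto simp: r_def inj_on_def split: if_splits)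
  have "F s y \<longleftrightarrow> sat M ((env cs s)(N := y) \<circ> r) p" if "range s \<subseteq> univ M" "y \<in> univ M" for s y
  proof -
    have "F s y \<longleftrightarrow> sat M (env cs (case_nat y s)) p"
      using p[of "case_nat y s"] that by (auto simp: image_subset_iff split: nat.splits)
    also have "\<dots> \<longleftrightarrow> sat M ((env cs s)(N := y) \<circ> r) p"
    proof (rule sat_cong)
      fix i assume "i \<in> fv p"
      then show "env cs (case_nat y s) i = ((env cs s)(N := y) \<circ> r) i"
        using N(1)[of i] N(2) by (auto simp: env_def r_def k_def split: nat.splits intro!: arg_cong[where f = s])
    qed
    finally show ?thesis .
  qed
  then show ?thesis
    by (intro Df_I[OF cs, of _ "Ex N (rn r p)"]) (auto simp: sat_rn[OF r])
qed

lemma dclass_Df: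
  assumes "is_struct M" shows "dclass (univ M) (Df M)"
proof
  show "Df M (\<lambda>s. \<not> P s)" if "Df M P" for P
    using that by (auto elim!: Df_E intro!: Df_I[of _ M _ "Neg p" for p])
  show "Df M (\<lambda>s. P s \<or> Q s)" if "Df M P" "Df M Q" for P Q
    using that by (rule Df_or)
  show "Df M (\<lambda>s. \<exists>y\<in>univ M. F s y)" if "Df M (\<lambda>s. F (\<lambda>i. s (Suc i)) (s 0))" for F
    using that by (rule Df_bex)
  show "Df M (\<lambda>s. P (\<lambda>i. s (r i)))" if P: "Df M P" and r: "inj r" for P r
  proof -
    obtain cs p where cs: "set cs \<subseteq> univ M" and p: "\<forall>s. range s \<subseteq> univ M \<longrightarrow> (P s \<longleftrightarrow> sat M (env cs s) p)"
      by (rule Df_E[OF P])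
    note p = p[rule_format]
    define r' where "r' i = (if i < length cs then i else r (i - length cs) + length cs)" for i
    have "inj r'" unfolding inj_on_def r'_def using r by (auto simp: inj_eq split: if_splits)
    moreover have "env cs s \<circ> r' = env cs (\<lambda>i. s (r i))" for s
      by (auto simp: env_def r'_def fun_eq_iff)
    moreover have "P (\<lambda>i. s (r i)) \<longleftrightarrow> sat M (env cs (\<lambda>i. s (r i))) p" if "range s \<subseteq> univ M" for s
      using that by (intro p) auto
    ultimately show ?thesis
      by (intro Df_I[OF cs, of _ "rn r' p"]) (simp add: sat_rn)
  qed
  show "Df M (\<lambda>s. s i = s j)" for i j
    by (rule Df_I[of "[]" M _ "Eq (Var i) (Var j)"]) (auto simp: env_def)
  show "Df M (\<lambda>s. s i = c)" if "c \<in> univ M" for c i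
    by (rule Df_I[of "[c]" M _ "Eq (Var (Suc i)) (Var 0)"]) (use that in \<open>auto simp: env_def\<close>)
  show "Df M Q" if "\<And>s. range s \<subseteq> univ M \<Longrightarrow> P s \<longleftrightarrow> Q s" "Df M P" for P Q
    using that unfolding Df_def by simp
qed

lemma Df_ind: "Df M (\<lambda>s. s i \<in> ind M)"
  by (rule Df_I[of "[]" M _ "InI (Var i)"]) (auto simp: env_def)

lemma Df_lt: "Df M (\<lambda>s. lt M (s i) (s j))"
  by (rule Df_I[of "[]" M _ "Less (Var i) (Var j)"]) (auto simp: env_def)

lemma dstruct_Df:
  assumes M: "is_struct M" and J: "J \<subseteq> univ M" "Df M (\<lambda>s. s 0 \<in> J)"
  shows "dstruct (univ M) (Df M) (M\<lparr>ind := J\<rparr>)"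
proof -
  interpret dclass "univ M" "Df M" by (rule dclass_Df[OF M])
  show ?thesis
  proof
    show "univ (M\<lparr>ind := J\<rparr>) = univ M" by simp
    show "is_struct (M\<lparr>ind := J\<rparr>)" using M J by (simp add: is_struct_def)
    have "Df M (\<lambda>s. s 0 = suc M (s 1))"
      by (rule Df_I[of "[]" M _ "Eq (Var 0) (Succ (Var 1))"]) (auto simp: env_def)
    then show "Fn (\<lambda>s. suc (M\<lparr>ind := J\<rparr>) (s 0))"
      using M by (auto simp: Fn_def is_struct_def image_subset_iff)
    have "Df M (\<lambda>s. s 0 = add M (s 2) (s 1))"
      by (rule Df_I[of "[]" M _ "Eq (Var 0) (Plus (Var 2) (Var 1))"]) (auto simp: env_def)
    then show "Fn (\<lambda>s. add (M\<lparr>ind := J\<rparr>) (s 1) (s 0))"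
      using M by (auto simp: Fn_def is_struct_def image_subset_iff numeral_2_eq_2)
    have "Df M (\<lambda>s. s 0 = mul M (s 2) (s 1))"
      by (rule Df_I[of "[]" M _ "Eq (Var 0) (Times (Var 2) (Var 1))"]) (auto simp: env_def)
    then show "Fn (\<lambda>s. mul (M\<lparr>ind := J\<rparr>) (s 1) (s 0))"
      using M by (auto simp: Fn_def is_struct_def image_subset_iff numeral_2_eq_2)
    show "Df M (\<lambda>s. lt (M\<lparr>ind := J\<rparr>) (s 1) (s 0))"
      using Df_lt[of M 1 0] by simp
    show "Df M (\<lambda>s. s 0 \<in> ind (M\<lparr>ind := J\<rparr>))" using J by simp
  qed
qed

lemma dstruct_Df_self: "is_struct M \<Longrightarrow> dstruct (univ M) (Df M) M"
  using dstruct_Df[of M "ind M", OF _ _ Df_ind[of M 0]] by (simp add: is_struct_def)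

text \<open>The parameters of the defining formula become free variables of an instance of
  \<open>Induct\<close>, with \<open>length cs\<close> as the induction variable.\<close>

lemma Df_induct:
  assumes M: "is_struct M" and Ind: "\<And>x p s. range s \<subseteq> univ M \<Longrightarrow> sat M s (Induct x p)"
    and P: "Df M (\<lambda>s. P (s 0))" and base: "P (zer M)"
    and step: "\<And>a. a \<in> univ M \<Longrightarrow> P a \<Longrightarrow> P (suc M a)" and a: "a \<in> univ M"
  shows "P a"
proof -
  obtain cs p where cs: "set cs \<subseteq> univ M"
    and p: "\<forall>s. range s \<subseteq> univ M \<longrightarrow> (P (s 0) \<longleftrightarrow> sat M (env cs s) p)"
    by (rule Df_E[OF P])
    note p = p[rule_format]
  define s where "s = env cs (\<lambda>_. zer M)"
  have s: "range s \<subseteq> univ M"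
    using M cs unfolding s_def by (intro range_env) (auto simp: is_struct_def)
  have upd: "P b \<longleftrightarrow> sat M (s(length cs := b)) p" if "b \<in> univ M" for b
  proof -
    have "env cs (case_nat b (\<lambda>_. zer M)) = s(length cs := b)"
      by (auto simp: s_def env_def fun_eq_iff split: nat.splits)
    then show ?thesis
      using p[of "case_nat b (\<lambda>_. zer M)"] that M
      by (auto simp: is_struct_def image_subset_iff split: nat.splits)
  qed
  have "zer M \<in> univ M" "\<And>b. b \<in> univ M \<Longrightarrow> suc M b \<in> univ M"
    using M by (auto simp: is_struct_def)
  then show ?thesis
    using Ind[OF s, of "length cs" p] upd base step a unfolding sat_Induct by blast
qed

text \<open>What is definable in the expansion by a definable \<open>J\<close> is already definable
  in \<open>M\<close>, where induction is available.\<close>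

lemma sat_Induct_expansion:
  assumes M: "is_struct M" and Ind: "\<And>x p s. range s \<subseteq> univ M \<Longrightarrow> sat M s (Induct x p)"
    and J: "J \<subseteq> univ M" "Df M (\<lambda>s. s 0 \<in> J)" and s: "range s \<subseteq> univ M"
  shows "sat (M\<lparr>ind := J\<rparr>) s (Induct x p)"
proof -
  let ?N = "M\<lparr>ind := J\<rparr>"
  interpret dstruct "univ M" "Df M" ?N by (rule dstruct_Df[OF M J])
  have "Df M (\<lambda>s'. sat ?N (\<lambda>i. (if i = x then (\<lambda>s'. s' 0) else (\<lambda>s'. s i)) s') p)"
    using s by (intro D_sat) (auto intro: Fn_var Fn_const)
  moreover have "(\<lambda>i. (if i = x then (\<lambda>s'. s' 0) else (\<lambda>s'. s i)) s') = s(x := s' 0)" for s' :: "nat \<Rightarrow> 'a"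
    by auto
  ultimately have "Df M (\<lambda>s'. sat ?N (s(x := s' 0)) p)" by (simp only:)
  note ind = Df_induct[OF M Ind this]
  show ?thesis
    unfolding sat_Induct using ind by (auto simp del: fun_upd_apply)
qed

section \<open>Coding sequences in models of arithmetic\<close>

text \<open>The value of the term \<open>pair\<close>, over a class of semirings:
  \<open>discrete_linordered_semidom\<close> leaves nothing between \<open>x\<close> and
  \<open>x + 1\<close>, and \<open>canonically_ordered_monoid_add\<close> makes
  \<open>x \<le> y\<close> mean that \<open>y\<close> is \<open>x\<close> plus something.\<close>

definition pr :: "'a::{discrete_linordered_semidom, canonically_ordered_monoid_add} \<Rightarrow> 'a \<Rightarrow> 'a" where
  "pr x y = (x + y) * (x + y) + x + 1"

definition seq :: "'a::{discrete_linordered_semidom, canonically_ordered_monoid_add} \<Rightarrow> 'a \<Rightarrow> bool" where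
  "seq s l \<longleftrightarrow> (\<exists>c d. s = pr l (pr c d))"

definition entry :: "'a::{discrete_linordered_semidom, canonically_ordered_monoid_add} \<Rightarrow> 'a \<Rightarrow> 'a \<Rightarrow> bool" where
  "entry s i x \<longleftrightarrow> (\<exists>l c d q. s = pr l (pr c d) \<and> i < l \<and>
     c = q * ((i + 1) * d + 1) + x \<and> x < (i + 1) * d + 1)"

definition inseq :: "'a::{discrete_linordered_semidom, canonically_ordered_monoid_add} \<Rightarrow> 'a \<Rightarrow> bool" where
  "inseq x C \<longleftrightarrow> (\<exists>i. entry C i x)"

text \<open>Congruence modulo \<open>m\<close>, with multiples added on both sides because
  differences may fail to exist.\<close>

definition cg :: "'a::{discrete_linordered_semidom, canonically_ordered_monoid_add} \<Rightarrow> 'a \<Rightarrow> 'a \<Rightarrow> bool" where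
  "cg m a b \<longleftrightarrow> (\<exists>x y. a + x * m = b + y * m)"

lemma less_add_one_iff: "x < y + 1 \<longleftrightarrow> x \<le> (y :: 'a::discrete_linordered_semidom)"
  by (simp add: less_eq_iff_succ_less)

lemma pr_gt: "x < pr x y" "y < pr x y"
  for x y :: "'a::{discrete_linordered_semidom, canonically_ordered_monoid_add}"
proof -
  have *: "z \<le> z * z" for z :: 'a
  proof (cases "z = 0")
    case False
    then have "1 \<le> z" using less_iff_succ_less_eq[of 0 z] by (simp add: zero_less_iff_neq_zero)
    then show ?thesis using mult_left_mono[of 1 z z] by simp
  qed simp
  have "x + y \<le> (x + y) * (x + y)" by (rule *)
  also have "\<dots> \<le> (x + y) * (x + y) + x" by simp
  finally have "x + y < pr x y" by (simp add: pr_def less_add_one_iff)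
  then show "x < pr x y" "y < pr x y"
    using le_less_trans[of x "x + y"] le_less_trans[of y "x + y"] by (simp_all add: add_increasing add_increasing2)
qed

text \<open>The values with \<open>x + y = z\<close> lie between \<open>z * z + 1\<close> and
  \<open>z * z + z + 1\<close>, and these intervals are disjoint for distinct
  \<open>z\<close>.\<close>

lemma pr_inj [simp]: "pr x y = pr x' y' \<longleftrightarrow> x = x' \<and> y = y'"
  for x y :: "'a::{discrete_linordered_semidom, canonically_ordered_monoid_add}"
proof
  assume eq: "pr x y = pr x' y'"
  have less: "pr a b < pr c d" if "a + b < c + d" for a b c d :: 'a
  proof -
    let ?z = "a + b"
    have "?z + 1 \<le> c + d" using that by (simp add: less_iff_succ_less_eq)
    then have "(?z + 1) * (?z + 1) \<le> (c + d) * (c + d)" by (intro mult_mono) simp_all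
    moreover have "?z * ?z + a < (?z + 1) * (?z + 1)"
    proof -
      have "?z * ?z + a \<le> ?z * ?z + a + (a + b + b)" by simp
      also have "\<dots> < ?z * ?z + a + (a + b + b) + 1" by simp
      also have "\<dots> = (?z + 1) * (?z + 1)" by (simp add: algebra_simps)
      finally show ?thesis .
    qed
    ultimately have "?z * ?z + a < (c + d) * (c + d)" by simp
    also have "\<dots> \<le> (c + d) * (c + d) + c" by simp
    finally show ?thesis by (simp add: pr_def)
  qed
  have "x + y = x' + y'"
    using less[of x y x' y'] less[of x' y' x y] eq by (cases "x + y" "x' + y'" rule: linorder_cases) auto
  then show "x = x' \<and> y = y'" using eq by (auto simp: pr_def)
qed simp

lemma division_unique:
  fixes r r' :: "'a::{discrete_linordered_semidom, canonically_ordered_monoid_add}"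
  assumes "r < m" "r' < m" "r + a * m = r' + b * m"
  shows "r = r'"
proof -
  have *: False if "a < b" "r < m" "r + a * m = r' + b * m" for r r' a b :: 'a
  proof -
    have "a + 1 \<le> b" using that by (simp add: less_iff_succ_less_eq)
    then have "m + a * m \<le> b * m" using mult_right_mono[of "a + 1" b m] by (simp add: algebra_simps)
    moreover have "r + a * m < m + a * m" using that(2) by simp
    moreover have "b * m \<le> r' + b * m" by simp
    ultimately show False using that by (metis leD order.trans)
  qed
  show ?thesis
    using *[of a b r r'] *[of b a r' r] assms by (cases a b rule: linorder_cases) auto
qed

lemma entry_unique: "entry s i x \<Longrightarrow> entry s i y \<Longrightarrow> x = y"
  unfolding entry_def using division_unique by (fastforce simp: add.commute)

lemma entry_less: "entry s i x \<Longrightarrow> i < s" "entry s i x \<Longrightarrow> x < s"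
proof -
  assume "entry s i x"
  then obtain l c d q where s: "s = pr l (pr c d)" "i < l" "c = q * ((i + 1) * d + 1) + x"
    unfolding entry_def by blast
  show "i < s" using s pr_gt(1)[of l "pr c d"] by simp
  have "x \<le> c" using s by simp
  also have "c < pr c d" by (rule pr_gt)
  also have "\<dots> < s" using s by (simp add: pr_gt)
  finally show "x < s" .
qed

lemma entry_length: "entry s i x \<Longrightarrow> seq s l \<Longrightarrow> i < l"
  by (auto simp: entry_def seq_def)

lemma seq_length: "seq s l \<Longrightarrow> seq s l' \<Longrightarrow> l = l'"
  by (auto simp: seq_def)

section \<open>Congruences\<close>

lemma cg_refl: "cg m x x"
  unfolding cg_def by blast

lemma cg_trans: assumes "cg m x y" "cg m y z" shows "cg m x z"
proof -
  obtain a b c d where "x + a * m = y + b * m" "y + c * m = z + d * m"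
    using assms unfolding cg_def by blast
  then have "x + (a + c) * m = z + (d + b) * m"
    by (simp add: distrib_right) (metis add.assoc add.commute)
  then show ?thesis unfolding cg_def by blast
qed

lemma cg_add: assumes "cg m x y" "cg m x' y'" shows "cg m (x + x') (y + y')"
proof -
  obtain a b c d where "x + a * m = y + b * m" "x' + c * m = y' + d * m"
    using assms unfolding cg_def by blast
  then have "(x + a * m) + (x' + c * m) = (y + b * m) + (y' + d * m)" by simp
  then have "x + x' + (a + c) * m = y + y' + (b + d) * m"
    by (simp add: algebra_simps)
  then show ?thesis unfolding cg_def by blast
qed

lemma cg_mult: assumes "cg m x y" "cg m x' y'" shows "cg m (x * x') (y * y')"
proof -
  obtain a b c d where "x + a * m = y + b * m" "x' + c * m = y' + d * m"
    using assms unfolding cg_def by blast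
  then have "(x + a * m) * (x' + c * m) = (y + b * m) * (y' + d * m)" by simp
  then have "x * x' + (a * x' + c * x + a * c * m) * m = y * y' + (b * y' + d * y + b * d * m) * m"
    by (simp add: algebra_simps)
  then show ?thesis unfolding cg_def by blast
qed

lemma cg_add_mult: "cg m (x + y * m) x"
  unfolding cg_def by (rule exI[of _ 0], rule exI[of _ y]) simp

section \<open>Arithmetic from induction on definable predicates\<close>

named_theorems D_intros

text \<open>Peano arithmetic in semantic form. \<open>D\<close> is left open because it is taken to
  be the predicates definable in one structure or, over the natural numbers, all predicates.\<close>

locale pam = dclass UNIV D for D :: "((nat \<Rightarrow> 'a::{discrete_linordered_semidom, canonically_ordered_monoid_add}) \<Rightarrow> bool) \<Rightarrow> bool" +
  assumes D_less0: "D (\<lambda>s. s 1 < s 0)"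
    and Fn_plus0: "Fn (\<lambda>s. s 1 + s 0)"
    and Fn_times0: "Fn (\<lambda>s. s 1 * s 0)"
    and induct: "D (\<lambda>s. P (s 0)) \<Longrightarrow> P 0 \<Longrightarrow> (\<And>x. P x \<Longrightarrow> P (x + 1)) \<Longrightarrow> P x"
begin

lemma D_ex: "D (\<lambda>s. F (\<lambda>i. s (Suc i)) (s 0)) \<Longrightarrow> D (\<lambda>s. \<exists>y. F s y)"
  using D_bex[of F] by simp

lemma D_all: "D (\<lambda>s. F (\<lambda>i. s (Suc i)) (s 0)) \<Longrightarrow> D (\<lambda>s. \<forall>y. F s y)"
  using D_ball[of F] by simp

lemma D_less: "Fn f \<Longrightarrow> Fn g \<Longrightarrow> D (\<lambda>s. f s < g s)"
  by (rule D_app2[OF D_less0])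

lemma D_le: "Fn f \<Longrightarrow> Fn g \<Longrightarrow> D (\<lambda>s. f s \<le> g s)"
  unfolding not_less[symmetric] by (intro D_Not D_less)

lemma Fn_plus: "Fn f \<Longrightarrow> Fn g \<Longrightarrow> Fn (\<lambda>s. f s + g s)"
  by (rule Fn_app2[OF Fn_plus0])

lemma Fn_times: "Fn f \<Longrightarrow> Fn g \<Longrightarrow> Fn (\<lambda>s. f s * g s)"
  by (rule Fn_app2[OF Fn_times0])

lemma Fn_const': "Fn (\<lambda>s. c)"
  by (rule Fn_const) simp

lemmas [D_intros] = D_Not D_and D_or D_imp D_iff D_ex D_all D_eq D_less D_le D_bool
  Fn_plus Fn_times Fn_var Fn_const'

lemma Fn_pr [D_intros]: "Fn f \<Longrightarrow> Fn g \<Longrightarrow> Fn (\<lambda>s. pr (f s) (g s))"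
  unfolding pr_def by (intro D_intros)

lemma D_seq [D_intros]: "Fn f \<Longrightarrow> Fn g \<Longrightarrow> D (\<lambda>s. seq (f s) (g s))"
  by (rule D_app2[where R = seq]) (unfold seq_def, intro D_intros)

lemma D_entry [D_intros]: "Fn f \<Longrightarrow> Fn g \<Longrightarrow> Fn h \<Longrightarrow> D (\<lambda>s. entry (f s) (g s) (h s))"
  by (rule D_app3[where R = entry]) (unfold entry_def, intro D_intros)

lemma D_inseq [D_intros]: "Fn f \<Longrightarrow> Fn g \<Longrightarrow> D (\<lambda>s. inseq (f s) (g s))"
  by (rule D_app2[where R = inseq]) (unfold inseq_def, intro D_intros)

lemma D_cg [D_intros]: "Fn f \<Longrightarrow> Fn g \<Longrightarrow> Fn h \<Longrightarrow> D (\<lambda>s. cg (f s) (g s) (h s))"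
  by (rule D_app3[where R = cg]) (unfold cg_def, intro D_intros)

lemma D_dvd [D_intros]: "Fn f \<Longrightarrow> Fn g \<Longrightarrow> D (\<lambda>s. f s dvd g s)"
  by (rule D_app2[where R = "(dvd)"]) (unfold dvd_def, intro D_intros)

lemma less_induct:
  assumes P: "D (\<lambda>s. P (s 0))" and step: "\<And>x. (\<And>y. y < x \<Longrightarrow> P y) \<Longrightarrow> P x"
  shows "P x"
proof -
  have "\<forall>y. y < x \<longrightarrow> P y"
  proof (rule induct[where P = "\<lambda>x. \<forall>y. y < x \<longrightarrow> P y"])
    show "D (\<lambda>s. \<forall>y. y < s 0 \<longrightarrow> P y)"
      by (rule D_all, rule D_imp, (intro D_intros)[1]) (rule P)
    show "\<forall>y. y < x + 1 \<longrightarrow> P y" if "\<forall>y. y < x \<longrightarrow> P y" for x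
      using that step by (metis less_add_one_iff order_le_imp_less_or_eq)
  qed simp
  then show ?thesis using step by blast
qed

lemma least:
  assumes P: "D (\<lambda>s. P (s 0))" and x: "P x"
  obtains y where "P y" "\<And>z. z < y \<Longrightarrow> \<not> P z"
proof -
  have "\<exists>y. P y \<and> (\<forall>z. z < y \<longrightarrow> \<not> P z)"
  proof (rule ccontr)
    assume *: "\<not> ?thesis"
    have "\<not> P z" for z
      by (rule less_induct[where P = "\<lambda>z. \<not> P z", OF D_Not[OF P]]) (use * in blast)
    then show False using x by blast
  qed
  then show ?thesis using that by blast
qed

lemma division:
  assumes "0 < m" shows "\<exists>q r. x = q * m + r \<and> r < (m :: 'a)"
proof (rule induct[where P = "\<lambda>x. \<exists>q r. x = q * m + r \<and> r < m"])
  show "D (\<lambda>s. \<exists>q r. s 0 = q * m + r \<and> r < m)" by (intro D_intros)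
  show "\<exists>q r. 0 = q * m + r \<and> r < m" using assms by (intro exI[of _ 0]) simp
  fix x assume "\<exists>q r. x = q * m + r \<and> r < m"
  then obtain q r where x: "x = q * m + r" and r: "r < m" by blast
  show "\<exists>q r. x + 1 = q * m + r \<and> r < m"
  proof (cases "r + 1 = m")
    case True
    have "x + 1 = q * m + (r + 1)" using x by (simp add: add.assoc)
    also have "\<dots> = (q + 1) * m + 0" unfolding True by (simp add: distrib_right)
    finally have "x + 1 = (q + 1) * m + 0" .
    then show ?thesis using assms by blast
  next
    case False
    have "r + 1 \<le> m" using r by (simp add: less_iff_succ_less_eq)
    then have "r + 1 < m" using False by simp
    moreover have "x + 1 = q * m + (r + 1)" using x by (simp add: algebra_simps)
    ultimately show ?thesis by blast
  qed
qed

text \<open>The bound grows along an induction on the initial segments of \<open>l\<close>. It puts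
  all witnesses below one number before they are coded as a sequence.\<close>

lemma collection:
  assumes R: "D (\<lambda>s. R (s 1) (s 0))" and ex: "\<And>i. i < l \<Longrightarrow> \<exists>x. R i x"
  shows "\<exists>b. \<forall>i. i < l \<longrightarrow> (\<exists>x. x < b \<and> R i x)"
proof -
  note [D_intros] = D_app2[where R = R, OF R]
  have "k \<le> l \<longrightarrow> (\<exists>b. \<forall>i. i < k \<longrightarrow> (\<exists>x. x < b \<and> R i x))" for k
  proof (rule induct[where P = "\<lambda>k. k \<le> l \<longrightarrow> (\<exists>b. \<forall>i. i < k \<longrightarrow> (\<exists>x. x < b \<and> R i x))"])
    show "D (\<lambda>s. s 0 \<le> l \<longrightarrow> (\<exists>b. \<forall>i. i < s 0 \<longrightarrow> (\<exists>x. x < b \<and> R i x)))"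
      by (intro D_intros)
    fix k assume IH: "k \<le> l \<longrightarrow> (\<exists>b. \<forall>i. i < k \<longrightarrow> (\<exists>x. x < b \<and> R i x))"
    show "k + 1 \<le> l \<longrightarrow> (\<exists>b. \<forall>i. i < k + 1 \<longrightarrow> (\<exists>x. x < b \<and> R i x))"
    proof
      assume "k + 1 \<le> l"
      then have kl: "k < l" by (simp add: less_iff_succ_less_eq)
      then obtain b where b: "\<forall>i. i < k \<longrightarrow> (\<exists>x. x < b \<and> R i x)" using IH by auto
      obtain x where x: "R k x" using ex[OF kl] by blast
      have "\<exists>y. y < max b (x + 1) \<and> R i y" if "i < k + 1" for i
      proof (cases "i = k")
        case True
        have "x < max b (x + 1)" by (simp add: less_max_iff_disj)
        then show ?thesis using x True by blast
      next
        case False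
        then have "i < k" using that by (simp add: less_add_one_iff)
        then show ?thesis using b by (metis less_max_iff_disj)
      qed
      then show "\<exists>b. \<forall>i. i < k + 1 \<longrightarrow> (\<exists>x. x < b \<and> R i x)" by blast
    qed
  qed simp
  then show ?thesis by blast
qed

text \<open>This stands in for the factorial of \<open>l\<close>: defining the factorial would
  require the coding of sequences that is being built here, whereas a common multiple exists by
  plain induction.\<close>

lemma common_multiple: "\<exists>d. 0 < d \<and> (\<forall>t. 0 < t \<and> t \<le> (l :: 'a) \<longrightarrow> t dvd d)"
proof (rule induct[where P = "\<lambda>l. \<exists>d. 0 < d \<and> (\<forall>t. 0 < t \<and> t \<le> l \<longrightarrow> t dvd d)"])
  show "D (\<lambda>s. \<exists>d. 0 < d \<and> (\<forall>t. 0 < t \<and> t \<le> s 0 \<longrightarrow> t dvd d))" by (intro D_intros)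
  show "\<exists>d::'a. 0 < d \<and> (\<forall>t. 0 < t \<and> t \<le> 0 \<longrightarrow> t dvd d)" by (rule exI[of _ 1]) simp
  fix l :: 'a assume "\<exists>d. 0 < d \<and> (\<forall>t. 0 < t \<and> t \<le> l \<longrightarrow> t dvd d)"
  then obtain d where d: "0 < d" "\<And>t. 0 < t \<Longrightarrow> t \<le> l \<Longrightarrow> t dvd d" by blast
  have "t dvd d * (l + 1)" if "0 < t" "t \<le> l + 1" for t
    using that d(2)[of t] by (cases "t = l + 1") (auto simp: order_le_less less_add_one_iff)
  then show "\<exists>d. 0 < d \<and> (\<forall>t. 0 < t \<and> t \<le> l + 1 \<longrightarrow> t dvd d)"
    using d(1) by (intro exI[of _ "d * (l + 1)"]) (simp add: add_nonneg_pos)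
qed

text \<open>If \<open>d\<close> is a multiple of \<open>j - k\<close>, then the moduli \<open>1 + (k + 1) d\<close> and \<open>1 + (j + 1) d\<close> are coprime:
  for \<open>d = t t'\<close> with \<open>t = j - k\<close>, the product of the first with \<open>t' (j + 1)\<^sup>2\<close> is \<open>-1\<close> modulo the
  second, hence its square is \<open>1\<close>.\<close>

lemma moduli_coprime:
  assumes "k < j" "\<And>t. 0 < t \<Longrightarrow> t \<le> j \<Longrightarrow> t dvd d"
  shows "\<exists>u. cg ((j + 1) * d + 1) (u * ((k + 1) * d + 1)) 1"
proof -
  obtain t where t: "j = k + t" using \<open>k < j\<close> le_iff_add[of k j] by auto
  then have "0 < t" "t \<le> j" using \<open>k < j\<close> by (auto simp: zero_less_iff_neq_zero)
  then obtain t' where d: "d = t * t'" using assms(2)[of t] by (auto simp: dvd_def)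
  let ?mj = "(j + 1) * d + 1" and ?mk = "(k + 1) * d + 1"
  define A where "A = t' * (j + 1) * (j + 1)"
  define W where "W = 1 + t' * (k + 1) * (j + 1)"
  have Z: "A * ?mk + 1 = W * ?mj"
    unfolding A_def W_def d t by (simp add: algebra_simps)
  have "A * ?mk * (A * ?mk) + W * ?mj = 1 + (A * ?mk) * (W * ?mj)"
    unfolding Z[symmetric] by (simp add: algebra_simps)
  then have "(A * (A * ?mk)) * ?mk + W * ?mj = 1 + (A * ?mk * W) * ?mj"
    by (simp only: mult.assoc mult.commute mult.left_commute)
  then show ?thesis unfolding cg_def by blast
qed

text \<open>Goedel's beta lemma inside the model. The appeal to the Chinese remainder theorem is
  unfolded into an induction on the number \<open>k\<close> of congruences solved, as no sequence of
  moduli can be coded yet. \<open>R\<close> may have many values; the sequence picks one at each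
  index.\<close>

theorem seq_exists:
  assumes R: "D (\<lambda>s. R (s 1) (s 0))" and ex: "\<And>i. i < l \<Longrightarrow> \<exists>x. R i x"
  shows "\<exists>s. seq s l \<and> (\<forall>i. i < l \<longrightarrow> (\<exists>x. R i x \<and> entry s i x))"
proof -
  note [D_intros] = D_app2[where R = R, OF R]
  obtain b where b: "\<And>i. i < l \<Longrightarrow> \<exists>x. x < b \<and> R i x"
    using collection[OF R ex] by blast
  obtain d0 where d0: "0 < d0" "\<And>t. 0 < t \<Longrightarrow> t \<le> l \<Longrightarrow> t dvd d0"
    using common_multiple[of l] by blast
  \<comment> \<open>The factor \<open>d0\<close> makes the moduli coprime by
    \<open>moduli_coprime\<close>; the factor \<open>b\<close> makes them exceed the
    entries.\<close>
  define d where "d = d0 * b"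
  have dvd: "t dvd d" if "0 < t" "t \<le> l" for t
    using d0(2)[OF that] by (simp add: d_def)
  have "1 \<le> d0" using d0(1) less_iff_succ_less_eq[of 0 d0] by simp
  then have bd: "b \<le> d" using mult_right_mono[of 1 d0 b] by (simp add: d_def)
  define m where "m i = (i + 1) * d + 1" for i
  have Fn_m [D_intros]: "Fn f \<Longrightarrow> Fn (\<lambda>s. m (f s))" for f
    unfolding m_def by (intro D_intros)
  have cop: "\<exists>u. cg (m j) (u * m k) 1" if "k < j" "j < l" for j k
    unfolding m_def using that by (intro moduli_coprime dvd) auto
  \<comment> \<open>\<open>c\<close> solves the first \<open>k\<close> congruences, \<open>P\<close>
    is a common multiple of their moduli, and \<open>P\<close> is invertible modulo each later
    modulus, which keeps the next congruence solvable.\<close>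
  define Q where "Q k c P \<longleftrightarrow> (\<forall>i. i < k \<longrightarrow> (\<exists>x. R i x \<and> x < b \<and> cg (m i) c x)) \<and>
      (\<forall>i. i < k \<longrightarrow> m i dvd P) \<and> (\<forall>j. k \<le> j \<and> j < l \<longrightarrow> (\<exists>u. cg (m j) (u * P) 1))" for k c P
  have "k \<le> l \<longrightarrow> (\<exists>c P. Q k c P)" for k
  proof (rule induct[where P = "\<lambda>k. k \<le> l \<longrightarrow> (\<exists>c P. Q k c P)"])
    show "D (\<lambda>s. s 0 \<le> l \<longrightarrow> (\<exists>c P. Q (s 0) c P))"
      unfolding Q_def by (intro D_intros)
    have "Q 0 0 1" unfolding Q_def by (auto intro: exI[of _ 1] cg_refl)
    then show "0 \<le> l \<longrightarrow> (\<exists>c P. Q 0 c P)" by blast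
    fix k assume IH: "k \<le> l \<longrightarrow> (\<exists>c P. Q k c P)"
    show "k + 1 \<le> l \<longrightarrow> (\<exists>c P. Q (k + 1) c P)"
    proof
      assume "k + 1 \<le> l"
      then have kl: "k < l" by (simp add: less_iff_succ_less_eq)
      then obtain c P where Q: "Q k c P" using IH by auto
      then obtain u where u: "cg (m k) (u * P) 1" using kl unfolding Q_def by blast
      obtain x where x: "R k x" "x < b" using b[OF kl] by blast
      \<comment> \<open>Here \<open>c * ((k + 1) * d)\<close> serves as \<open>- c\<close>, for
        added to \<open>c\<close> it gives \<open>c * m k\<close>. Since \<open>u * P\<close> is 1
        modulo \<open>m k\<close>, the correction turns \<open>c\<close> into \<open>x\<close>
        there; as a multiple of \<open>P\<close> it changes nothing modulo the earlier
        moduli.\<close>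
      define c' where "c' = c + P * (u * (x + c * ((k + 1) * d)))"
      have c'k: "cg (m k) c' x"
      proof -
        have "cg (m k) (c + (u * P) * (x + c * ((k + 1) * d))) (c + 1 * (x + c * ((k + 1) * d)))"
          by (intro cg_add cg_mult cg_refl u)
        moreover have "c + 1 * (x + c * ((k + 1) * d)) = x + c * m k"
          by (simp add: m_def algebra_simps)
        moreover have "c' = c + (u * P) * (x + c * ((k + 1) * d))"
          by (simp add: c'_def algebra_simps)
        ultimately show ?thesis using cg_trans cg_add_mult by metis
      qed
      have c'i: "cg (m i) c' c" if "i < k" for i
      proof -
        have "m i dvd P" using Q that unfolding Q_def by blast
        then obtain e where "P = m i * e" by (auto simp: dvd_def)
        then have "c' = c + (e * (u * (x + c * ((k + 1) * d)))) * m i"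
          by (simp add: c'_def algebra_simps)
        then show ?thesis by (simp add: cg_add_mult)
      qed
      have "Q (k + 1) c' (P * m k)"
        unfolding Q_def
      proof (intro conjI allI impI)
        fix i assume "i < k + 1"
        then consider "i < k" | "i = k" by (auto simp: less_add_one_iff order_le_less)
        then show "\<exists>x. R i x \<and> x < b \<and> cg (m i) c' x"
        proof cases
          case 1
          then obtain y where "R i y" "y < b" "cg (m i) c y" using Q unfolding Q_def by blast
          then show ?thesis using cg_trans[OF c'i[OF 1]] by blast
        next
          case 2
          then show ?thesis using x c'k by blast
        qed
      next
        fix i assume "i < k + 1"
        then consider "i < k" | "i = k" by (auto simp: less_add_one_iff order_le_less)
        then show "m i dvd P * m k"
          by cases (use Q in \<open>auto simp: Q_def\<close>)
      next
        fix j assume j: "k + 1 \<le> j \<and> j < l"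
        then have kj: "k < j" by (simp add: less_iff_succ_less_eq)
        then obtain v where "cg (m j) (v * P) 1" using Q j unfolding Q_def by (meson less_imp_le)
        moreover obtain w where "cg (m j) (w * m k) 1" using cop[OF kj] j by blast
        ultimately have "cg (m j) ((v * P) * (w * m k)) (1 * 1)" by (rule cg_mult)
        then have "cg (m j) ((v * w) * (P * m k)) 1" by (simp add: ac_simps)
        then show "\<exists>u. cg (m j) (u * (P * m k)) 1" by blast
      qed
      then show "\<exists>c P. Q (k + 1) c P" by blast
    qed
  qed
  then obtain c P where Q: "Q l c P" by blast
  have "\<exists>x. R i x \<and> entry (pr l (pr c d)) i x" if il: "i < l" for i
  proof -
    obtain x where x: "R i x" "x < b" "cg (m i) c x" using Q il unfolding Q_def by blast
    have "d \<le> (i + 1) * d" by (simp add: distrib_right)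
    then have xm: "x < m i"
      using x(2) bd unfolding m_def less_add_one_iff by (meson less_imp_le order.trans)
    then have "0 < m i" by (metis gr_zeroI not_less_zero)
    from division[OF this] obtain q r where c: "c = q * m i + r" "r < m i" by blast
    obtain a e where "c + a * m i = x + e * m i" using x(3) unfolding cg_def by blast
    then have "r + (q + a) * m i = x + e * m i" using c by (simp add: algebra_simps)
    then have "r = x" using division_unique c(2) xm by blast
    then show ?thesis using x c il unfolding entry_def m_def by blast
  qed
  then show ?thesis unfolding seq_def by blast
qed

lemma entry_ex: assumes "seq s l" "i < (l :: 'a)" shows "\<exists>x. entry s i x"
proof -
  obtain c d where "s = pr l (pr c d)" using assms unfolding seq_def by blast
  moreover obtain q r where "c = q * ((i + 1) * d + 1) + r \<and> r < (i + 1) * d + 1"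
    using division[of "(i + 1) * d + 1" c] by (auto simp: add_nonneg_pos)
  ultimately show ?thesis using assms unfolding entry_def by blast
qed

text \<open>The entry at index \<open>i\<close> is \<open>i\<close> itself if \<open>P i\<close>
  holds and a fixed element \<open>x0\<close> of \<open>P\<close> otherwise, so the empty set gets a
  separate code, of length 0.\<close>

lemma comprehension:
  assumes P: "D (\<lambda>s. P (s 0))" and m: "\<And>x. P x \<Longrightarrow> x < m"
  shows "\<exists>C. \<forall>x. inseq x C \<longleftrightarrow> P x"
proof (cases "\<exists>x. P x")
  case True
  then obtain x0 where x0: "P x0" by blast
  note [D_intros] = D_app1[where R = P, OF P]
  have "D (\<lambda>s. P (s 1) \<and> s 0 = s 1 \<or> \<not> P (s 1) \<and> s 0 = x0)" by (intro D_intros)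
  from seq_exists[where R = "\<lambda>i x. P i \<and> x = i \<or> \<not> P i \<and> x = x0", OF this, of m]
  obtain C where C: "seq C m" "\<And>i. i < m \<Longrightarrow> \<exists>x. (P i \<and> x = i \<or> \<not> P i \<and> x = x0) \<and> entry C i x"
    by blast
  have "inseq x C \<longleftrightarrow> P x" for x
  proof
    assume "P x"
    then show "inseq x C" using C(2)[OF m] unfolding inseq_def by blast
  next
    assume "inseq x C"
    then obtain i where i: "entry C i x" unfolding inseq_def by blast
    then show "P x" using C(2)[of i] entry_length[OF i C(1)] x0 entry_unique[OF i] by blast
  qed
  then show ?thesis by blast
next
  case False
  have "\<not> inseq x (pr 0 (pr 0 0))" for x :: 'a
    by (auto simp: inseq_def entry_def)
  then show ?thesis using False by blast
qed

end

section \<open>Recursion on codes\<close>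

abbreviation "tr x y z \<equiv> pr x (pr y z)"

abbreviation "kVar i \<equiv> pr 0 i"
abbreviation "kZero \<equiv> pr 1 0"
abbreviation "kSucc t \<equiv> pr 2 t"
abbreviation "kPlus t u \<equiv> pr 3 (pr t u)"
abbreviation "kTimes t u \<equiv> pr 4 (pr t u)"
abbreviation "kEq t u \<equiv> pr 5 (pr t u)"
abbreviation "kLess t u \<equiv> pr 6 (pr t u)"
abbreviation "kNeg p \<equiv> pr 7 p"
abbreviation "kOr p q \<equiv> pr 8 (pr p q)"
abbreviation "kEx i p \<equiv> pr 9 (pr i p)"
abbreviation "kAnd p q \<equiv> kNeg (kOr (kNeg p) (kNeg q))"

lemma less_pr1: "z \<le> x \<Longrightarrow> z < pr x y"
  by (rule le_less_trans[OF _ pr_gt(1)])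

lemma less_pr2: "z \<le> y \<Longrightarrow> z < pr x y"
  by (rule le_less_trans[OF _ pr_gt(2)])

lemmas less_pr = less_pr1 less_pr2 less_imp_le

text \<open>\<open>C\<close> is a certificate: the clause \<open>\<Phi>\<close> justifies each
  element from elements of \<open>C\<close>. Keeping \<open>\<Phi>\<close> abstract lets all
  recursions on syntax share the lemmas on unfolding and folding.\<close>

definition cert where
  "cert \<Phi> C \<longleftrightarrow> (\<forall>u. inseq u C \<longrightarrow> \<Phi> (\<lambda>y. inseq y C) u)"

definition certified where
  "certified \<Phi> x \<longleftrightarrow> (\<exists>C. inseq x C \<and> cert \<Phi> C)"

definition tm_clause where
  "tm_clause n X u \<longleftrightarrow>
     (\<exists>i. i < n \<and> u = kVar i) \<or> u = kZero \<or> (\<exists>s. X s \<and> u = kSucc s) \<or>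
     (\<exists>s t. X s \<and> X t \<and> (u = kPlus s t \<or> u = kTimes s t))"

definition "isT n = certified (tm_clause n)"

definition fm_clause where
  "fm_clause n X u \<longleftrightarrow>
     (\<exists>s t. isT n s \<and> isT n t \<and> (u = kEq s t \<or> u = kLess s t)) \<or>
     (\<exists>p. X p \<and> u = kNeg p) \<or> (\<exists>p q. X p \<and> X q \<and> u = kOr p q) \<or>
     (\<exists>i. i < n \<and> (\<exists>p. X p \<and> u = kEx i p))"

definition "isF n = certified (fm_clause n)"

definition tilde_clause where
  "tilde_clause n X w \<longleftrightarrow> (\<exists>u v. w = pr u v \<and>
     ((\<exists>i. i < n \<and> u = kVar i \<and> v = kVar i) \<or>
      (\<exists>i. \<not> i < n \<and> u = kVar i \<and> v = kVar (i + 1)) \<or>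
      u = kZero \<and> v = kZero \<or>
      (\<exists>p p'. X (pr p p') \<and>
         (u = kSucc p \<and> v = kSucc p' \<or> u = kNeg p \<and> v = kNeg p' \<or>
          (\<exists>i. i < n \<and> u = kEx i p \<and> v = kEx i p'))) \<or>
      (\<exists>p p' q q'. X (pr p p') \<and> X (pr q q') \<and>
         (u = kPlus p q \<and> v = kPlus p' q' \<or> u = kTimes p q \<and> v = kTimes p' q' \<or>
          u = kEq p q \<and> v = kEq p' q' \<or> u = kLess p q \<and> v = kLess p' q' \<or>
          u = kOr p q \<and> v = kOr p' q'))))"

definition "tilde n x y = certified (tilde_clause n) (pr x y)"

definition star_clause where
  "star_clause n X w \<longleftrightarrow> (\<exists>u v m. w = tr u v m \<and>
     ((\<exists>s t. (u = kEq s t \<or> u = kLess s t) \<and> v = u \<and> m = 0) \<or>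
      (\<exists>p p'. X (tr p p' m) \<and> u = kNeg p \<and> v = kNeg p') \<or>
      (\<exists>p p' k1 q q' k2. X (tr p p' k1) \<and> X (tr q q' k2) \<and> u = kOr p q \<and> v = kOr p' q' \<and>
         (m = k1 \<and> \<not> k1 < k2 \<or> m = k2 \<and> k1 < k2)) \<or>
      (\<exists>i p p' k1 r. X (tr p p' k1) \<and> tilde n p' r \<and>
         u = kEx i p \<and> v = kEx i (kAnd (kLess (kVar i) (kVar n)) r) \<and> m = k1 + 1)))"

definition "star n x y k = certified (star_clause n) (tr x y k)"

definition truth where
  "truth v P \<longleftrightarrow> v = 1 \<and> P \<or> v = 0 \<and> \<not> P"

definition upd where
  "upd a i y b \<longleftrightarrow> (\<exists>l. seq a l \<and> seq b l \<and> entry b i y \<and>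
     (\<forall>k. k < l \<longrightarrow> k \<noteq> i \<longrightarrow> (\<forall>x. entry a k x \<longrightarrow> entry b k x)))"

text \<open>The bounds of \<open>evalS\<close> are left out here; \<open>eval_clause_bounded\<close>
  shows that they exclude nothing.\<close>

definition eval_clause where
  "eval_clause X w \<longleftrightarrow> (\<exists>x b v. w = tr x b v \<and>
     ((\<exists>i. x = kVar i \<and> entry b i v) \<or>
      x = kZero \<and> v = 0 \<or>
      (\<exists>y p. X (tr y b p) \<and> (x = kSucc y \<and> v = p + 1 \<or> x = kNeg y \<and> truth v (p \<noteq> 1))) \<or>
      (\<exists>y p z q. X (tr y b p) \<and> X (tr z b q) \<and>
         (x = kPlus y z \<and> v = p + q \<or> x = kTimes y z \<and> v = p * q \<or>
          x = kEq y z \<and> truth v (p = q) \<or> x = kLess y z \<and> truth v (p < q) \<or>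
          x = kOr y z \<and> truth v (p = 1 \<or> q = 1))) \<or>
      (\<exists>i j y p. x = kEx i (kAnd (kLess (kVar i) (kVar j)) y) \<and> i \<noteq> j \<and> entry b j p \<and>
         (v = 1 \<and> (\<exists>a. a < p \<and> (\<exists>b'. upd b i a b' \<and> X (tr y b' 1))) \<or>
          v = 0 \<and> (\<forall>a. a < p \<longrightarrow> (\<exists>b'. upd b i a b' \<and> X (tr y b' 0)))))))"

definition "eval x b v = certified eval_clause (tr x b v)"

text \<open>A sequence has many codes, since different \<open>c\<close> and \<open>d\<close> can
  give the same remainders. Results of an update are therefore unique only up to
  \<open>same\<close>.\<close>

definition same where
  "same a b \<longleftrightarrow> (\<exists>l. seq a l \<and> seq b l) \<and> (\<forall>k x. entry a k x \<longleftrightarrow> entry b k x)"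

text \<open>The certificate of \<open>w\<close> also certifies every other element of it.\<close>

lemma certified_unfold:
  assumes mono: "\<And>X Y w. (\<And>u. X u \<Longrightarrow> Y u) \<Longrightarrow> \<Phi> X w \<Longrightarrow> \<Phi> Y w" and "certified \<Phi> w"
  shows "\<Phi> (certified \<Phi>) w"
proof -
  obtain C where "inseq w C" "cert \<Phi> C" using assms(2) unfolding certified_def by blast
  then show ?thesis
    using mono[of "\<lambda>y. inseq y C" "certified \<Phi>" w] unfolding cert_def certified_def by blast
qed

lemma tm_clause_mono: "(\<And>u. X u \<Longrightarrow> Y u) \<Longrightarrow> tm_clause n X w \<Longrightarrow> tm_clause n Y w"
  unfolding tm_clause_def
  by (elim ex_forward disj_forward conj_forward all_forward imp_forward; (assumption | blast))

lemma fm_clause_mono: "(\<And>u. X u \<Longrightarrow> Y u) \<Longrightarrow> fm_clause n X w \<Longrightarrow> fm_clause n Y w"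
  unfolding fm_clause_def
  by (elim ex_forward disj_forward conj_forward all_forward imp_forward; (assumption | blast))

lemma tilde_clause_mono: "(\<And>u. X u \<Longrightarrow> Y u) \<Longrightarrow> tilde_clause n X w \<Longrightarrow> tilde_clause n Y w"
  unfolding tilde_clause_def
  by (elim ex_forward disj_forward conj_forward all_forward imp_forward; (assumption | blast))

lemma star_clause_mono: "(\<And>u. X u \<Longrightarrow> Y u) \<Longrightarrow> star_clause n X w \<Longrightarrow> star_clause n Y w"
  unfolding star_clause_def
  by (elim ex_forward disj_forward conj_forward all_forward imp_forward; (assumption | blast))

lemma eval_clause_mono: "(\<And>u. X u \<Longrightarrow> Y u) \<Longrightarrow> eval_clause X w \<Longrightarrow> eval_clause Y w"
  unfolding eval_clause_def
  by (elim ex_forward disj_forward conj_forward all_forward imp_forward; (assumption | blast))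

section \<open>Uniting certificates, and the recursion equations for syntax\<close>

context pam
begin

text \<open>All certificates with code below \<open>B\<close>, together with \<open>w\<close>, are
  united into one by comprehension. The bound \<open>B\<close> makes the union a coded set, even
  when \<open>w\<close> rests on nonstandardly many premises.\<close>

lemma glue:
  assumes D: "D (\<lambda>s. cert \<Phi> (s 0))"
    and mono: "\<And>X Y w. (\<And>u. X u \<Longrightarrow> Y u) \<Longrightarrow> \<Phi> X w \<Longrightarrow> \<Phi> Y w"
    and w: "\<Phi> (\<lambda>u. \<exists>C. C < B \<and> cert \<Phi> C \<and> inseq u C) w"
  shows "certified \<Phi> w"
proof -
  note [D_intros] = D_app1[where R = "cert \<Phi>", OF D]
  let ?X = "\<lambda>u. \<exists>C. C < B \<and> cert \<Phi> C \<and> inseq u C"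
  have "\<exists>E. \<forall>u. inseq u E \<longleftrightarrow> u = w \<or> ?X u"
  proof (rule comprehension)
    show "D (\<lambda>s. s 0 = w \<or> (\<exists>C. C < B \<and> cert \<Phi> C \<and> inseq (s 0) C))" by (intro D_intros)
    have "u < B" if "C < B" "inseq u C" for u C
      using that entry_less(2) unfolding inseq_def by (meson less_trans)
    then show "u < max (w + 1) B" if "u = w \<or> ?X u" for u
      using that by (auto simp: less_max_iff_disj)
  qed
  then obtain E where E: "\<And>u. inseq u E \<longleftrightarrow> u = w \<or> ?X u" by blast
  have "\<Phi> (\<lambda>y. inseq y E) u" if uE: "inseq u E" for u
  proof (cases "u = w")
    case True
    show ?thesis unfolding True by (rule mono[of ?X "\<lambda>y. inseq y E", OF _ w]) (use E in blast)
  next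
    case False
    then obtain C where C: "C < B" "cert \<Phi> C" "inseq u C" using uE[unfolded E] by blast
    have 1: "\<Phi> (\<lambda>y. inseq y C) u" using C(2,3) unfolding cert_def by blast
    have 2: "inseq y E" if "inseq y C" for y using that E C(1,2) by blast
    show ?thesis by (rule mono[of "\<lambda>y. inseq y C" "\<lambda>y. inseq y E", OF 2 1])
  qed
  then have "inseq w E" "cert \<Phi> E" using E by (auto simp: cert_def)
  then show ?thesis unfolding certified_def by blast
qed

lemma certified_fold:
  assumes D: "D (\<lambda>s. cert \<Phi> (s 0))"
    and mono: "\<And>X Y w. (\<And>u. X u \<Longrightarrow> Y u) \<Longrightarrow> \<Phi> X w \<Longrightarrow> \<Phi> Y w"
    and w: "\<Phi> (\<lambda>y. (y = u \<or> y = v) \<and> certified \<Phi> y) w"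
  shows "certified \<Phi> w"
proof -
  have "\<exists>C. certified \<Phi> y \<longrightarrow> cert \<Phi> C \<and> inseq y C" for y
    unfolding certified_def by blast
  then obtain C where C: "certified \<Phi> y \<longrightarrow> cert \<Phi> (C y) \<and> inseq y (C y)" for y by metis
  have "\<exists>E. E < max (C u + 1) (C v + 1) \<and> cert \<Phi> E \<and> inseq y E"
    if "(y = u \<or> y = v) \<and> certified \<Phi> y" for y
    using that C[of y] by (intro exI[of _ "C y"]) (auto simp: less_max_iff_disj)
  then have X: "\<Phi> (\<lambda>y. \<exists>E. E < max (C u + 1) (C v + 1) \<and> cert \<Phi> E \<and> inseq y E) w"
    by (intro mono[OF _ w])
  show ?thesis
    by (rule glue[where \<Phi> = \<Phi> and B = "max (C u + 1) (C v + 1)"]) (fact D, fact mono, fact X)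
qed

text \<open>By \<open>fin\<close> a clause uses at most two premises at a time, so only two
  certificates have to be united. The bounded quantifier in \<open>eval_clause\<close> has no such
  limit and is treated in \<open>eval_Ex\<close>.\<close>

lemma certified_iff:
  assumes D: "D (\<lambda>s. cert \<Phi> (s 0))"
    and mono: "\<And>X Y w. (\<And>u. X u \<Longrightarrow> Y u) \<Longrightarrow> \<Phi> X w \<Longrightarrow> \<Phi> Y w"
    and fin: "\<And>X w. \<Phi> X w \<Longrightarrow> \<exists>u v. \<Phi> (\<lambda>y. (y = u \<or> y = v) \<and> X y) w"
  shows "certified \<Phi> w \<longleftrightarrow> \<Phi> (certified \<Phi>) w"
proof
  assume *: "certified \<Phi> w"
  show "\<Phi> (certified \<Phi>) w" by (rule certified_unfold[where \<Phi> = \<Phi>]) (fact mono, fact *)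
next
  assume "\<Phi> (certified \<Phi>) w"
  from fin[OF this] obtain u v where *: "\<Phi> (\<lambda>y. (y = u \<or> y = v) \<and> certified \<Phi> y) w" by blast
  show "certified \<Phi> w"
    by (rule certified_fold[where \<Phi> = \<Phi> and u = u and v = v]) (fact D, fact mono, fact *)
qed

lemma D_isT [D_intros]: "Fn f \<Longrightarrow> Fn g \<Longrightarrow> D (\<lambda>s. isT (f s) (g s))"
  by (rule D_app2[where R = isT]) (unfold isT_def certified_def cert_def tm_clause_def, intro D_intros)

lemma isT_iff: "isT (n :: 'a) x \<longleftrightarrow> tm_clause n (isT n) x"
  unfolding isT_def
proof (rule certified_iff)
  show "D (\<lambda>s. cert (tm_clause n) (s 0))" unfolding cert_def tm_clause_def by (intro D_intros)
  show "\<exists>u v. tm_clause n (\<lambda>y. (y = u \<or> y = v) \<and> X y) w" if "tm_clause n X w" for X w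
    using that unfolding tm_clause_def by blast
qed (rule tm_clause_mono)

lemma isT_simps [simp]:
  "isT n (kVar i) \<longleftrightarrow> i < (n :: 'a)"
  "isT (n :: 'a) kZero"
  "isT (n :: 'a) (kSucc s) \<longleftrightarrow> isT n s"
  "isT (n :: 'a) (kPlus s t) \<longleftrightarrow> isT n s \<and> isT n t"
  "isT (n :: 'a) (kTimes s t) \<longleftrightarrow> isT n s \<and> isT n t"
  by (subst isT_iff, simp add: tm_clause_def)+

text \<open>Structural induction on possibly nonstandard codes: a code exceeds its components, so it
  reduces to course-of-values induction for the definable \<open>P\<close>.\<close>

lemma isT_induct [consumes 2, case_names Var Zero Succ Plus Times]:
  assumes D: "D (\<lambda>s. P (s 0))" and x: "isT n x"
    and "\<And>i. i < n \<Longrightarrow> P (kVar i)" "P kZero" "\<And>s. isT n s \<Longrightarrow> P s \<Longrightarrow> P (kSucc s)"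
    "\<And>s t. isT n s \<Longrightarrow> isT n t \<Longrightarrow> P s \<Longrightarrow> P t \<Longrightarrow> P (kPlus s t)"
    "\<And>s t. isT n s \<Longrightarrow> isT n t \<Longrightarrow> P s \<Longrightarrow> P t \<Longrightarrow> P (kTimes s t)"
  shows "P x"
proof -
  note [D_intros] = D_app1[where R = P, OF D]
  have "isT n x \<longrightarrow> P x"
  proof (rule less_induct[where P = "\<lambda>x. isT n x \<longrightarrow> P x"])
    show "D (\<lambda>s. isT n (s 0) \<longrightarrow> P (s 0))" by (intro D_intros)
    fix x assume IH: "\<And>y. y < x \<Longrightarrow> isT n y \<longrightarrow> P y"
    show "isT n x \<longrightarrow> P x"
    proof
      assume "isT n x"
      then have "tm_clause n (isT n) x" using isT_iff by simp
      then show "P x"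
        unfolding tm_clause_def by (elim exE conjE disjE) (use assms(3-) IH in \<open>simp_all add: less_pr\<close>)
    qed
  qed
  then show ?thesis using x by simp
qed

lemma D_isF [D_intros]: "Fn f \<Longrightarrow> Fn g \<Longrightarrow> D (\<lambda>s. isF (f s) (g s))"
  by (rule D_app2[where R = isF]) (unfold isF_def certified_def cert_def fm_clause_def, intro D_intros)

lemma isF_iff: "isF (n :: 'a) x \<longleftrightarrow> fm_clause n (isF n) x"
  unfolding isF_def
proof (rule certified_iff)
  show "D (\<lambda>s. cert (fm_clause n) (s 0))" unfolding cert_def fm_clause_def by (intro D_intros)
  show "\<exists>u v. fm_clause n (\<lambda>y. (y = u \<or> y = v) \<and> X y) w" if "fm_clause n X w" for X w
    using that unfolding fm_clause_def by (elim exE conjE disjE; simp; blast?)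
qed (rule fm_clause_mono)

lemma isF_simps [simp]:
  "isF (n :: 'a) (kEq s t) \<longleftrightarrow> isT n s \<and> isT n t"
  "isF (n :: 'a) (kLess s t) \<longleftrightarrow> isT n s \<and> isT n t"
  "isF (n :: 'a) (kNeg p) \<longleftrightarrow> isF n p"
  "isF (n :: 'a) (kOr p q) \<longleftrightarrow> isF n p \<and> isF n q"
  "isF (n :: 'a) (kEx i p) \<longleftrightarrow> i < n \<and> isF n p"
  by (subst isF_iff, simp add: fm_clause_def)+

lemma isF_induct [consumes 2, case_names Eq Less Neg Or Ex]:
  assumes D: "D (\<lambda>s. P (s 0))" and x: "isF n x"
    and "\<And>s t. isT n s \<Longrightarrow> isT n t \<Longrightarrow> P (kEq s t)" "\<And>s t. isT n s \<Longrightarrow> isT n t \<Longrightarrow> P (kLess s t)"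
    "\<And>p. isF n p \<Longrightarrow> P p \<Longrightarrow> P (kNeg p)"
    "\<And>p q. isF n p \<Longrightarrow> isF n q \<Longrightarrow> P p \<Longrightarrow> P q \<Longrightarrow> P (kOr p q)"
    "\<And>i p. i < n \<Longrightarrow> isF n p \<Longrightarrow> P p \<Longrightarrow> P (kEx i p)"
  shows "P x"
proof -
  note [D_intros] = D_app1[where R = P, OF D]
  have "isF n x \<longrightarrow> P x"
  proof (rule less_induct[where P = "\<lambda>x. isF n x \<longrightarrow> P x"])
    show "D (\<lambda>s. isF n (s 0) \<longrightarrow> P (s 0))" by (intro D_intros)
    fix x assume IH: "\<And>y. y < x \<Longrightarrow> isF n y \<longrightarrow> P y"
    show "isF n x \<longrightarrow> P x"
    proof
      assume "isF n x"
      then have "fm_clause n (isF n) x" using isF_iff by simp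
      then show "P x"
        unfolding fm_clause_def by (elim exE conjE disjE) (use assms(3-) IH in \<open>simp_all add: less_pr\<close>)
    qed
  qed
  then show ?thesis using x by simp
qed

lemma D_tilde [D_intros]: "Fn f \<Longrightarrow> Fn g \<Longrightarrow> Fn h \<Longrightarrow> D (\<lambda>s. tilde (f s) (g s) (h s))"
  by (rule D_app3[where R = tilde])
    (unfold tilde_def certified_def cert_def tilde_clause_def, intro D_intros)

lemma tilde_iff: "tilde (n :: 'a) x y \<longleftrightarrow> tilde_clause n (certified (tilde_clause n)) (pr x y)"
  unfolding tilde_def
proof (rule certified_iff)
  show "D (\<lambda>s. cert (tilde_clause n) (s 0))" unfolding cert_def tilde_clause_def by (intro D_intros)
  show "\<exists>u v. tilde_clause n (\<lambda>y. (y = u \<or> y = v) \<and> X y) w" if "tilde_clause n X w" for X w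
    using that unfolding tilde_clause_def by (elim exE conjE disjE; simp; blast?)
qed (rule tilde_clause_mono)

lemma tilde_simps [simp]:
  "tilde (n :: 'a) (kVar i) y \<longleftrightarrow> (if i < n then y = kVar i else y = kVar (i + 1))"
  "tilde (n :: 'a) kZero y \<longleftrightarrow> y = kZero"
  "tilde (n :: 'a) (kSucc p) y \<longleftrightarrow> (\<exists>p'. tilde n p p' \<and> y = kSucc p')"
  "tilde (n :: 'a) (kNeg p) y \<longleftrightarrow> (\<exists>p'. tilde n p p' \<and> y = kNeg p')"
  "tilde (n :: 'a) (kEx i p) y \<longleftrightarrow> i < n \<and> (\<exists>p'. tilde n p p' \<and> y = kEx i p')"
  "tilde (n :: 'a) (kPlus p q) y \<longleftrightarrow> (\<exists>p' q'. tilde n p p' \<and> tilde n q q' \<and> y = kPlus p' q')"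
  "tilde (n :: 'a) (kTimes p q) y \<longleftrightarrow> (\<exists>p' q'. tilde n p p' \<and> tilde n q q' \<and> y = kTimes p' q')"
  "tilde (n :: 'a) (kEq p q) y \<longleftrightarrow> (\<exists>p' q'. tilde n p p' \<and> tilde n q q' \<and> y = kEq p' q')"
  "tilde (n :: 'a) (kLess p q) y \<longleftrightarrow> (\<exists>p' q'. tilde n p p' \<and> tilde n q q' \<and> y = kLess p' q')"
  "tilde (n :: 'a) (kOr p q) y \<longleftrightarrow> (\<exists>p' q'. tilde n p p' \<and> tilde n q q' \<and> y = kOr p' q')"
  by (subst tilde_iff, simp add: tilde_clause_def tilde_def[symmetric]; blast)+

lemma tilde_induct [consumes 2, case_names Var_less Var_ge Zero Succ Neg Ex Plus Times Eq Less Or]: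
  assumes D: "D (\<lambda>s. P (s 1) (s 0))" and xy: "tilde (n :: 'a) x y"
    and cases: "\<And>i. i < n \<Longrightarrow> P (kVar i) (kVar i)" "\<And>i. \<not> i < n \<Longrightarrow> P (kVar i) (kVar (i + 1))" "P kZero kZero"
      "\<And>p p'. tilde n p p' \<Longrightarrow> P p p' \<Longrightarrow> P (kSucc p) (kSucc p')"
      "\<And>p p'. tilde n p p' \<Longrightarrow> P p p' \<Longrightarrow> P (kNeg p) (kNeg p')"
      "\<And>i p p'. i < n \<Longrightarrow> tilde n p p' \<Longrightarrow> P p p' \<Longrightarrow> P (kEx i p) (kEx i p')"
      "\<And>p p' q q'. tilde n p p' \<Longrightarrow> tilde n q q' \<Longrightarrow> P p p' \<Longrightarrow> P q q' \<Longrightarrow> P (kPlus p q) (kPlus p' q')"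
      "\<And>p p' q q'. tilde n p p' \<Longrightarrow> tilde n q q' \<Longrightarrow> P p p' \<Longrightarrow> P q q' \<Longrightarrow> P (kTimes p q) (kTimes p' q')"
      "\<And>p p' q q'. tilde n p p' \<Longrightarrow> tilde n q q' \<Longrightarrow> P p p' \<Longrightarrow> P q q' \<Longrightarrow> P (kEq p q) (kEq p' q')"
      "\<And>p p' q q'. tilde n p p' \<Longrightarrow> tilde n q q' \<Longrightarrow> P p p' \<Longrightarrow> P q q' \<Longrightarrow> P (kLess p q) (kLess p' q')"
      "\<And>p p' q q'. tilde n p p' \<Longrightarrow> tilde n q q' \<Longrightarrow> P p p' \<Longrightarrow> P q q' \<Longrightarrow> P (kOr p q) (kOr p' q')"
  shows "P x y"
proof -
  note [D_intros] = D_app2[where R = P, OF D]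
  have "\<forall>y. tilde n x y \<longrightarrow> P x y"
  proof (rule less_induct[where P = "\<lambda>x. \<forall>y. tilde n x y \<longrightarrow> P x y"])
    show "D (\<lambda>s. \<forall>y. tilde n (s 0) y \<longrightarrow> P (s 0) y)" by (intro D_intros)
    fix x assume IH: "\<And>u. u < x \<Longrightarrow> \<forall>y. tilde n u y \<longrightarrow> P u y"
    show "\<forall>y. tilde n x y \<longrightarrow> P x y"
    proof (intro allI impI)
      fix y assume "tilde n x y"
      then have "tilde_clause n (certified (tilde_clause n)) (pr x y)" using tilde_iff by simp
      then show "P x y"
        unfolding tilde_clause_def tilde_def[symmetric] pr_inj
        by (elim exE conjE disjE) (use cases IH in \<open>simp_all add: less_pr\<close>)
    qed
  qed
  then show ?thesis using xy by simp
qed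

text \<open>Under nested quantifiers \<open>tilde\<close> is applied repeatedly, so its results have
  to lie in its domain again.\<close>

lemma tilde_tilde: "tilde (n :: 'a) x y \<Longrightarrow> \<exists>z. tilde n y z"
proof (rule tilde_induct[where P = "\<lambda>x y. \<exists>z. tilde n y z"])
  show "D (\<lambda>s. \<exists>z. tilde n (s 0) z)" by (intro D_intros)
qed (simp_all, blast+)

lemma tilde_term: "isT (n :: 'a) t \<Longrightarrow> \<exists>t'. tilde n t t'"
proof (rule isT_induct[where P = "\<lambda>t. \<exists>t'. tilde n t t'"])
  show "D (\<lambda>s. \<exists>t'. tilde n (s 0) t')" by (intro D_intros)
qed (simp_all, blast+)

lemma D_star [D_intros]: "Fn f \<Longrightarrow> Fn g \<Longrightarrow> Fn h \<Longrightarrow> Fn k \<Longrightarrow> D (\<lambda>s. star (f s) (g s) (h s) (k s))"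
  by (rule D_app4[where R = star])
    (unfold star_def certified_def cert_def star_clause_def, intro D_intros)

lemma star_iff: "star (n :: 'a) x y k \<longleftrightarrow> star_clause n (certified (star_clause n)) (tr x y k)"
  unfolding star_def
proof (rule certified_iff)
  show "D (\<lambda>s. cert (star_clause n) (s 0))" unfolding cert_def star_clause_def by (intro D_intros)
  show "\<exists>u v. star_clause n (\<lambda>y. (y = u \<or> y = v) \<and> X y) w" if "star_clause n X w" for X w
    using that unfolding star_clause_def by (elim exE conjE disjE; simp; blast?)
qed (rule star_clause_mono)

lemma star_simps [simp]:
  "star (n :: 'a) (kEq s t) y k \<longleftrightarrow> y = kEq s t \<and> k = 0"
  "star (n :: 'a) (kLess s t) y k \<longleftrightarrow> y = kLess s t \<and> k = 0"
  "star (n :: 'a) (kNeg p) y k \<longleftrightarrow> (\<exists>p'. star n p p' k \<and> y = kNeg p')"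
  "star (n :: 'a) (kOr p q) y k \<longleftrightarrow> (\<exists>p' k1 q' k2. star n p p' k1 \<and> star n q q' k2 \<and> y = kOr p' q' \<and>
      (k = k1 \<and> \<not> k1 < k2 \<or> k = k2 \<and> k1 < k2))"
  "star (n :: 'a) (kEx i p) y k \<longleftrightarrow> (\<exists>p' k1 r. star n p p' k1 \<and> tilde n p' r \<and>
      y = kEx i (kAnd (kLess (kVar i) (kVar n)) r) \<and> k = k1 + 1)"
  by (subst star_iff, simp add: star_clause_def star_def[symmetric] del: not_less; blast)+

lemma star_ex: "isF (n :: 'a) x \<Longrightarrow> \<exists>y k. star n x y k"
proof -
  \<comment> \<open>The claim is strengthened so that the transform also admits
    \<open>tilde\<close>, which an enclosing quantifier will apply to it.\<close>
  have "isF n x \<Longrightarrow> \<exists>y k r. star n x y k \<and> tilde n y r"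
  proof (rule isF_induct[where P = "\<lambda>x. \<exists>y k r. star n x y k \<and> tilde n y r"])
    show "D (\<lambda>s. \<exists>y k r. star n (s 0) y k \<and> tilde n y r)" by (intro D_intros)
    fix i p assume i: "i < n" and "\<exists>y k r. star n p y k \<and> tilde n y r"
    then obtain y k r where *: "star n p y k" "tilde n y r" by blast
    obtain z where z: "tilde n r z" using tilde_tilde[OF *(2)] by blast
    have "star n (kEx i p) (kEx i (kAnd (kLess (kVar i) (kVar n)) r)) (k + 1)"
      using * by auto
    \<comment> \<open>The bound variable \<open>i\<close> is below \<open>n\<close> and stays, while
      \<open>kVar n\<close>, in the role of \<open>z\<^sub>1\<close>, becomes
      \<open>kVar (n + 1)\<close>.\<close>
    moreover have "tilde n (kEx i (kAnd (kLess (kVar i) (kVar n)) r))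
        (kEx i (kAnd (kLess (kVar i) (kVar (n + 1))) z))"
      using i z by auto
    ultimately show "\<exists>y k r. star n (kEx i p) y k \<and> tilde n y r" by blast
  next
    fix s t assume "isT n s" "isT n t"
    then obtain s' t' where "tilde n s s'" "tilde n t t'" using tilde_term by blast
    then have "star n (kEq s t) (kEq s t) 0" "tilde n (kEq s t) (kEq s' t')"
      "star n (kLess s t) (kLess s t) 0" "tilde n (kLess s t) (kLess s' t')" by auto
    then show "\<exists>y k r. star n (kEq s t) y k \<and> tilde n y r" "\<exists>y k r. star n (kLess s t) y k \<and> tilde n y r"
      by blast+
  next
    fix p assume "\<exists>y k r. star n p y k \<and> tilde n y r"
    then obtain y k r where "star n p y k" "tilde n y r" by blast
    then have "star n (kNeg p) (kNeg y) k" "tilde n (kNeg y) (kNeg r)" by auto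
    then show "\<exists>y k r. star n (kNeg p) y k \<and> tilde n y r" by blast
  next
    fix p q assume "\<exists>y k r. star n p y k \<and> tilde n y r" "\<exists>y k r. star n q y k \<and> tilde n y r"
    then obtain y k r y' k' r' where "star n p y k" "tilde n y r" "star n q y' k'" "tilde n y' r'" by blast
    then have "star n (kOr p q) (kOr y y') (if k < k' then k' else k)" "tilde n (kOr y y') (kOr r r')"
      by (simp_all del: not_less split: if_splits) blast+
    then show "\<exists>y k r. star n (kOr p q) y k \<and> tilde n y r" by blast
  qed
  then show "isF n x \<Longrightarrow> \<exists>y k. star n x y k" by blast
qed

end

section \<open>Evaluation of terms and bounded formulae\<close>

context pam
begin

lemma D_truth [D_intros]: "Fn f \<Longrightarrow> D P \<Longrightarrow> D (\<lambda>s. truth (f s) (P s))"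
  unfolding truth_def by (intro D_intros)

lemma D_upd [D_intros]: "Fn f \<Longrightarrow> Fn g \<Longrightarrow> Fn h \<Longrightarrow> Fn k \<Longrightarrow> D (\<lambda>s. upd (f s) (g s) (h s) (k s))"
  by (rule D_app4[where R = upd]) (unfold upd_def, intro D_intros)

lemma D_cert_eval [D_intros]: "Fn f \<Longrightarrow> D (\<lambda>s. cert eval_clause (f s))"
  by (rule D_app1[where R = "cert eval_clause"]) (unfold cert_def eval_clause_def, intro D_intros)

lemma D_eval [D_intros]: "Fn f \<Longrightarrow> Fn g \<Longrightarrow> Fn h \<Longrightarrow> D (\<lambda>s. eval (f s) (g s) (h s))"
  by (rule D_app3[where R = eval]) (unfold eval_def certified_def, intro D_intros)

lemma eval_unfold: "eval x b v \<Longrightarrow> eval_clause (certified eval_clause) (tr x b v)"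
  unfolding eval_def by (rule certified_unfold) (rule eval_clause_mono)

lemma eval_fold:
  assumes "eval_clause (\<lambda>y. (y = u \<or> y = u') \<and> certified eval_clause y) (tr x b (v :: 'a))"
  shows "eval x b v"
proof -
  have D: "D (\<lambda>s. cert eval_clause (s 0))" by (intro D_intros)
  show ?thesis unfolding eval_def
    by (rule certified_fold[where \<Phi> = eval_clause and u = u and v = u'])
      (fact D, fact eval_clause_mono, fact assms)
qed

lemma eval_Var [simp]: "eval (kVar i) b (v :: 'a) \<longleftrightarrow> entry b i v"
proof
  show "eval (kVar i) b v" if "entry b i v"
    by (rule eval_fold) (use that in \<open>simp add: eval_clause_def\<close>)
qed (drule eval_unfold, simp add: eval_clause_def)

lemma eval_Zero [simp]: "eval kZero b (v :: 'a) \<longleftrightarrow> v = 0"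
proof
  show "eval kZero b v" if "v = 0"
    by (rule eval_fold) (use that in \<open>simp add: eval_clause_def\<close>)
qed (drule eval_unfold, simp add: eval_clause_def)

lemma eval_unary [simp]:
  "eval (kSucc y) b (v :: 'a) \<longleftrightarrow> (\<exists>p. eval y b p \<and> v = p + 1)" (is ?S)
  "eval (kNeg y) b v \<longleftrightarrow> (\<exists>p. eval y b p \<and> truth v (p \<noteq> 1))" (is ?N)
proof -
  have "eval (kSucc y) b v" if "eval y b p" "v = p + 1" for p
    by (rule eval_fold[where u = "tr y b p"]) (use that in \<open>simp add: eval_clause_def eval_def\<close>)
  moreover have "\<exists>p. eval y b p \<and> v = p + 1" if "eval (kSucc y) b v"
    using eval_unfold[OF that] by (simp add: eval_clause_def eval_def)
  ultimately show ?S by blast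
  have "eval (kNeg y) b v" if "eval y b p" "truth v (p \<noteq> 1)" for p
    by (rule eval_fold[where u = "tr y b p"]) (use that in \<open>simp add: eval_clause_def eval_def, blast?\<close>)
  moreover have "\<exists>p. eval y b p \<and> truth v (p \<noteq> 1)" if "eval (kNeg y) b v"
    using eval_unfold[OF that] by (simp add: eval_clause_def eval_def)
  ultimately show ?N by blast
qed

lemma eval_clause_binary:
  assumes "X (tr y b p)" "X (tr z b q)"
    "x = kPlus y z \<and> v = p + q \<or> x = kTimes y z \<and> v = p * q \<or>
     x = kEq y z \<and> truth v (p = q) \<or> x = kLess y z \<and> truth v (p < q) \<or>
     x = kOr y z \<and> truth v (p = 1 \<or> q = 1)"
  shows "eval_clause X (tr x b (v :: 'a))"
  unfolding eval_clause_def
  by (rule exI[of _ x], rule exI[of _ b], rule exI[of _ v], rule conjI, rule refl,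
      rule disjI2, rule disjI2, rule disjI2, rule disjI1,
      rule exI[of _ y], rule exI[of _ p], rule exI[of _ z], rule exI[of _ q])
    (intro conjI assms)

lemma eval_binary [simp]:
  "eval (kPlus y z) b (v :: 'a) \<longleftrightarrow> (\<exists>p q. eval y b p \<and> eval z b q \<and> v = p + q)" (is ?P)
  "eval (kTimes y z) b v \<longleftrightarrow> (\<exists>p q. eval y b p \<and> eval z b q \<and> v = p * q)" (is ?T)
  "eval (kEq y z) b v \<longleftrightarrow> (\<exists>p q. eval y b p \<and> eval z b q \<and> truth v (p = q))" (is ?E)
  "eval (kLess y z) b v \<longleftrightarrow> (\<exists>p q. eval y b p \<and> eval z b q \<and> truth v (p < q))" (is ?L)
  "eval (kOr y z) b v \<longleftrightarrow> (\<exists>p q. eval y b p \<and> eval z b q \<and> truth v (p = 1 \<or> q = 1))" (is ?O)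
proof -
  have *: "eval x b v" if "eval y b p" "eval z b q"
    "x = kPlus y z \<and> v = p + q \<or> x = kTimes y z \<and> v = p * q \<or>
     x = kEq y z \<and> truth v (p = q) \<or> x = kLess y z \<and> truth v (p < q) \<or>
     x = kOr y z \<and> truth v (p = 1 \<or> q = 1)" for x p q
  proof (rule eval_fold[where u = "tr y b p" and u' = "tr z b q"])
    show "eval_clause (\<lambda>w. (w = tr y b p \<or> w = tr z b q) \<and> certified eval_clause w) (tr x b v)"
      by (rule eval_clause_binary[OF _ _ that(3)]) (use that(1,2) in \<open>simp_all add: eval_def\<close>)
  qed
  show ?P
    by (rule iffI, drule eval_unfold, simp add: eval_clause_def eval_def, blast)
      (elim exE conjE, rule *, assumption+, simp)
  show ?T
    by (rule iffI, drule eval_unfold, simp add: eval_clause_def eval_def, blast)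
      (elim exE conjE, rule *, assumption+, simp)
  show ?E
    by (rule iffI, drule eval_unfold, simp add: eval_clause_def eval_def, blast)
      (elim exE conjE, rule *, assumption+, simp)
  show ?L
    by (rule iffI, drule eval_unfold, simp add: eval_clause_def eval_def, blast)
      (elim exE conjE, rule *, assumption+, simp)
  show ?O
    by (rule iffI, drule eval_unfold, simp add: eval_clause_def eval_def, blast)
      (elim exE conjE, rule *, assumption+, simp)
qed

lemma eval_clause_Ex:
  assumes "i \<noteq> j" "entry b j p"
    "v = 1 \<and> (\<exists>a. a < p \<and> (\<exists>b'. upd b i a b' \<and> X (tr y b' 1))) \<or>
     v = 0 \<and> (\<forall>a. a < p \<longrightarrow> (\<exists>b'. upd b i a b' \<and> X (tr y b' 0)))"
  shows "eval_clause X (tr (kEx i (kAnd (kLess (kVar i) (kVar j)) y)) b (v :: 'a))"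
  unfolding eval_clause_def
  by (rule exI[of _ "kEx i (kAnd (kLess (kVar i) (kVar j)) y)"], rule exI[of _ b], rule exI[of _ v],
      rule conjI, rule refl, rule disjI2, rule disjI2, rule disjI2, rule disjI2,
      rule exI[of _ i], rule exI[of _ j], rule exI[of _ y], rule exI[of _ p])
    (intro conjI refl assms)

text \<open>The converse for value 0 requires a certificate for every \<open>a < p\<close>, where
  \<open>p\<close> may be nonstandard. Collection bounds the codes of these certificates by some
  \<open>B\<close>, and \<open>glue\<close> unites them.\<close>

lemma eval_Ex:
  "eval (kEx i (kAnd (kLess (kVar i) (kVar j)) y)) b (v :: 'a) \<longleftrightarrow>
     i \<noteq> j \<and> (\<exists>p. entry b j p \<and>
       (v = 1 \<and> (\<exists>a. a < p \<and> (\<exists>b'. upd b i a b' \<and> eval y b' 1)) \<or>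
        v = 0 \<and> (\<forall>a. a < p \<longrightarrow> (\<exists>b'. upd b i a b' \<and> eval y b' 0))))" (is "eval ?x b v \<longleftrightarrow> ?R")
proof
  show ?R if "eval ?x b v"
    using eval_unfold[OF that] by (simp add: eval_clause_def eval_def)
  assume R: ?R
  then obtain p where p: "i \<noteq> j" "entry b j p" by blast
  let ?G = "\<lambda>B u. \<exists>C. C < B \<and> cert eval_clause C \<and> inseq u C"
  have "\<exists>B. v = 1 \<and> (\<exists>a. a < p \<and> (\<exists>b'. upd b i a b' \<and> ?G B (tr y b' 1))) \<or>
        v = 0 \<and> (\<forall>a. a < p \<longrightarrow> (\<exists>b'. upd b i a b' \<and> ?G B (tr y b' 0)))"
  proof (cases "v = 1")
    case True
    then obtain a b' C where "a < p" "upd b i a b'" "cert eval_clause C" "inseq (tr y b' 1) C"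
      using R p entry_unique unfolding eval_def certified_def by fastforce
    moreover have "C < C + 1" by simp
    ultimately show ?thesis using True by blast
  next
    case False
    then have v: "v = 0" and *: "\<forall>a. a < p \<longrightarrow> (\<exists>b'. upd b i a b' \<and> eval y b' 0)"
      using R entry_unique[OF p(2)] by blast+
    have "\<exists>B. \<forall>a. a < p \<longrightarrow> (\<exists>C. C < B \<and> (\<exists>b'. upd b i a b' \<and> cert eval_clause C \<and> inseq (tr y b' 0) C))"
    proof (rule collection)
      show "D (\<lambda>s. \<exists>b'. upd b i (s 1) b' \<and> cert eval_clause (s 0) \<and> inseq (tr y b' 0) (s 0))"
        by (intro D_intros)
      show "\<exists>C b'. upd b i a b' \<and> cert eval_clause C \<and> inseq (tr y b' 0) C" if "a < p" for a
        using * that unfolding eval_def certified_def by blast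
    qed
    then show ?thesis using v by blast
  qed
  then obtain B where B: "v = 1 \<and> (\<exists>a. a < p \<and> (\<exists>b'. upd b i a b' \<and> ?G B (tr y b' 1))) \<or>
        v = 0 \<and> (\<forall>a. a < p \<longrightarrow> (\<exists>b'. upd b i a b' \<and> ?G B (tr y b' 0)))" by blast
  have D: "D (\<lambda>s. cert eval_clause (s 0))" by (intro D_intros)
  have X: "eval_clause (?G B) (tr ?x b v)"
    by (rule eval_clause_Ex[OF p B])
  show "eval ?x b v" unfolding eval_def
    by (rule glue[where \<Phi> = eval_clause and B = B]) (fact D, fact eval_clause_mono, fact X)
qed

lemma eval_cases [consumes 1, case_names Var Zero Succ Neg Plus Times Eq Less Or Ex]:
  assumes "eval x b (v :: 'a)"
  obtains i where "x = kVar i" | "x = kZero" | y where "x = kSucc y" | y where "x = kNeg y"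
  | y z where "x = kPlus y z" | y z where "x = kTimes y z" | y z where "x = kEq y z"
  | y z where "x = kLess y z" | y z where "x = kOr y z"
  | i j y where "x = kEx i (kAnd (kLess (kVar i) (kVar j)) y)"
  using eval_unfold[OF assms] unfolding eval_clause_def pr_inj by (elim exE conjE disjE) simp_all

lemma upd_same: "same b b' \<Longrightarrow> upd b i a c \<Longrightarrow> upd b' i a c"
  unfolding same_def upd_def by (metis seq_length)

text \<open>Only the entries of an assignment enter into \<open>eval\<close>. In the quantifier case
  every update of \<open>b\<close> is, by \<open>upd_same\<close>, literally an update of
  \<open>b'\<close>.\<close>

lemma eval_same: "eval x b (v :: 'a) \<Longrightarrow> same b b' \<Longrightarrow> eval x b' v"
proof -
  have "\<forall>b v. eval x b v \<and> same b b' \<longrightarrow> eval x b' v" for x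
  proof (rule less_induct[where P = "\<lambda>x. \<forall>b v. eval x b v \<and> same b b' \<longrightarrow> eval x b' v"])
    show "D (\<lambda>s. \<forall>b v. eval (s 0) b v \<and> same b b' \<longrightarrow> eval (s 0) b' v)"
      unfolding same_def by (intro D_intros)
    fix x assume IH: "\<And>y. y < x \<Longrightarrow> \<forall>b v. eval y b v \<and> same b b' \<longrightarrow> eval y b' v"
    show "\<forall>b v. eval x b v \<and> same b b' \<longrightarrow> eval x b' v"
    proof (intro allI impI, elim conjE)
      fix b v assume ev: "eval x b v" and sm: "same b b'"
      have IH': "eval y b w \<Longrightarrow> eval y b' w" if "y < x" for y w using IH[OF that] sm by blast
      have en: "entry b = entry b'" using sm by (auto simp: same_def fun_eq_iff)
      from ev show "eval x b' v"
      proof (cases rule: eval_cases)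
        case (Ex i j y)
        then show ?thesis using ev upd_same[OF sm] unfolding Ex eval_Ex en by blast
      next
        case (Succ y)
        then show ?thesis using ev IH'[of y] by (fastforce simp: less_pr)
      next
        case (Neg y)
        then show ?thesis using ev IH'[of y] by (fastforce simp: less_pr)
      next
        case (Plus y z)
        then show ?thesis using ev IH'[of y] IH'[of z] by (fastforce simp: less_pr)
      next
        case (Times y z)
        then show ?thesis using ev IH'[of y] IH'[of z] by (fastforce simp: less_pr)
      next
        case (Eq y z)
        then show ?thesis using ev IH'[of y] IH'[of z] by (fastforce simp: less_pr)
      next
        case (Less y z)
        then show ?thesis using ev IH'[of y] IH'[of z] by (fastforce simp: less_pr)
      next
        case (Or y z)
        then show ?thesis using ev IH'[of y] IH'[of z] by (fastforce simp: less_pr)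
      qed (use ev en in auto)
    qed
  qed
  then show "eval x b v \<Longrightarrow> same b b' \<Longrightarrow> eval x b' v" by blast
qed

lemma upd_entry:
  assumes "upd a i y b" shows "entry b k x \<longleftrightarrow> (if k = i then x = y else entry a k (x :: 'a))"
proof -
  obtain l where l: "seq a l" "seq b l" "entry b i y"
    "\<And>k x. k < l \<Longrightarrow> k \<noteq> i \<Longrightarrow> entry a k x \<Longrightarrow> entry b k x"
    using assms unfolding upd_def by blast
  show ?thesis
  proof (cases "k = i")
    case True
    then show ?thesis using l(3) entry_unique by auto
  next
    case False
    have "entry a k x" if "entry b k x"
      using l(4)[OF entry_length[OF that l(2)] False] entry_ex[OF l(1) entry_length[OF that l(2)]]
        entry_unique[OF that] by blast
    then show ?thesis using False l(4)[OF _ False] entry_length[OF _ l(1)] by auto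
  qed
qed

lemma upd_seq: "upd a i y b \<Longrightarrow> seq a l \<longleftrightarrow> seq b l"
  unfolding upd_def by (metis seq_length)

lemma upd_ex: assumes "seq a l" "i < (l :: 'a)" shows "\<exists>b. upd a i y b"
proof -
  have "\<exists>b. seq b l \<and> (\<forall>k. k < l \<longrightarrow> (\<exists>x. (k = i \<and> x = y \<or> k \<noteq> i \<and> entry a k x) \<and> entry b k x))"
  proof (rule seq_exists)
    show "D (\<lambda>s. s 1 = i \<and> s 0 = y \<or> s 1 \<noteq> i \<and> entry a (s 1) (s 0))" by (intro D_intros)
    show "\<exists>x. k = i \<and> x = y \<or> k \<noteq> i \<and> entry a k x" if "k < l" for k
      using entry_ex[OF assms(1) that] by auto
  qed
  then obtain b where b: "seq b l"
    "\<And>k. k < l \<Longrightarrow> \<exists>x. (k = i \<and> x = y \<or> k \<noteq> i \<and> entry a k x) \<and> entry b k x" by blast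
  have "entry b i y" using b(2)[OF assms(2)] by auto
  moreover have "entry b k x" if "k < l" "k \<noteq> i" "entry a k x" for k x
    using b(2)[OF that(1)] that entry_unique by blast
  ultimately show ?thesis unfolding upd_def using assms b by blast
qed

lemma upd_upd_same: "upd a i y b \<Longrightarrow> upd a i y c \<Longrightarrow> same b (c :: 'a)"
  unfolding same_def by (simp add: upd_entry) (meson upd_def upd_seq)

lemma truth_unique: "truth v P \<Longrightarrow> truth w P \<Longrightarrow> v = w"
  by (auto simp: truth_def)

lemma eval_unique: "eval x b (v :: 'a) \<Longrightarrow> eval x b w \<Longrightarrow> v = w"
proof -
  have "\<forall>b v w. eval x b v \<and> eval x b w \<longrightarrow> v = w" for x :: 'a
  proof (rule less_induct[where P = "\<lambda>x. \<forall>b v w. eval x b v \<and> eval x b w \<longrightarrow> v = w"])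
    show "D (\<lambda>s. \<forall>b v w. eval (s 0) b v \<and> eval (s 0) b w \<longrightarrow> v = w)" by (intro D_intros)
    fix x :: 'a assume IH: "\<And>y. y < x \<Longrightarrow> \<forall>b v w. eval y b v \<and> eval y b w \<longrightarrow> v = w"
    show "\<forall>b v w. eval x b v \<and> eval x b w \<longrightarrow> v = w"
    proof (intro allI impI, elim conjE)
      fix b v w assume ev: "eval x b v" "eval x b w"
      have IH': "v = w" if "y < x" "eval y b v" "eval y b w" for y b v w using IH[OF that(1)] that by blast
      from ev(1) show "v = w"
      proof (cases rule: eval_cases)
        case (Var i)
        then show ?thesis using ev entry_unique by auto
      next
        case Zero
        then show ?thesis using ev by simp
      next
        case (Ex i j y)
        \<comment> \<open>Values 1 and 0 would provide two updates of \<open>b\<close> with the same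
          witness, possibly with different codes; \<open>eval_same\<close> reduces them to one
          assignment.\<close>
        have "eval y b1 1 \<Longrightarrow> eval y b2 0 \<Longrightarrow> upd b i a b1 \<Longrightarrow> upd b i a b2 \<Longrightarrow> False" for a b1 b2
          using IH'[of y b2 1 0] eval_same[OF _ upd_upd_same] Ex by (fastforce simp: less_pr)
        then show ?thesis using ev unfolding Ex eval_Ex using entry_unique by blast
      next
        case (Succ y)
        then show ?thesis using ev IH'[of y] by (fastforce simp: less_pr)
      next
        case (Neg y)
        then have "\<exists>p. eval y b p \<and> truth v (p \<noteq> 1)" "\<exists>p. eval y b p \<and> truth w (p \<noteq> 1)" using ev by auto
        then show ?thesis using IH'[of y] Neg truth_unique by (metis less_pr2 order_refl)
      next
        case (Plus y z)
        then have "\<exists>p q. eval y b p \<and> eval z b q \<and> v = p + q" "\<exists>p q. eval y b p \<and> eval z b q \<and> w = p + q"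
          using ev by auto
        moreover have "y < x" "z < x" using Plus by (auto simp: less_pr)
        ultimately show ?thesis using IH' by metis
      next
        case (Times y z)
        then have "\<exists>p q. eval y b p \<and> eval z b q \<and> v = p * q" "\<exists>p q. eval y b p \<and> eval z b q \<and> w = p * q"
          using ev by auto
        moreover have "y < x" "z < x" using Times by (auto simp: less_pr)
        ultimately show ?thesis using IH' by metis
      next
        case (Eq y z)
        then have "\<exists>p q. eval y b p \<and> eval z b q \<and> truth v (p = q)"
          "\<exists>p q. eval y b p \<and> eval z b q \<and> truth w (p = q)" using ev by auto
        moreover have "y < x" "z < x" using Eq by (auto simp: less_pr)
        ultimately show ?thesis using IH' truth_unique by metis
      next
        case (Less y z)
        then have "\<exists>p q. eval y b p \<and> eval z b q \<and> truth v (p < q)"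
          "\<exists>p q. eval y b p \<and> eval z b q \<and> truth w (p < q)" using ev by auto
        moreover have "y < x" "z < x" using Less by (auto simp: less_pr)
        ultimately show ?thesis using IH' truth_unique by metis
      next
        case (Or y z)
        then have "\<exists>p q. eval y b p \<and> eval z b q \<and> truth v (p = 1 \<or> q = 1)"
          "\<exists>p q. eval y b p \<and> eval z b q \<and> truth w (p = 1 \<or> q = 1)" using ev by auto
        moreover have "y < x" "z < x" using Or by (auto simp: less_pr)
        ultimately show ?thesis using IH' truth_unique by metis
      qed
    qed
  qed
  then show "eval x b v \<Longrightarrow> eval x b w \<Longrightarrow> v = w" by blast
qed

lemma eval_term_ex: "isT n t \<Longrightarrow> seq a n \<Longrightarrow> \<exists>v. eval t a (v :: 'a)"
proof (rule isT_induct[where P = "\<lambda>t. \<exists>v. eval t a v"])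
  show "D (\<lambda>s. \<exists>v. eval (s 0) a v)" by (intro D_intros)
qed (auto dest: entry_ex)

lemma eval_term_agree:
  assumes "isT n t" and agree: "\<And>k x. k < n \<Longrightarrow> entry a k x \<Longrightarrow> entry b k x" and "eval t a (v :: 'a)"
  shows "eval t b v"
proof -
  have "\<forall>v. eval t a v \<longrightarrow> eval t b v"
  proof (rule isT_induct[where P = "\<lambda>t. \<forall>v. eval t a v \<longrightarrow> eval t b v", OF _ assms(1)])
    show "D (\<lambda>s. \<forall>v. eval (s 0) a v \<longrightarrow> eval (s 0) b v)" by (intro D_intros)
  qed (auto dest: agree)
  then show ?thesis using assms(3) by blast
qed

text \<open>\<open>b'\<close> arises from \<open>b\<close> by deleting entry \<open>n\<close>, where
  the value of \<open>z\<^sub>1\<close> is kept. This is the semantic side of replacing each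
  \<open>z\<^sub>i\<close> by \<open>z\<^sub>i\<^sub>+\<^sub>1\<close>.\<close>

definition shifted where
  "shifted n b b' \<longleftrightarrow> (\<exists>l. seq b' l \<and> n \<le> l \<and> seq b (l + 1)) \<and>
     (\<forall>k x. k < n \<longrightarrow> entry b' k x \<longrightarrow> entry b k x) \<and>
     (\<forall>k x. \<not> k < n \<longrightarrow> entry b' k x \<longrightarrow> entry b (k + 1) (x :: 'a))"

lemma shifted_upd:
  assumes sh: "shifted n b b'" and i: "i < n" and u': "upd b' i a c'" and u: "upd b i a c"
  shows "shifted n c c'"
proof -
  have "k + 1 \<noteq> i" if "\<not> k < n" for k
  proof
    assume "k + 1 = i"
    moreover have "k < k + 1" by simp
    ultimately have "k < n" using i by (metis less_trans)
    then show False using that by simp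
  qed
  then show ?thesis
    using sh i unfolding shifted_def upd_entry[OF u'] upd_entry[OF u] upd_seq[OF u', symmetric] upd_seq[OF u, symmetric]
    by auto
qed

text \<open>The renaming lemma for \<open>tilde\<close>, by course-of-values induction on the code.
  Being stated for any \<open>v\<close>, it transfers truth, falsity and the values of terms at
  once.\<close>

lemma tilde_eval:
  assumes "tilde n x y" "shifted n b b'" "eval x b' v" shows "eval y b (v :: 'a)"
proof -
  have "\<forall>y b b' v. tilde n x y \<and> shifted n b b' \<and> eval x b' v \<longrightarrow> eval y b v"
  proof (rule less_induct[where P = "\<lambda>x. \<forall>y b b' v. tilde n x y \<and> shifted n b b' \<and> eval x b' v \<longrightarrow> eval y b v"])
    show "D (\<lambda>s. \<forall>y b b' v. tilde n (s 0) y \<and> shifted n b b' \<and> eval (s 0) b' v \<longrightarrow> eval y b v)"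
      unfolding shifted_def by (intro D_intros)
    fix x assume IH: "\<And>u. u < x \<Longrightarrow> \<forall>y b b' v. tilde n u y \<and> shifted n b b' \<and> eval u b' v \<longrightarrow> eval y b v"
    show "\<forall>y b b' v. tilde n x y \<and> shifted n b b' \<and> eval x b' v \<longrightarrow> eval y b v"
    proof (intro allI impI, elim conjE)
      fix y b b' v assume ti: "tilde n x y" and sh: "shifted n b b'" and ev: "eval x b' v"
      have IH': "eval y b v" if "u < x" "tilde n u y" "shifted n b b'" "eval u b' v" for u y b b' v
        using IH[OF that(1)] that by blast
      from ev show "eval y b v"
      proof (cases rule: eval_cases)
        case (Var i)
        then show ?thesis using ti ev sh by (auto simp: shifted_def split: if_splits)
      next
        case (Ex i j z)
        \<comment> \<open>The bounding variable \<open>j\<close> can itself be one of the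
          \<open>z\<^sub>i\<close> and is then renamed, while the bound variable \<open>i\<close> is
          below \<open>n\<close> and stays.\<close>
        define j' where "j' = (if j < n then j else j + 1)"
        obtain z' where i: "i < n" and z': "tilde n z z'" and y: "y = kEx i (kAnd (kLess (kVar i) (kVar j')) z')"
          using ti unfolding Ex by (auto simp: j'_def)
        have zx: "z < x" unfolding Ex by (simp add: less_pr)
        obtain p where ij: "i \<noteq> j" and p: "entry b' j p" and
          v: "v = 1 \<and> (\<exists>a. a < p \<and> (\<exists>b1. upd b' i a b1 \<and> eval z b1 1)) \<or>
              v = 0 \<and> (\<forall>a. a < p \<longrightarrow> (\<exists>b1. upd b' i a b1 \<and> eval z b1 0))"
          using ev unfolding Ex eval_Ex by blast
        have ij': "i \<noteq> j'"
        proof (cases "j < n")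
          case False
          have "i < j + 1" using i False less_trans[of i j "j + 1"] by (metis less_add_one_iff less_imp_le not_less order.trans)
          then show ?thesis using False by (auto simp: j'_def)
        qed (use ij in \<open>simp add: j'_def\<close>)
        have p': "entry b j' p" using p sh by (auto simp: j'_def shifted_def)
        obtain l where "seq b l" "i < l" using sh i unfolding shifted_def
          by (metis less_add_one_iff less_imp_le less_le_trans)
        then have ex: "\<exists>c. upd b i a c" for a by (rule upd_ex)
        have step: "\<exists>c. upd b i a c \<and> eval z' c w" if b1: "upd b' i a b1" "eval z b1 w" for a b1 w
        proof -
          obtain c where c: "upd b i a c" using ex by blast
          then show ?thesis using IH'[OF zx z' shifted_upd[OF sh i b1(1) c] b1(2)] by blast
        qed
        show ?thesis unfolding y eval_Ex using ij' p' v step by blast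
      next
        case Zero
        then show ?thesis using ti ev by simp
      next
        case (Succ z)
        then show ?thesis using ti ev sh IH'[of z _ b b'] by (fastforce simp: less_pr)
      next
        case (Neg z)
        then show ?thesis using ti ev sh IH'[of z _ b b'] by (fastforce simp: less_pr)
      next
        case (Plus z z')
        then show ?thesis using ti ev sh IH'[of z _ b b'] IH'[of z' _ b b'] by (fastforce simp: less_pr)
      next
        case (Times z z')
        then show ?thesis using ti ev sh IH'[of z _ b b'] IH'[of z' _ b b'] by (fastforce simp: less_pr)
      next
        case (Eq z z')
        then show ?thesis using ti ev sh IH'[of z _ b b'] IH'[of z' _ b b'] by (fastforce simp: less_pr)
      next
        case (Less z z')
        then show ?thesis using ti ev sh IH'[of z _ b b'] IH'[of z' _ b b'] by (fastforce simp: less_pr)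
      next
        case (Or z z')
        then show ?thesis using ti ev sh IH'[of z _ b b'] IH'[of z' _ b b'] by (fastforce simp: less_pr)
      qed
    qed
  qed
  then show ?thesis using assms by blast
qed

end

section \<open>The set defined by \<open>\<sigma>\<close>\<close>

definition next_in where
  "next_in J x y \<longleftrightarrow> y \<in> J \<and> x < y \<and> \<not> (\<exists>z. z \<in> J \<and> x < z \<and> z < y)"

definition exceed where
  "exceed j p a \<longleftrightarrow> p < j \<and> (\<forall>s x. entry a s x \<longrightarrow> x < j)"

text \<open>\<open>e\<close> starts with \<open>j\<close> and its next \<open>k\<close> successors in \<open>J\<close>, and \<open>b\<close> with \<open>a\<close> followed by these
  successors; both may be longer, so that one configuration serves both parts of a disjunction.\<close>

definition config where
  "config J n a j k e b \<longleftrightarrow>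
     entry e 0 j \<and>
     (\<forall>s. s < k \<longrightarrow> (\<exists>y z. entry e s y \<and> entry e (s + 1) z \<and> next_in J y z)) \<and>
     (\<exists>l. seq b l \<and> n + k \<le> l) \<and>
     (\<forall>s. s < n \<longrightarrow> (\<exists>y. entry a s y \<and> entry b s y)) \<and>
     (\<forall>s. s < k \<longrightarrow> (\<exists>y. entry e (s + 1) y \<and> entry b (n + s) y))"

definition sig where
  "sig J x \<longleftrightarrow> (\<exists>p a n psi k j e b. x = pr p a \<and> seq a n \<and> isF n p \<and> star n p psi k \<and>
     j \<in> J \<and> exceed j p a \<and> \<not> (\<exists>j'. j' \<in> J \<and> exceed j' p a \<and> j' < j) \<and>
     seq e (k + 1) \<and> entry e 0 j \<and>
     (\<forall>s. s < k \<longrightarrow> (\<exists>y z. entry e s y \<and> entry e (s + 1) z \<and> next_in J y z)) \<and>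
     seq b (n + k) \<and>
     (\<forall>s. s < n \<longrightarrow> (\<exists>y. entry a s y \<and> entry b s y)) \<and>
     (\<forall>s. s < k \<longrightarrow> (\<exists>y. entry e (s + 1) y \<and> entry b (n + s) y)) \<and>
     eval psi b 1)"

definition tarski where
  "tarski S \<longleftrightarrow> (\<forall>n a. seq a n \<longrightarrow>
     (\<forall>s t. isT n s \<and> isT n t \<longrightarrow>
        (S (pr (kEq s t) a) \<longleftrightarrow> (\<exists>y z. eval s a y \<and> eval t a z \<and> y = z)) \<and>
        (S (pr (kLess s t) a) \<longleftrightarrow> (\<exists>y z. eval s a y \<and> eval t a z \<and> y < z))) \<and>
     (\<forall>p. isF n p \<longrightarrow> (S (pr (kNeg p) a) \<longleftrightarrow> \<not> S (pr p a))) \<and>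
     (\<forall>p q. isF n p \<and> isF n q \<longrightarrow> (S (pr (kOr p q) a) \<longleftrightarrow> S (pr p a) \<or> S (pr q a))) \<and>
     (\<forall>i p. i < n \<and> isF n p \<longrightarrow>
        (S (pr (kEx i p) a) \<longleftrightarrow> (\<exists>y b. upd a i y b \<and> S (pr p b)))))"

lemma tarskiD:
  assumes "tarski S" "seq a n"
  shows "isT n s \<Longrightarrow> isT n t \<Longrightarrow>
      S (pr (kEq s t) a) \<longleftrightarrow> (\<exists>y z. eval s a y \<and> eval t a z \<and> y = z)"
    and "isT n s \<Longrightarrow> isT n t \<Longrightarrow>
      S (pr (kLess s t) a) \<longleftrightarrow> (\<exists>y z. eval s a y \<and> eval t a z \<and> y < z)"
    and "isF n p \<Longrightarrow> S (pr (kNeg p) a) \<longleftrightarrow> \<not> S (pr p a)"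
    and "isF n p \<Longrightarrow> isF n q \<Longrightarrow> S (pr (kOr p q) a) \<longleftrightarrow> S (pr p a) \<or> S (pr q a)"
    and "i < n \<Longrightarrow> isF n p \<Longrightarrow> S (pr (kEx i p) a) \<longleftrightarrow> (\<exists>y b. upd a i y b \<and> S (pr p b))"
  using assms(1)[unfolded tarski_def, rule_format, OF assms(2)] by simp_all

text \<open>This contains a totality claim: \<open>psi\<close> has a truth value under
  \<open>b\<close> at all. The clauses for negation and disjunction evaluate their parts and rely on
  it.\<close>

definition represents where
  "represents J n S p \<longleftrightarrow> (\<forall>a j psi k e b. seq a n \<and> j \<in> J \<and> exceed j p a \<and> star n p psi k \<and>
     config J n a j k e b \<longrightarrow> (\<exists>v. truth v (S (pr p a)) \<and> eval psi b v))"

lemma config_mono: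
  fixes k :: "'a::{discrete_linordered_semidom, canonically_ordered_monoid_add}"
  assumes "config J n a j k e b" "k' \<le> k"
  shows "config J n a j k' e b"
proof -
  have "n + k' \<le> n + k" using assms(2) by simp
  then show ?thesis using assms unfolding config_def by (meson less_le_trans order.trans)
qed

section \<open>Satisfaction classes computed by the transformed formulae\<close>

context pam
begin

lemma zero_or_succ: obtains "s = 0" | t where "s = t + (1 :: 'a)"
proof (cases "s = 0")
  case False
  then have "1 \<le> s" using less_iff_succ_less_eq[of 0 s] by (simp add: zero_less_iff_neq_zero)
  then show ?thesis using that le_iff_add[of 1 s] by (auto simp: add.commute)
qed simp

lemma map_seq_exists:
  assumes "D (\<lambda>s. R (s 1) (s 0))" "\<And>i. i < l \<Longrightarrow> \<exists>x. R i x" "\<And>i x y. R i x \<Longrightarrow> R i y \<Longrightarrow> x = y"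
  shows "\<exists>s. seq s l \<and> (\<forall>i x. entry s i x \<longleftrightarrow> i < l \<and> R i x)"
  using seq_exists[OF assms(1,2)] assms(3) entry_unique entry_length by metis

lemma truth_ex: "\<exists>v. truth v P"
  unfolding truth_def by blast

lemma truth_one: "truth (v :: 'a) P \<Longrightarrow> v = 1 \<longleftrightarrow> P"
  by (auto simp: truth_def)

text \<open>Entering the scope of a quantifier: the first successor \<open>j'\<close> of
  \<open>j\<close>, which is the value of \<open>z\<^sub>1\<close> and sits at position
  \<open>n\<close> of \<open>b\<close>, becomes the new start. Accordingly \<open>e\<close> loses
  its first entry, \<open>b\<close> its entry at \<open>n\<close>, and \<open>k + 1\<close> drops to
  \<open>k\<close>.\<close>

lemma config_step:
  assumes cf: "config J n a j (k + 1) e b" and a: "seq a n" and u: "upd a i y a'" and i: "i < n"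
  obtains j' e' b' where "entry b n j'" "next_in J j (j' :: 'a)" "config J n a' j' k e' b'"
    "\<And>c. upd b i y c \<Longrightarrow> shifted n c b'"
proof -
  have e0: "entry e 0 j"
    and ch: "\<And>s. s < k + 1 \<Longrightarrow> \<exists>y z. entry e s y \<and> entry e (s + 1) z \<and> next_in J y z"
    and ab: "\<And>s. s < n \<Longrightarrow> \<exists>y. entry a s y \<and> entry b s y"
    and eb: "\<And>s. s < k + 1 \<Longrightarrow> \<exists>y. entry e (s + 1) y \<and> entry b (n + s) y"
    using cf unfolding config_def by blast+
  obtain l where l: "seq b l" "n + (k + 1) \<le> l" using cf unfolding config_def by blast
  have "0 < k + 1" by (simp add: add_nonneg_pos)
  then obtain j' where j': "entry e 1 j'" "next_in J j j'" using ch[of 0] entry_unique[OF e0] by auto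
  have bj': "entry b n j'" using eb[OF \<open>0 < k + 1\<close>] entry_unique[OF j'(1)] by auto
  obtain L where L: "l = L + 1" using l(2) by (cases rule: zero_or_succ[of l]) (auto simp: add_nonneg_pos)
  have nkL: "n + k \<le> L" using l(2) unfolding L by (simp flip: add.assoc)
  have nL: "s < n \<Longrightarrow> s < L" for s using nkL by (meson add_increasing2 less_le_trans order.trans order_refl zero_le)
  have a': "seq a' n" using a upd_seq[OF u] by simp
  have "\<exists>s. seq s L \<and> (\<forall>i x. entry s i x \<longleftrightarrow> i < L \<and> (i < n \<and> entry a' i x \<or> \<not> i < n \<and> entry b (i + 1) x))"
  proof (rule map_seq_exists)
    show "D (\<lambda>s. s 1 < n \<and> entry a' (s 1) (s 0) \<or> \<not> s 1 < n \<and> entry b (s 1 + 1) (s 0))" by (intro D_intros)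
    show "\<exists>x. s < n \<and> entry a' s x \<or> \<not> s < n \<and> entry b (s + 1) x" if "s < L" for s
      using entry_ex[OF a', of s] entry_ex[OF l(1), of "s + 1"] that by (auto simp: L)
  qed (auto dest: entry_unique)
  then obtain b' where b': "seq b' L"
    "\<And>i x. entry b' i x \<longleftrightarrow> i < L \<and> (i < n \<and> entry a' i x \<or> \<not> i < n \<and> entry b (i + 1) x)" by blast
  have "\<exists>s. seq s (k + 1) \<and> (\<forall>i x. entry s i x \<longleftrightarrow> i < k + 1 \<and> entry e (i + 1) x)"
  proof (rule map_seq_exists)
    show "D (\<lambda>s. entry e (s 1 + 1) (s 0))" by (intro D_intros)
    show "\<exists>x. entry e (s + 1) x" if "s < k + 1" for s using ch[OF that] by blast
  qed (auto dest: entry_unique)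
  then obtain e' where e': "\<And>i x. entry e' i x \<longleftrightarrow> i < k + 1 \<and> entry e (i + 1) x" by blast
  have lt1: "s < k + 1" "s + 1 < k + 1" if "s < k" for s
    using that less_iff_succ_less_eq[of s k] by (simp_all add: less_add_one_iff)
  have "config J n a' j' k e' b'"
    unfolding config_def
  proof (intro conjI allI impI)
    show "entry e' 0 j'" using j'(1) \<open>0 < k + 1\<close> by (simp add: e')
    show "\<exists>y z. entry e' s y \<and> entry e' (s + 1) z \<and> next_in J y z" if "s < k" for s
      using ch[OF lt1(2)[OF that]] lt1[OF that] by (auto simp: e')
    show "\<exists>l. seq b' l \<and> n + k \<le> l" using b'(1) nkL by blast
    show "\<exists>y. entry a' s y \<and> entry b' s y" if "s < n" for s
      using entry_ex[OF a' that] that nL[OF that] by (auto simp: b')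
    show "\<exists>y. entry e' (s + 1) y \<and> entry b' (n + s) y" if "s < k" for s
    proof -
      have "n + s < L" using nkL that by (meson add_less_cancel_left less_le_trans)
      moreover have "\<not> n + s < n" by (simp add: not_less)
      ultimately show ?thesis
        using eb[OF lt1(2)[OF that]] lt1(2)[OF that] by (auto simp: e' b' add.assoc)
    qed
  qed
  moreover have "shifted n c b'" if c: "upd b i y c" for c
    unfolding shifted_def
  proof (intro conjI allI impI)
    have "n \<le> L" using nkL by (meson add_increasing2 order.trans order_refl zero_le)
    then show "\<exists>l. seq b' l \<and> n \<le> l \<and> seq c (l + 1)"
      using b'(1) l(1) upd_seq[OF c] unfolding L by blast
    show "entry c s x" if "s < n" "entry b' s x" for s x
      using that ab[OF that(1)] by (auto simp: b' upd_entry[OF u] upd_entry[OF c] dest: entry_unique)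
    show "entry c (s + 1) x" if "\<not> s < n" "entry b' s x" for s x
    proof -
      have "s + 1 \<noteq> i" using that(1) i by (metis less_add_one less_trans)
      then show ?thesis using that by (simp add: b' upd_entry[OF c])
    qed
  qed
  ultimately show ?thesis using that bj' j'(2) by blast
qed

text \<open>All clauses but the existential one follow from the Tarski clauses of \<open>S\<close>
  and the values of the immediate subformulae. A true existential formula must have a witness below
  the bound \<open>j'\<close>, which is what \<open>witness\<close> grants; it may refer to
  \<open>represents\<close> for the body, since the induction hypothesis is at hand when it is
  invoked.\<close>

lemma represents:
  assumes J: "D (\<lambda>s. s 0 \<in> J)" and S: "D (\<lambda>s. S (s 0))" and T: "tarski S" and p: "isF n (p :: 'a)"
    and witness: "\<And>i p a j j'. isF n p \<Longrightarrow> i < n \<Longrightarrow> represents J n S p \<Longrightarrow> seq a n \<Longrightarrow> j \<in> J \<Longrightarrow>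
      exceed j (kEx i p) a \<Longrightarrow> next_in J j j' \<Longrightarrow> S (pr (kEx i p) a) \<Longrightarrow>
      \<exists>y a'. y < j' \<and> upd a i y a' \<and> S (pr p a')"
  shows "represents J n S p"
proof (rule isF_induct[where P = "represents J n S", OF _ p])
  note [D_intros] = D_app1[where R = S, OF S] D_app1[where R = "\<lambda>x. x \<in> J", OF J]
  show "D (\<lambda>s. represents J n S (s 0))"
    unfolding represents_def exceed_def config_def next_in_def by (intro D_intros)
next
  fix s t assume st: "isT n s" "isT n t"
  have *: "\<exists>y z. eval s a y \<and> eval t a z \<and> eval s b y \<and> eval t b z \<and>
      (S (pr (kEq s t) a) \<longleftrightarrow> y = z) \<and> (S (pr (kLess s t) a) \<longleftrightarrow> y < z)"
    if a: "seq a n" and cf: "config J n a j k e b" for a j k e b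
  proof -
    have agree: "entry b s y" if "s < n" "entry a s y" for s y
      using cf that entry_unique unfolding config_def by metis
    obtain y z where yz: "eval s a y" "eval t a z" using eval_term_ex[OF _ a] st by blast
    have "eval s b y" "eval t b z"
      using eval_term_agree[OF st(1) agree yz(1)] eval_term_agree[OF st(2) agree yz(2)] by blast+
    moreover have "S (pr (kEq s t) a) \<longleftrightarrow> (\<exists>y z. eval s a y \<and> eval t a z \<and> y = z)"
      "S (pr (kLess s t) a) \<longleftrightarrow> (\<exists>y z. eval s a y \<and> eval t a z \<and> y < z)"
      using tarskiD(1,2)[OF T a st] .
    ultimately show ?thesis using yz eval_unique by metis
  qed
  show "represents J n S (kEq s t)" unfolding represents_def
  proof (intro allI impI, elim conjE)
    fix a j psi k e b assume a: "seq a n" and st: "star n (kEq s t) psi k" and cf: "config J n a j k e b"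
    obtain y z where "eval s b y" "eval t b z" "S (pr (kEq s t) a) \<longleftrightarrow> y = z" using *[OF a cf] by blast
    then show "\<exists>v. truth v (S (pr (kEq s t) a)) \<and> eval psi b v"
      using st truth_ex[of "S (pr (kEq s t) a)"] by auto
  qed
  show "represents J n S (kLess s t)" unfolding represents_def
  proof (intro allI impI, elim conjE)
    fix a j psi k e b assume a: "seq a n" and st: "star n (kLess s t) psi k" and cf: "config J n a j k e b"
    obtain y z where "eval s b y" "eval t b z" "S (pr (kLess s t) a) \<longleftrightarrow> y < z" using *[OF a cf] by blast
    then show "\<exists>v. truth v (S (pr (kLess s t) a)) \<and> eval psi b v"
      using st truth_ex[of "S (pr (kLess s t) a)"] by auto
  qed
next
  fix p assume p: "isF n p" and IH: "represents J n S p"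
  show "represents J n S (kNeg p)" unfolding represents_def
  proof (intro allI impI, elim conjE)
    fix a j psi k e b assume a: "seq a n" and j: "j \<in> J" and ex: "exceed j (kNeg p) a"
      and st: "star n (kNeg p) psi k" and cf: "config J n a j k e b"
    obtain p' where p': "star n p p' k" "psi = kNeg p'" using st by auto
    have "exceed j p a" using ex unfolding exceed_def by (meson less_pr2 less_trans order_refl)
    then obtain v where v: "truth v (S (pr p a))" "eval p' b v"
      using IH a j p'(1) cf unfolding represents_def by blast
    have "S (pr (kNeg p) a) \<longleftrightarrow> v \<noteq> 1"
      using tarskiD(3)[OF T a p] truth_one[OF v(1)] by simp
    then show "\<exists>v. truth v (S (pr (kNeg p) a)) \<and> eval psi b v"
      using truth_ex[of "v \<noteq> 1"] v(2) p'(2) by auto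
  qed
next
  fix p q assume p: "isF n p" "isF n q" and IH: "represents J n S p" "represents J n S q"
  show "represents J n S (kOr p q)" unfolding represents_def
  proof (intro allI impI, elim conjE)
    fix a j psi k e b assume a: "seq a n" and j: "j \<in> J" and ex: "exceed j (kOr p q) a"
      and st: "star n (kOr p q) psi k" and cf: "config J n a j k e b"
    obtain p' k1 q' k2 where p': "star n p p' k1" "star n q q' k2" "psi = kOr p' q'"
      and k: "k = k1 \<and> \<not> k1 < k2 \<or> k = k2 \<and> k1 < k2" using st by auto
    have "k1 \<le> k" "k2 \<le> k" using k by auto
    then have cf': "config J n a j k1 e b" "config J n a j k2 e b" using config_mono[OF cf] by blast+
    have "p < kOr p q" "q < kOr p q" by (simp_all add: less_pr)
    then have "exceed j p a" "exceed j q a" using ex unfolding exceed_def by (meson less_trans)+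
    then obtain v w where v: "truth v (S (pr p a))" "eval p' b v" "truth w (S (pr q a))" "eval q' b w"
      using IH a j p' cf' unfolding represents_def by blast
    have "S (pr (kOr p q) a) \<longleftrightarrow> v = 1 \<or> w = 1"
      using tarskiD(4)[OF T a p] truth_one[OF v(1)] truth_one[OF v(3)] by simp
    then show "\<exists>v. truth v (S (pr (kOr p q) a)) \<and> eval psi b v"
      using truth_ex[of "v = 1 \<or> w = 1"] v(2,4) p'(3) by auto
  qed
next
  fix i p assume i: "i < n" and p: "isF n p" and IH: "represents J n S p"
  show "represents J n S (kEx i p)" unfolding represents_def
  proof (intro allI impI, elim conjE)
    fix a j psi k e b assume a: "seq a n" and j: "j \<in> J" and ex: "exceed j (kEx i p) a"
      and st: "star n (kEx i p) psi k" and cf: "config J n a j k e b"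
    obtain p' k1 r where p': "star n p p' k1" "tilde n p' r"
      and psi: "psi = kEx i (kAnd (kLess (kVar i) (kVar n)) r)" and k: "k = k1 + 1" using st by auto
    have T_Ex: "S (pr (kEx i p) a) \<longleftrightarrow> (\<exists>y b. upd a i y b \<and> S (pr p b))"
      by (rule tarskiD(5)[OF T a i p])
    \<comment> \<open>\<open>config_step\<close> yields its \<open>j'\<close> only for a given
      update \<open>a'\<close>. As the entry of \<open>b\<close> at \<open>n\<close> is unique, the
      \<open>j'\<close> found for one update works for all.\<close>
    obtain j' where bj': "entry b n j'" and nx: "next_in J j j'"
      and step: "\<And>y a'. upd a i y a' \<Longrightarrow>
        \<exists>e' b'. config J n a' j' k1 e' b' \<and> (\<forall>c. upd b i y c \<longrightarrow> shifted n c b')"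
    proof -
      obtain a0 where "upd a i 0 a0" using upd_ex[OF a i] by blast
      from config_step[OF cf[unfolded k] a this i]
      obtain j' where j': "entry b n j'" "next_in J j j'" by blast
      have "\<exists>e' b'. config J n a' j' k1 e' b' \<and> (\<forall>c. upd b i y c \<longrightarrow> shifted n c b')"
        if "upd a i y a'" for y a'
        using config_step[OF cf[unfolded k] a that i] entry_unique[OF j'(1)] by metis
      then show ?thesis using that j' by blast
    qed
    have j'J: "j' \<in> J" "j < j'" using nx by (auto simp: next_in_def)
    obtain l where l: "seq b l" "i < l"
      using cf i unfolding config_def by (meson add_increasing2 less_le_trans order_refl zero_le)
    \<comment> \<open>For \<open>y\<close> below \<open>j'\<close> the induction hypothesis applies
      with start \<open>j'\<close>, because \<open>j'\<close> exceeds \<open>p\<close>, the entries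
      of \<open>a\<close> and also \<open>y\<close>.\<close>
    have main: "\<exists>c v. upd b i y c \<and> truth v (S (pr p a')) \<and> eval r c v"
      if "y < j'" and u: "upd a i y a'" for y a'
    proof -
      obtain e' b' where cf': "config J n a' j' k1 e' b'" and sh: "\<forall>c. upd b i y c \<longrightarrow> shifted n c b'"
        using step[OF u] by blast
      have "p < kEx i p" by (simp add: less_pr)
      then have "p < j'" using ex j'J unfolding exceed_def by (meson less_trans)
      moreover have "x < j'" if "entry a' s x" for s x
        using that ex j'J \<open>y < j'\<close> unfolding upd_entry[OF u] exceed_def
        by (auto split: if_splits intro: less_trans)
      ultimately have "exceed j' p a'" by (simp add: exceed_def)
      then obtain v where v: "truth v (S (pr p a'))" "eval p' b' v"
        using IH a upd_seq[OF u] j'J p'(1) cf' unfolding represents_def by blast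
      obtain c where c: "upd b i y c" using upd_ex[OF l] by blast
      then have "eval r c v" using tilde_eval[OF p'(2) _ v(2)] sh by blast
      then show ?thesis using c v(1) by blast
    qed
    have "i \<noteq> n" using i by simp
    show "\<exists>v. truth v (S (pr (kEx i p) a)) \<and> eval psi b v"
    proof (cases "S (pr (kEx i p) a)")
      case True
      then obtain y a' where y: "y < j'" "upd a i y a'" "S (pr p a')"
        using witness[OF p i IH a j ex nx] by blast
      obtain c v where "upd b i y c" "truth v (S (pr p a'))" "eval r c v" using main[OF y(1,2)] by blast
      moreover have "v = 1" using truth_one[OF \<open>truth v (S (pr p a'))\<close>] y(3) by simp
      ultimately have "eval psi b 1" unfolding psi eval_Ex using \<open>i \<noteq> n\<close> bj' y(1) by blast
      then show ?thesis using True by (auto simp: truth_def)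
    next
      case False
      have "\<exists>c. upd b i y c \<and> eval r c 0" if "y < j'" for y
      proof -
        obtain a' where a': "upd a i y a'" using upd_ex[OF a i] by blast
        then have "\<not> S (pr p a')" using False T_Ex by blast
        then show ?thesis using main[OF that a'] by (auto simp: truth_def)
      qed
      then have "eval psi b 0" unfolding psi eval_Ex using \<open>i \<noteq> n\<close> bj' by blast
      then show ?thesis using False by (auto simp: truth_def)
    qed
  qed
qed

section \<open>Existence of configurations\<close>

lemma next_ex:
  assumes J: "D (\<lambda>s. s 0 \<in> J)" and unb: "\<And>x. \<exists>y. y \<in> J \<and> x < y"
  shows "\<exists>y. next_in J x (y :: 'a)"
proof -
  note [D_intros] = D_app1[where R = "\<lambda>x. x \<in> J", OF J]
  obtain z where "z \<in> J \<and> x < z" using unb by blast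
  moreover have "D (\<lambda>s. s 0 \<in> J \<and> x < s 0)" by (intro D_intros)
  ultimately obtain y where "y \<in> J \<and> x < y" "\<And>z. z < y \<Longrightarrow> \<not> (z \<in> J \<and> x < z)"
    using least[where P = "\<lambda>y. y \<in> J \<and> x < y"] by blast
  then show ?thesis unfolding next_in_def by blast
qed

text \<open>The number \<open>k\<close> of successors may be nonstandard, so the chain is extended
  entry by entry within the induction of the model.\<close>

lemma chain_ex:
  assumes J: "D (\<lambda>s. s 0 \<in> J)" and unb: "\<And>x. \<exists>y. y \<in> J \<and> x < y"
  shows "\<exists>e. seq e (k + 1) \<and> entry e 0 (j :: 'a) \<and>
    (\<forall>s. s < k \<longrightarrow> (\<exists>y z. entry e s y \<and> entry e (s + 1) z \<and> next_in J y z))"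
proof (rule induct[where P = "\<lambda>k. \<exists>e. seq e (k + 1) \<and> entry e 0 j \<and>
    (\<forall>s. s < k \<longrightarrow> (\<exists>y z. entry e s y \<and> entry e (s + 1) z \<and> next_in J y z))"])
  note [D_intros] = D_app1[where R = "\<lambda>x. x \<in> J", OF J]
  show "D (\<lambda>s. \<exists>e. seq e (s 0 + 1) \<and> entry e 0 j \<and>
    (\<forall>t. t < s 0 \<longrightarrow> (\<exists>y z. entry e t y \<and> entry e (t + 1) z \<and> next_in J y z)))"
    unfolding next_in_def by (intro D_intros)
  have "\<exists>e. seq e 1 \<and> (\<forall>i x. entry e i x \<longleftrightarrow> i < 1 \<and> x = j)"
    by (rule map_seq_exists) ((intro D_intros)?, auto)
  then show "\<exists>e. seq e (0 + 1) \<and> entry e 0 j \<and>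
    (\<forall>s. s < 0 \<longrightarrow> (\<exists>y z. entry e s y \<and> entry e (s + 1) z \<and> next_in J y z))" by auto
  fix k assume "\<exists>e. seq e (k + 1) \<and> entry e 0 j \<and>
    (\<forall>s. s < k \<longrightarrow> (\<exists>y z. entry e s y \<and> entry e (s + 1) z \<and> next_in J y z))"
  then obtain e where e: "seq e (k + 1)" "entry e 0 j"
    "\<And>s. s < k \<Longrightarrow> \<exists>y z. entry e s y \<and> entry e (s + 1) z \<and> next_in J y z" by blast
  obtain y where y: "entry e k y" using entry_ex[OF e(1), of k] by auto
  obtain z where z: "next_in J y z" using next_ex[OF J unb] by blast
  have "\<exists>e'. seq e' (k + 1 + 1) \<and> (\<forall>i x. entry e' i x \<longleftrightarrow>
      i < k + 1 + 1 \<and> (i < k + 1 \<and> entry e i x \<or> i = k + 1 \<and> x = z))"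
  proof (rule map_seq_exists)
    show "D (\<lambda>s. s 1 < k + 1 \<and> entry e (s 1) (s 0) \<or> s 1 = k + 1 \<and> s 0 = z)" by (intro D_intros)
    show "\<exists>x. i < k + 1 \<and> entry e i x \<or> i = k + 1 \<and> x = z" if "i < k + 1 + 1" for i
      using that entry_ex[OF e(1), of i] by (auto simp: less_add_one_iff[of i "k + 1"] order_le_less)
  qed (auto dest: entry_unique)
  then obtain e' where e': "seq e' (k + 1 + 1)" "\<And>i x. entry e' i x \<longleftrightarrow>
      i < k + 1 + 1 \<and> (i < k + 1 \<and> entry e i x \<or> i = k + 1 \<and> x = z)" by blast
  have "\<exists>y z. entry e' s y \<and> entry e' (s + 1) z \<and> next_in J y z" if "s < k + 1" for s
  proof (cases "s = k")
    case True
    then show ?thesis using y z by (intro exI[of _ y] exI[of _ z]) (auto simp: e' less_add_one_iff)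
  next
    case False
    then have "s < k" using that by (simp add: less_add_one_iff)
    then obtain y z where "entry e s y" "entry e (s + 1) z" "next_in J y z" using e(3) by blast
    moreover have "s < k + 1 + 1" "s + 1 < k + 1" "s + 1 < k + 1 + 1"
      using \<open>s < k\<close> less_iff_succ_less_eq[of s k] by (auto simp: less_add_one_iff intro: less_imp_le)
    ultimately show ?thesis using that by (intro exI[of _ y] exI[of _ z]) (auto simp: e')
  qed
  moreover have "entry e' 0 j" using e(2) by (auto simp: e' add_nonneg_pos less_add_one_iff)
  ultimately show "\<exists>e. seq e (k + 1 + 1) \<and> entry e 0 j \<and>
    (\<forall>s. s < k + 1 \<longrightarrow> (\<exists>y z. entry e s y \<and> entry e (s + 1) z \<and> next_in J y z))"
    using e'(1) by blast
qed

lemma config_ex: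
  assumes J: "D (\<lambda>s. s 0 \<in> J)" and unb: "\<And>x. \<exists>y. y \<in> J \<and> x < y" and a: "seq a (n :: 'a)"
  shows "\<exists>e b. seq e (k + 1) \<and> entry e 0 j \<and>
     (\<forall>s. s < k \<longrightarrow> (\<exists>y z. entry e s y \<and> entry e (s + 1) z \<and> next_in J y z)) \<and>
     seq b (n + k) \<and>
     (\<forall>s. s < n \<longrightarrow> (\<exists>y. entry a s y \<and> entry b s y)) \<and>
     (\<forall>s. s < k \<longrightarrow> (\<exists>y. entry e (s + 1) y \<and> entry b (n + s) y))"
proof -
  obtain e where e: "seq e (k + 1)" "entry e 0 j"
    "\<forall>s. s < k \<longrightarrow> (\<exists>y z. entry e s y \<and> entry e (s + 1) z \<and> next_in J y z)"
    using chain_ex[OF J unb] by blast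
  have "\<exists>b. seq b (n + k) \<and> (\<forall>i x. entry b i x \<longleftrightarrow>
      i < n + k \<and> (i < n \<and> entry a i x \<or> (\<exists>t. i = n + t \<and> entry e (t + 1) x)))"
  proof (rule map_seq_exists)
    show "D (\<lambda>s. s 1 < n \<and> entry a (s 1) (s 0) \<or> (\<exists>t. s 1 = n + t \<and> entry e (t + 1) (s 0)))"
      by (intro D_intros)
    show "\<exists>x. i < n \<and> entry a i x \<or> (\<exists>t. i = n + t \<and> entry e (t + 1) x)" if "i < n + k" for i
    proof (cases "i < n")
      case True
      then show ?thesis using entry_ex[OF a] by blast
    next
      case False
      then obtain t where t: "i = n + t" using le_iff_add[of n i] by auto
      then have "t < k" using that by simp
      then show ?thesis using e(3) t by blast
    qed
  qed (auto dest: entry_unique)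
  then obtain b where b: "seq b (n + k)" "\<And>i x. entry b i x \<longleftrightarrow>
      i < n + k \<and> (i < n \<and> entry a i x \<or> (\<exists>t. i = n + t \<and> entry e (t + 1) x))" by blast
  have "\<exists>y. entry a s y \<and> entry b s y" if "s < n" for s
  proof -
    have "s < n + k" using that by (meson add_increasing2 less_le_trans order_refl zero_le)
    then show ?thesis using entry_ex[OF a that] that by (auto simp: b)
  qed
  moreover have "\<exists>y. entry e (s + 1) y \<and> entry b (n + s) y" if "s < k" for s
    using e(3) that by (auto simp: b)
  ultimately show ?thesis using e b(1) by blast
qed

text \<open>Above an element of a final segment \<open>J\<close> of \<open>I\<close>, the successors in \<open>J\<close> and in \<open>I\<close> coincide.\<close>

lemma config_final_segment:
  assumes cf: "config J n a j k e b" and j: "j \<in> J" and sub: "J \<subseteq> I"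
    and up: "\<And>x y. x \<in> J \<Longrightarrow> y \<in> I \<Longrightarrow> x < y \<Longrightarrow> y \<in> J"
  shows "config I n a j k e (b :: 'a)"
proof -
  have "\<exists>y z. entry e s y \<and> entry e (s + 1) z \<and> next_in I y z" if s: "s < k" for s
  proof -
    obtain y z where yz: "entry e s y" "entry e (s + 1) z" "next_in J y z"
      using cf s unfolding config_def by blast
    have "y \<in> J"
    proof (cases rule: zero_or_succ[of s])
      case 1
      then show ?thesis using yz(1) cf j entry_unique unfolding config_def by metis
    next
      case (2 t)
      have "t < t + 1" by simp
      then have "t < k" using s 2 by (meson less_trans)
      then obtain y' z' where "entry e (t + 1) z'" "next_in J y' z'" using cf unfolding config_def by blast
      then show ?thesis using yz(1) entry_unique unfolding 2 next_in_def by blast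
    qed
    then have "next_in I y z" using yz(3) sub up unfolding next_in_def by blast
    then show ?thesis using yz by blast
  qed
  then show ?thesis using cf unfolding config_def by blast
qed

text \<open>From left to right, the value found by \<open>sig\<close> is compared with the
  represented one by uniqueness of \<open>eval\<close>. From right to left, a least \<open>j\<close>
  and a configuration above it have to exist, which rests on the unboundedness of
  \<open>J\<close>.\<close>

lemma sig_iff:
  assumes J: "D (\<lambda>s. s 0 \<in> J)" and unb: "\<And>x. \<exists>y. y \<in> J \<and> x < y"
    and sub: "J \<subseteq> I" and up: "\<And>x y. x \<in> J \<Longrightarrow> y \<in> I \<Longrightarrow> x < y \<Longrightarrow> y \<in> J"
    and rep: "represents I n S p" and p: "isF n p" and a: "seq a (n :: 'a)"
  shows "sig J (pr p a) \<longleftrightarrow> S (pr p a)"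
proof
  assume "sig J (pr p a)"
  then obtain n' psi k j e b where *: "seq a n'" "star n' p psi k" "j \<in> J" "exceed j p a"
    "seq e (k + 1)" "entry e 0 j"
    "\<forall>s. s < k \<longrightarrow> (\<exists>y z. entry e s y \<and> entry e (s + 1) z \<and> next_in J y z)"
    "seq b (n' + k)" "\<forall>s. s < n' \<longrightarrow> (\<exists>y. entry a s y \<and> entry b s y)"
    "\<forall>s. s < k \<longrightarrow> (\<exists>y. entry e (s + 1) y \<and> entry b (n' + s) y)" "eval psi b 1"
    unfolding sig_def pr_inj by blast
  have n': "n' = n" using a *(1) by (rule seq_length[symmetric])
  have cf: "config J n a j k e b" using * unfolding config_def n' by blast
  have "config I n a j k e b" by (rule config_final_segment[OF cf *(3) sub]) (fact up)
  then obtain v where v: "truth v (S (pr p a))" "eval psi b v"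
    using rep a * sub unfolding represents_def n' by blast
  have "v = 1" using eval_unique[OF v(2) *(11)] .
  then show "S (pr p a)" using truth_one[OF v(1)] by simp
next
  assume S: "S (pr p a)"
  note [D_intros] = D_app1[where R = "\<lambda>x. x \<in> J", OF J]
  obtain psi k where st: "star n p psi k" using star_ex[OF p] by blast
  obtain j1 where j1: "j1 \<in> J \<and> exceed j1 p a"
  proof -
    obtain j where j: "j \<in> J" "max p a < j" using unb by blast
    \<comment> \<open>Entries of a sequence are smaller than its code, so it suffices to exceed
      \<open>p\<close> and \<open>a\<close> themselves.\<close>
    then have "exceed j p a" using entry_less(2) by (auto simp: exceed_def intro: less_trans)
    then show ?thesis using j that by blast
  qed
  have "D (\<lambda>s. s 0 \<in> J \<and> exceed (s 0) p a)" unfolding exceed_def by (intro D_intros)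
  from least[where P = "\<lambda>j. j \<in> J \<and> exceed j p a", OF this j1]
  obtain j where "j \<in> J \<and> exceed j p a" "\<And>z. z < j \<Longrightarrow> \<not> (z \<in> J \<and> exceed z p a)" by blast
  then have j: "j \<in> J" "exceed j p a" "\<not> (\<exists>j'. j' \<in> J \<and> exceed j' p a \<and> j' < j)" by blast+
  obtain e b where eb: "seq e (k + 1)" "entry e 0 j"
     "\<forall>s. s < k \<longrightarrow> (\<exists>y z. entry e s y \<and> entry e (s + 1) z \<and> next_in J y z)"
     "seq b (n + k)" "\<forall>s. s < n \<longrightarrow> (\<exists>y. entry a s y \<and> entry b s y)"
     "\<forall>s. s < k \<longrightarrow> (\<exists>y. entry e (s + 1) y \<and> entry b (n + s) y)"
    using config_ex[OF J unb a] by blast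
  have cf: "config J n a j k e b" using eb unfolding config_def by blast
  have "config I n a j k e b" by (rule config_final_segment[OF cf j(1) sub]) (fact up)
  then obtain v where v: "truth v (S (pr p a))" "eval psi b v"
    using rep a j sub st unfolding represents_def by blast
  then have "eval psi b 1" using S truth_one[OF v(1)] by simp
  then show "sig J (pr p a)" unfolding sig_def using a p st j eb by blast
qed

lemma tarski_sig:
  assumes J: "D (\<lambda>s. s 0 \<in> J)" and unb: "\<And>x. \<exists>y. y \<in> J \<and> x < y"
    and sub: "J \<subseteq> I" and up: "\<And>x y. x \<in> J \<Longrightarrow> y \<in> I \<Longrightarrow> x < y \<Longrightarrow> y \<in> J"
    and rep: "\<And>n p. isF n p \<Longrightarrow> represents I n S p" and T: "tarski S"
  shows "tarski (sig (J :: 'a set))"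
proof -
  have sig: "sig J (pr p a) \<longleftrightarrow> S (pr p a)" if "isF n p" "seq a n" for n p a :: 'a
    by (rule sig_iff[OF J unb sub _ rep[OF that(1)] that]) (fact up)
  show ?thesis unfolding tarski_def
  proof (intro allI impI conjI; (elim conjE)?)
    fix n a i p :: 'a assume a: "seq a n" and i: "i < n" and p: "isF n p"
    have "(\<exists>y b. upd a i y b \<and> sig J (pr p b)) \<longleftrightarrow> (\<exists>y b. upd a i y b \<and> S (pr p b))"
      using sig[OF p] a upd_seq by blast
    then show "sig J (pr (kEx i p) a) \<longleftrightarrow> (\<exists>y b. upd a i y b \<and> sig J (pr p b))"
      using tarskiD(5)[OF T a i p] i p sig[of n "kEx i p" a] a by simp
  qed (use tarskiD[OF T] sig in simp_all)
qed

text \<open>Truth of the existential formula in \<open>sig I\<close> provides \<open>y\<close> below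
  \<open>i1\<close>, the successor of the least \<open>j0\<close>. The body is then evaluated from
  the start \<open>i1\<close>, which may differ from the least element exceeding \<open>p\<close>
  and \<open>a'\<close>; only the hypothesis on \<open>p\<close> for arbitrary starts turns this
  value into \<open>sig I (pr p a')\<close>.\<close>

lemma represents_sig:
  assumes I: "D (\<lambda>s. s 0 \<in> I)" and T: "tarski (sig I)" and p: "isF n (p :: 'a)"
  shows "represents I n (sig I) p"
proof (rule represents[OF I _ T p])
  note [D_intros] = D_app1[where R = "\<lambda>x. x \<in> I", OF I]
  show "D (\<lambda>s. sig I (s 0))"
    unfolding sig_def next_in_def exceed_def by (intro D_intros)
  fix i p a j j'
  assume p: "isF n p" and i: "i < n" and rep: "represents I n (sig I) p" and a: "seq a n" and j: "j \<in> I"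
    and ex: "exceed j (kEx i p) a" and nx: "next_in I j j'" and S: "sig I (pr (kEx i p) a)"
  from S obtain n' psi k j0 e b where *: "seq a n'" "star n' (kEx i p) psi k" "j0 \<in> I" "exceed j0 (kEx i p) a"
    "\<not> (\<exists>j'. j' \<in> I \<and> exceed j' (kEx i p) a \<and> j' < j0)"
    "seq e (k + 1)" "entry e 0 j0"
    "\<forall>s. s < k \<longrightarrow> (\<exists>y z. entry e s y \<and> entry e (s + 1) z \<and> next_in I y z)"
    "seq b (n' + k)" "\<forall>s. s < n' \<longrightarrow> (\<exists>y. entry a s y \<and> entry b s y)"
    "\<forall>s. s < k \<longrightarrow> (\<exists>y. entry e (s + 1) y \<and> entry b (n' + s) y)" "eval psi b 1"
    unfolding sig_def pr_inj by blast
  have n': "n' = n" using a *(1) by (rule seq_length[symmetric])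
  have cf: "config I n a j0 k e b" using * unfolding config_def n' by blast
  obtain p' k1 r where p': "star n p p' k1" "tilde n p' r"
    and psi: "psi = kEx i (kAnd (kLess (kVar i) (kVar n)) r)" and k: "k = k1 + 1"
    using *(2) unfolding n' by auto
  obtain q y b1 where q: "entry b n q" and y: "y < q" "upd b i y b1" "eval r b1 1"
    using *(12) unfolding psi eval_Ex by auto
  obtain a' where a': "upd a i y a'" using upd_ex[OF a i] by blast
  from config_step[OF cf[unfolded k] a a' i] obtain i1 e' b'
    where i1: "entry b n i1" "next_in I j0 i1" and cf': "config I n a' i1 k1 e' b'"
      and sh: "\<And>c. upd b i y c \<Longrightarrow> shifted n c b'" by blast
  have yi1: "y < i1" using y(1) entry_unique[OF q i1(1)] by simp
  have "p < kEx i p" by (simp add: less_pr)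
  have j0: "kEx i p < j0" "\<And>s x. entry a s x \<Longrightarrow> x < j0" "j0 < i1" "i1 \<in> I"
    using *(4) i1(2) unfolding exceed_def next_in_def by blast+
  have "p < i1" using \<open>p < kEx i p\<close> j0 by (meson less_trans)
  moreover have "x < i1" if "entry a' s x" for s x
    using that yi1 j0 unfolding upd_entry[OF a'] by (auto split: if_splits intro: less_trans)
  ultimately have "exceed i1 p a'" by (simp add: exceed_def)
  then obtain v where v: "truth v (sig I (pr p a'))" "eval p' b' v"
    using rep a upd_seq[OF a'] j0(4) p'(1) cf' unfolding represents_def by blast
  have "eval r b1 v" using tilde_eval[OF p'(2) sh[OF y(2)] v(2)] .
  then have "sig I (pr p a')" using eval_unique[OF y(3)] truth_one[OF v(1)] by simp
  \<comment> \<open>The minimality of \<open>j0\<close> in the definition of \<open>sig\<close>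
    enters here: from \<open>j0 \<le> j\<close> the successor of \<open>j0\<close> is at most the
    successor of \<open>j\<close>.\<close>
  moreover have "i1 \<le> j'"
  proof -
    have "j0 \<le> j" using *(5) j ex by (meson not_less)
    then have "j0 < j'" "j' \<in> I" using nx unfolding next_in_def by auto
    then show ?thesis using i1(2) unfolding next_in_def by (meson not_less)
  qed
  ultimately show "\<exists>y a'. y < j' \<and> upd a i y a' \<and> sig I (pr p a')"
    using yi1 a' by (meson less_le_trans)
qed

theorem tarski_sig_final_segment:
  assumes I: "D (\<lambda>s. s 0 \<in> I)" and T: "tarski (sig I)"
    and J: "D (\<lambda>s. s 0 \<in> J)" and unb: "\<And>x. \<exists>y. y \<in> J \<and> x < y"
    and sub: "J \<subseteq> I" and up: "\<And>x y. x \<in> J \<Longrightarrow> y \<in> I \<Longrightarrow> x < y \<Longrightarrow> y \<in> J"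
  shows "tarski (sig (J :: 'a set))"
  by (rule tarski_sig[OF J unb sub _ represents_sig[OF I T] T]) (fact up)

end

section \<open>The meaning of \<open>\<alpha>\<close>\<close>

definition mk :: "'a set \<Rightarrow> 'a::{discrete_linordered_semidom, canonically_ordered_monoid_add} struct" where
  "mk J = \<lparr>univ = UNIV, zer = 0, suc = (\<lambda>x. x + 1), add = (+), mul = (*), lt = (<), ind = J\<rparr>"

lemma mk_simps [simp]:
  "univ (mk J) = UNIV" "zer (mk J) = 0" "suc (mk J) x = x + 1" "add (mk J) = (+)"
  "mul (mk J) = (*)" "lt (mk J) = (<)" "ind (mk J) = J"
  by (simp_all add: mk_def)

text \<open>The side condition of the scheme notation: a quantifier built at index \<open>n\<close>
  binds the variable numbered \<open>n\<close>, so terms from outside may only contain smaller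
  ones.\<close>

definition fresh :: "nat \<Rightarrow> tm \<Rightarrow> bool" where
  "fresh n t \<longleftrightarrow> (\<forall>i\<in>fv_tm t. i < n)"

lemma fv_tm_num [simp]: "fv_tm (num k) = {}"
  by (induction k) auto

lemma fresh_simps [simp]:
  "fresh n (Var i) \<longleftrightarrow> i < n" "fresh n Zero" "fresh n (Succ t) \<longleftrightarrow> fresh n t"
  "fresh n (Plus t u) \<longleftrightarrow> fresh n t \<and> fresh n u" "fresh n (Times t u) \<longleftrightarrow> fresh n t \<and> fresh n u"
  "fresh n (num k)" "fresh n (pair t u) \<longleftrightarrow> fresh n t \<and> fresh n u"
  by (auto simp: fresh_def pair_def)

lemma fresh_Suc [simp]: "fresh n t \<Longrightarrow> fresh (Suc n) t"
  by (auto simp: fresh_def)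

lemma val_fresh [simp]: "fresh n t \<Longrightarrow> val M (s(n := a)) t = val M s t"
  by (rule val_cong) (auto simp: fresh_def)

lemma val_num [simp]: "val (mk J) s (num k) = of_nat k"
  by (induction k) (simp_all add: add.commute)

lemma val_pair [simp]: "val (mk J) s (pair t u) = pr (val (mk J) s t) (val (mk J) s u)"
  by (simp add: pair_def pr_def)

lemmas code_defs = triple_def cVar_def cZero_def cSucc_def cPlus_def cTimes_def cEq_def cLess_def
  cNeg_def cOr_def cEx_def cAnd_def

lemma sat_scheme [simp]:
  "sat M s ((t \<doteq> u) n) \<longleftrightarrow> val M s t = val M s u"
  "sat M s ((t \<prec> u) n) \<longleftrightarrow> lt M (val M s t) (val M s u)"
  "sat M s (inI t n) \<longleftrightarrow> val M s t \<in> ind M"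
  "sat M s ((\<^bold>\<not> P) n) \<longleftrightarrow> \<not> sat M s (P n)"
  "sat M s ((P \<^bold>\<or> Q) n) \<longleftrightarrow> sat M s (P n) \<or> sat M s (Q n)"
  "sat M s ((P \<^bold>\<and> Q) n) \<longleftrightarrow> sat M s (P n) \<and> sat M s (Q n)"
  "sat M s ((P \<^bold>\<longrightarrow> Q) n) \<longleftrightarrow> (sat M s (P n) \<longrightarrow> sat M s (Q n))"
  "sat M s ((P \<^bold>\<longleftrightarrow> Q) n) \<longleftrightarrow> (sat M s (P n) \<longleftrightarrow> sat M s (Q n))"
  by (simp_all add: eqS_def ltS_def inI_def notS_def orS_def andS_def impS_def iffS_def)

lemma sat_exS [simp]: "sat (mk J) s (exS B n) \<longleftrightarrow> (\<exists>a. sat (mk J) (s(n := a)) (B (Var n) (Suc n)))"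
  by (simp add: exS_def)

lemma sat_allS [simp]: "sat (mk J) s (allS B n) \<longleftrightarrow> (\<forall>a. sat (mk J) (s(n := a)) (B (Var n) (Suc n)))"
  by (simp add: allS_def)

lemma sat_exlt [simp]: "fresh n t \<Longrightarrow>
  sat (mk J) s (exlt t B n) \<longleftrightarrow> (\<exists>a. a < val (mk J) s t \<and> sat (mk J) (s(n := a)) (B (Var n) (Suc n)))"
  by (simp add: exlt_def)

lemma sat_alllt [simp]: "fresh n t \<Longrightarrow>
  sat (mk J) s (alllt t B n) \<longleftrightarrow> (\<forall>a. a < val (mk J) s t \<longrightarrow> sat (mk J) (s(n := a)) (B (Var n) (Suc n)))"
  by (simp add: alllt_def)

lemma sat_seqS [simp]: "fresh n x \<Longrightarrow> fresh n l \<Longrightarrow>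
  sat (mk J) s (seqS x l n) \<longleftrightarrow> seq (val (mk J) s x) (val (mk J) s l)"
  by (auto simp: seqS_def seq_def less_pr)

lemma sat_nthS [simp]: "fresh n x \<Longrightarrow> fresh n i \<Longrightarrow> fresh n y \<Longrightarrow>
  sat (mk J) s (nthS x i y n) \<longleftrightarrow> entry (val (mk J) s x) (val (mk J) s i) (val (mk J) s y)"
proof -
  assume fr: "fresh n x" "fresh n i" "fresh n y"
  let ?x = "val (mk J) s x" and ?i = "val (mk J) s i" and ?y = "val (mk J) s y"
  \<comment> \<open>The quotient, too, is smaller than the code, the modulus being at least
    1.\<close>
  have "q < ?x" if "?x = pr l (pr c d)" "c = q * ((?i + 1) * d + 1) + ?y" for l c d q
  proof -
    have "q \<le> q * ((?i + 1) * d + 1)" by (simp add: distrib_left)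
    also have "\<dots> \<le> c" using that(2) by simp
    finally show ?thesis using that(1) by (auto intro: less_pr)
  qed
  then have bound: "l < ?x \<and> c < ?x \<and> d < ?x \<and> q < ?x"
    if "?x = pr l (pr c d)" "c = q * ((?i + 1) * d + 1) + ?y" for l c d q
    using that by (simp add: less_pr)
  show ?thesis
  proof
    assume "sat (mk J) s (nthS x i y n)"
    then show "entry ?x ?i ?y" using fr by (simp add: nthS_def entry_def) blast
  next
    assume "entry ?x ?i ?y"
    then obtain l c d q where "?x = pr l (pr c d)" "?i < l" "c = q * ((?i + 1) * d + 1) + ?y" "?y < (?i + 1) * d + 1"
      unfolding entry_def by blast
    moreover from this(1,3) have "l < ?x" "c < ?x" "d < ?x" "q < ?x" using bound by blast+
    ultimately have "\<exists>l<?x. \<exists>c<?x. \<exists>d<?x. \<exists>q<?x. ?x = pr l (pr c d) \<and> ?i < l \<and>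
        c = q * ((?i + 1) * d + 1) + ?y \<and> ?y < (?i + 1) * d + 1" by blast
    then show "sat (mk J) s (nthS x i y n)" using fr by (simp add: nthS_def)
  qed
qed

lemma sat_mem [simp]: "fresh n x \<Longrightarrow> fresh n C \<Longrightarrow>
  sat (mk J) s (mem x C n) \<longleftrightarrow> inseq (val (mk J) s x) (val (mk J) s C)"
  by (simp add: mem_def inseq_def) (use entry_less(1) in blast)

lemma inseq_less: "inseq x C \<Longrightarrow> x < C"
  by (auto simp: inseq_def entry_less)

lemma sat_exin [simp]: "fresh n C \<Longrightarrow>
  sat (mk J) s (exin C B n) \<longleftrightarrow> (\<exists>a. inseq a (val (mk J) s C) \<and> sat (mk J) (s(n := a)) (B (Var n) (Suc n)))"
  by (simp add: exin_def) (use inseq_less in blast)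

lemma sat_allin [simp]: "fresh n C \<Longrightarrow>
  sat (mk J) s (allin C B n) \<longleftrightarrow> (\<forall>a. inseq a (val (mk J) s C) \<longrightarrow> sat (mk J) (s(n := a)) (B (Var n) (Suc n)))"
  by (simp add: allin_def) (use inseq_less in blast)

lemma sat_updS [simp]: "fresh n a \<Longrightarrow> fresh n i \<Longrightarrow> fresh n y \<Longrightarrow> fresh n b \<Longrightarrow>
  sat (mk J) s (updS a i y b n) \<longleftrightarrow>
    upd (val (mk J) s a) (val (mk J) s i) (val (mk J) s y) (val (mk J) s b)"
  by (auto simp: updS_def upd_def entry_less) (metis seq_def less_pr1 order_refl entry_less(2))+

lemma sat_tmS [simp]: "fresh m n \<Longrightarrow> fresh m x \<Longrightarrow>
  sat (mk J) s (tmS n x m) \<longleftrightarrow> isT (val (mk J) s n) (val (mk J) s x)"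
  by (simp add: tmS_def isT_def certified_def cert_def tm_clause_def code_defs)

lemma sat_fmS [simp]: "fresh m n \<Longrightarrow> fresh m x \<Longrightarrow>
  sat (mk J) s (fmS n x m) \<longleftrightarrow> isF (val (mk J) s n) (val (mk J) s x)"
  by (simp add: fmS_def isF_def certified_def cert_def fm_clause_def code_defs)

lemma sat_tildeS [simp]: "fresh m n \<Longrightarrow> fresh m x \<Longrightarrow> fresh m y \<Longrightarrow>
  sat (mk J) s (tildeS n x y m) \<longleftrightarrow> tilde (val (mk J) s n) (val (mk J) s x) (val (mk J) s y)"
  by (simp add: tildeS_def tilde_def certified_def cert_def tilde_clause_def code_defs)

lemma sat_starS [simp]: "fresh m n \<Longrightarrow> fresh m x \<Longrightarrow> fresh m y \<Longrightarrow> fresh m k \<Longrightarrow>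
  sat (mk J) s (starS n x y k m) \<longleftrightarrow>
    star (val (mk J) s n) (val (mk J) s x) (val (mk J) s y) (val (mk J) s k)"
  by (simp add: starS_def star_def certified_def cert_def star_clause_def code_defs)

lemma sat_truthS [simp]: "sat (mk J) s (truthS v P n) \<longleftrightarrow> truth (val (mk J) s v) (sat (mk J) s (P n))"
  by (simp add: truthS_def truth_def)

text \<open>Components of a triple in \<open>C\<close> are below \<open>C\<close>, hence so are the
  parts of the code \<open>x\<close> and the entries of the assignment \<open>b\<close>. This
  justifies every bound written in \<open>evalS\<close>.\<close>

lemma eval_clause_bounded:
  assumes w: "inseq w C"
  shows "eval_clause (\<lambda>u. inseq u C) w \<longleftrightarrow> (\<exists>x. x < C \<and> (\<exists>b. b < C \<and> (\<exists>v. v < C \<and> w = tr x b v \<and>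
     ((\<exists>i. i < C \<and> x = kVar i \<and> entry b i v) \<or>
      x = kZero \<and> v = 0 \<or>
      (\<exists>y. y < C \<and> (\<exists>p. p < C \<and> inseq (tr y b p) C \<and>
         (x = kSucc y \<and> v = p + 1 \<or> x = kNeg y \<and> truth v (p \<noteq> 1)))) \<or>
      (\<exists>y. y < C \<and> (\<exists>p. p < C \<and> (\<exists>z. z < C \<and> (\<exists>q. q < C \<and> inseq (tr y b p) C \<and> inseq (tr z b q) C \<and>
         (x = kPlus y z \<and> v = p + q \<or> x = kTimes y z \<and> v = p * q \<or>
          x = kEq y z \<and> truth v (p = q) \<or> x = kLess y z \<and> truth v (p < q) \<or>
          x = kOr y z \<and> truth v (p = 1 \<or> q = 1)))))) \<or>
      (\<exists>i. i < C \<and> (\<exists>j. j < C \<and> (\<exists>y. y < C \<and> (\<exists>p. p < C \<and>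
         x = kEx i (kAnd (kLess (kVar i) (kVar j)) y) \<and> i \<noteq> j \<and> entry b j p \<and>
         (v = 1 \<and> (\<exists>a. a < p \<and> (\<exists>b'. b' < C \<and> upd b i a b' \<and> inseq (tr y b' 1) C)) \<or>
          v = 0 \<and> (\<forall>a. a < p \<longrightarrow> (\<exists>b'. b' < C \<and> upd b i a b' \<and> inseq (tr y b' 0) C)))))))))))"
    (is "_ \<longleftrightarrow> ?R")
proof
  have tr: "x < C" "b < C" "v < C" if "inseq (tr x b v) C" for x b v
    using inseq_less[OF that] by (meson less_pr1 less_pr2 less_trans order_refl)+
  show "eval_clause (\<lambda>u. inseq u C) w" if ?R
    using that unfolding eval_clause_def
    by (elim exE conjE) (intro exI conjI, assumption, elim disj_forward; blast)
  assume "eval_clause (\<lambda>u. inseq u C) w"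
  then obtain x b v where xbv: "w = tr x b v" and cases: "
     (\<exists>i. x = kVar i \<and> entry b i v) \<or>
      x = kZero \<and> v = 0 \<or>
      (\<exists>y p. inseq (tr y b p) C \<and> (x = kSucc y \<and> v = p + 1 \<or> x = kNeg y \<and> truth v (p \<noteq> 1))) \<or>
      (\<exists>y p z q. inseq (tr y b p) C \<and> inseq (tr z b q) C \<and>
         (x = kPlus y z \<and> v = p + q \<or> x = kTimes y z \<and> v = p * q \<or>
          x = kEq y z \<and> truth v (p = q) \<or> x = kLess y z \<and> truth v (p < q) \<or>
          x = kOr y z \<and> truth v (p = 1 \<or> q = 1))) \<or>
      (\<exists>i j y p. x = kEx i (kAnd (kLess (kVar i) (kVar j)) y) \<and> i \<noteq> j \<and> entry b j p \<and>
         (v = 1 \<and> (\<exists>a. a < p \<and> (\<exists>b'. upd b i a b' \<and> inseq (tr y b' 1) C)) \<or>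
          v = 0 \<and> (\<forall>a. a < p \<longrightarrow> (\<exists>b'. upd b i a b' \<and> inseq (tr y b' 0) C))))"
    unfolding eval_clause_def by blast
  have C: "x < C" "b < C" "v < C" using tr w unfolding xbv by blast+
  have xC: "z < x \<Longrightarrow> z < C" for z using C(1) by (rule less_trans[rotated])
  have 1: "\<exists>i. i < C \<and> x = kVar i \<and> entry b i v" if "\<exists>i. x = kVar i \<and> entry b i v"
    using that xC less_pr2 by blast
  have 3: "\<exists>y. y < C \<and> (\<exists>p. p < C \<and> inseq (tr y b p) C \<and> Q y p)" if "\<exists>y p. inseq (tr y b p) C \<and> Q y p" for Q
    using that tr by blast
  have 4: "\<exists>y. y < C \<and> (\<exists>p. p < C \<and> (\<exists>z. z < C \<and> (\<exists>q. q < C \<and> inseq (tr y b p) C \<and> inseq (tr z b q) C \<and> Q y p z q)))"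
    if ex: "\<exists>y p z q. inseq (tr y b p) C \<and> inseq (tr z b q) C \<and> Q y p z q" for Q
  proof -
    from ex obtain y p z q where "inseq (tr y b p) C" "inseq (tr z b q) C" "Q y p z q" by (elim exE conjE)
    moreover from this(1,2) have "y < C" "p < C" "z < C" "q < C" using tr by blast+
    ultimately show ?thesis by (intro exI conjI)
  qed
  have 5: "\<exists>i. i < C \<and> (\<exists>j. j < C \<and> (\<exists>y. y < C \<and> (\<exists>p. p < C \<and>
         x = kEx i (kAnd (kLess (kVar i) (kVar j)) y) \<and> i \<noteq> j \<and> entry b j p \<and>
         (v = 1 \<and> (\<exists>a. a < p \<and> (\<exists>b'. b' < C \<and> upd b i a b' \<and> inseq (tr y b' 1) C)) \<or>
          v = 0 \<and> (\<forall>a. a < p \<longrightarrow> (\<exists>b'. b' < C \<and> upd b i a b' \<and> inseq (tr y b' 0) C))))))"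
    if ex: "x = kEx i (kAnd (kLess (kVar i) (kVar j)) y)" "i \<noteq> j" "entry b j p"
      "v = 1 \<and> (\<exists>a. a < p \<and> (\<exists>b'. upd b i a b' \<and> inseq (tr y b' 1) C)) \<or>
          v = 0 \<and> (\<forall>a. a < p \<longrightarrow> (\<exists>b'. upd b i a b' \<and> inseq (tr y b' 0) C))" for i j y p
  proof -
    have "i < C" "j < C" "y < C"
      by (rule xC, simp add: ex(1) less_pr)+
    moreover have "p < C" using entry_less(2)[OF ex(3)] C(2) by (rule less_trans)
    moreover have "v = 1 \<and> (\<exists>a. a < p \<and> (\<exists>b'. b' < C \<and> upd b i a b' \<and> inseq (tr y b' 1) C)) \<or>
          v = 0 \<and> (\<forall>a. a < p \<longrightarrow> (\<exists>b'. b' < C \<and> upd b i a b' \<and> inseq (tr y b' 0) C))"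
      using ex(4) tr by blast
    ultimately show ?thesis using ex(1-3) by blast
  qed
  show ?R
    by (rule exI[of _ x], rule conjI, rule C, rule exI[of _ b], rule conjI, rule C,
        rule exI[of _ v], rule conjI, rule C, rule conjI, rule xbv)
      (rule disj_forward[OF cases], erule 1, erule disj_forward, assumption, erule disj_forward, erule 3,
        erule disj_forward, erule 4, elim exE conjE, rule 5, assumption+)
qed

lemma sat_evalS [simp]: "fresh n x \<Longrightarrow> fresh n b \<Longrightarrow> fresh n v \<Longrightarrow>
  sat (mk J) s (evalS x b v n) \<longleftrightarrow> eval (val (mk J) s x) (val (mk J) s b) (val (mk J) s v)"
  by (simp add: evalS_def eval_def certified_def cert_def eval_clause_bounded code_defs)

lemma sat_exceeds [simp]: "fresh n j \<Longrightarrow> fresh n p \<Longrightarrow> fresh n a \<Longrightarrow>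
  sat (mk J) s (exceeds j p a n) \<longleftrightarrow> exceed (val (mk J) s j) (val (mk J) s p) (val (mk J) s a)"
  by (simp add: exceeds_def exceed_def)

lemma sat_nextI [simp]: "fresh n x \<Longrightarrow> fresh n y \<Longrightarrow>
  sat (mk J) s (nextI x y n) \<longleftrightarrow> next_in J (val (mk J) s x) (val (mk J) s y)"
  by (simp add: nextI_def next_in_def)

lemma sat_sigma [simp]: "fresh n x \<Longrightarrow> sat (mk J) s (sigma x n) \<longleftrightarrow> sig J (val (mk J) s x)"
  by (simp add: sigma_def sig_def satD0_def)

theorem sat_alpha: "sat (mk J) s alpha \<longleftrightarrow> tarski (sig J)"
  by (simp add: alpha_def tarskiS_def tarski_def code_defs)

section \<open>Models of Peano arithmetic as a type\<close>

definition PA_ind :: "fm set" where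
  "PA_ind = PA_basic \<union> {Induct x p | x p. True}"

lemma models_Un: "models M (A \<union> B) \<longleftrightarrow> models M A \<and> models M B"
  by (auto simp: models_def)

text \<open>It carries structures from \<open>'a\<close> and from \<open>nat\<close> into
  \<open>'a + nat\<close>, and from there to the type \<open>'a pam\<close>.\<close>

definition transport :: "('a \<Rightarrow> 'b) \<Rightarrow> 'a struct \<Rightarrow> 'b struct" where
  "transport h M = (let g = inv_into (univ M) h in
     \<lparr>univ = h ` univ M, zer = h (zer M), suc = (\<lambda>x. h (suc M (g x))),
      add = (\<lambda>x y. h (add M (g x) (g y))), mul = (\<lambda>x y. h (mul M (g x) (g y))),
      lt = (\<lambda>x y. lt M (g x) (g y)), ind = h ` ind M\<rparr>)"

lemma sat_transport:
  assumes M: "is_struct M" and h: "inj_on h (univ M)" and s: "range s \<subseteq> univ M"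
  shows "sat (transport h M) (h \<circ> s) p \<longleftrightarrow> sat M s p"
proof (rule sat_iso[OF M _ _ _ _ _ _ _ s])
  show "bij_betw h (univ M) (univ (transport h M))"
    using h by (simp add: bij_betw_def transport_def Let_def)
  show "x \<in> ind M \<longleftrightarrow> h x \<in> ind (transport h M)" if "x \<in> univ M" for x
    using M inj_on_image_mem_iff[OF h that, of "ind M"] by (simp add: transport_def Let_def is_struct_def)
qed (use h in \<open>simp_all add: transport_def Let_def\<close>)

lemma is_struct_transport:
  assumes M: "is_struct M" and h: "inj_on h (univ M)"
  shows "is_struct (transport h M)"
  using M h by (auto simp: is_struct_def transport_def Let_def)

lemma models_transport:
  fixes M :: "'a struct" and h :: "'a \<Rightarrow> 'b"
  assumes M: "is_struct M" and h: "inj_on h (univ M)"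
  shows "models (transport h M) U \<longleftrightarrow> models M U"
proof -
  have uM: "univ (transport h M) = h ` univ M" by (simp add: transport_def Let_def)
  have "(\<forall>s. range s \<subseteq> univ (transport h M) \<longrightarrow> sat (transport h M) s p) \<longleftrightarrow>
      (\<forall>s. range s \<subseteq> univ M \<longrightarrow> sat M s p)" for p
  proof
    assume *: "\<forall>s. range s \<subseteq> univ (transport h M) \<longrightarrow> sat (transport h M) s p"
    show "\<forall>s. range s \<subseteq> univ M \<longrightarrow> sat M s p"
    proof (intro allI impI)
      fix s :: "nat \<Rightarrow> 'a" assume s: "range s \<subseteq> univ M"
      then have "range (h \<circ> s) \<subseteq> univ (transport h M)" unfolding uM by auto
      then show "sat M s p" using * sat_transport[OF M h s] by blast
    qed
  next
    assume *: "\<forall>s. range s \<subseteq> univ M \<longrightarrow> sat M s p"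
    show "\<forall>s. range s \<subseteq> univ (transport h M) \<longrightarrow> sat (transport h M) s p"
    proof (intro allI impI)
      fix s :: "nat \<Rightarrow> 'b" assume s: "range s \<subseteq> univ (transport h M)"
      define s' where "s' i = inv_into (univ M) h (s i)" for i
      have si: "s i \<in> h ` univ M" for i using s unfolding uM by auto
      have "range s' \<subseteq> univ M" using si unfolding s'_def by (auto intro: inv_into_into)
      moreover have "s = h \<circ> s'" using si by (auto simp: s'_def f_inv_into_f fun_eq_iff)
      ultimately show "sat (transport h M) s p" using * sat_transport[OF M h] by metis
    qed
  qed
  then show ?thesis
    using M is_struct_transport[OF M h] by (simp add: models_def)
qed

lemma is_struct_mk: "is_struct (mk J)"
  by (simp add: is_struct_def)

lemma models_mk_nat: "models (mk J :: nat struct) PA_ind"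
proof -
  have "sat (mk J :: nat struct) s (Induct x p)" for s x p
    unfolding sat_Induct
  proof (intro impI ballI, elim conjE)
    fix a assume "sat (mk J) (s(x := zer (mk J))) p"
      "\<forall>a\<in>univ (mk J). sat (mk J) (s(x := a)) p \<longrightarrow> sat (mk J) (s(x := suc (mk J) a)) p"
    then show "sat (mk J) (s(x := a)) p"
      by (induction a) (simp_all del: fun_upd_apply)
  qed
  then show ?thesis
    by (auto simp: models_def PA_ind_def PA_basic_def Let_def is_struct_mk)
qed

definition "final_segment M d = M\<lparr>ind := {x \<in> ind M. \<not> lt M x d}\<rparr>"

text \<open>The failure of \<open>models_final_segment_alpha\<close> at one structure, phrased as a
  property that can be transported and used to select a model.\<close>

definition counterexample :: "'a struct \<Rightarrow> bool" where
  "counterexample M \<longleftrightarrow> models M (PA_ind \<union> {Unbounded, alpha}) \<and>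
     (\<exists>d\<in>univ M. \<not> models (final_segment M d) {alpha})"

text \<open>A type carries a single instance of a type class.  To reason about an arbitrary model over \<open>'a\<close>
  by means of the ordered semiring classes, let the type be one particular model, which is a
  counterexample to the claim if there is one; the summand \<open>nat\<close> provides a model in any case.\<close>

definition chosen_model :: "('a + nat) struct" where
  "chosen_model = (SOME M. models M PA_ind \<and> ((\<exists>M' :: ('a + nat) struct. counterexample M') \<longrightarrow> counterexample M))"

lemma chosen_model:
  "models (chosen_model :: ('a + nat) struct) PA_ind"
  "counterexample (M :: ('a + nat) struct) \<Longrightarrow> counterexample (chosen_model :: ('a + nat) struct)"
proof -
  have "\<exists>M :: ('a + nat) struct. models M PA_ind \<and>
      ((\<exists>M' :: ('a + nat) struct. counterexample M') \<longrightarrow> counterexample M)"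
  proof (cases "\<exists>M' :: ('a + nat) struct. counterexample M'")
    case True
    then show ?thesis unfolding counterexample_def models_Un by blast
  next
    case False
    have "models (transport Inr (mk {}) :: ('a + nat) struct) PA_ind"
      using models_mk_nat by (simp add: models_transport is_struct_mk)
    then show ?thesis using False by blast
  qed
  from someI_ex[OF this]
  show "models (chosen_model :: ('a + nat) struct) PA_ind"
    "counterexample M \<Longrightarrow> counterexample (chosen_model :: ('a + nat) struct)"
    unfolding chosen_model_def by blast+
qed

typedef 'a pam = "univ (chosen_model :: ('a + nat) struct)"
  using chosen_model(1) unfolding models_def is_struct_def by blast

definition pam_struct :: "'a pam struct" where
  "pam_struct = transport Abs_pam chosen_model"

lemma inj_on_Abs_pam: "inj_on Abs_pam (univ chosen_model)"
  by (simp add: inj_on_def Abs_pam_inject)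

lemma models_pam_struct: "models (pam_struct :: 'a pam struct) U \<longleftrightarrow> models (chosen_model :: ('a + nat) struct) U"
  unfolding pam_struct_def using chosen_model(1) inj_on_Abs_pam
  by (intro models_transport) (auto simp: models_def)

lemma univ_pam_struct [simp]: "univ pam_struct = UNIV"
proof -
  have "x \<in> Abs_pam ` univ chosen_model" for x
    by (cases x) auto
  then show ?thesis by (auto simp: pam_struct_def transport_def Let_def)
qed

lemma models_pam_struct_PA_ind: "models pam_struct PA_ind"
  using models_pam_struct chosen_model(1) by blast

lemma is_struct_pam_struct: "is_struct pam_struct"
  using models_pam_struct_PA_ind unfolding models_def by blast

lemma sat_pam_struct: "p \<in> PA_ind \<Longrightarrow> sat pam_struct s p"
  using models_pam_struct_PA_ind unfolding models_def univ_pam_struct by blast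

instantiation pam :: (type) "{zero, one, plus, times, minus, ord}"
begin

definition zero_pam :: "'a pam" where "0 = zer pam_struct"
definition one_pam :: "'a pam" where "1 = suc pam_struct 0"
definition plus_pam :: "'a pam \<Rightarrow> 'a pam \<Rightarrow> 'a pam" where "plus = add pam_struct"
definition times_pam :: "'a pam \<Rightarrow> 'a pam \<Rightarrow> 'a pam" where "times = mul pam_struct"
definition less_pam :: "'a pam \<Rightarrow> 'a pam \<Rightarrow> bool" where "less = lt pam_struct"
definition less_eq_pam :: "'a pam \<Rightarrow> 'a pam \<Rightarrow> bool" where "x \<le> y \<longleftrightarrow> x < y \<or> x = (y :: 'a pam)"
text \<open>Truncated subtraction, as the semiring class demands: the value is 0 where no difference
  exists.\<close>

definition minus_pam :: "'a pam \<Rightarrow> 'a pam \<Rightarrow> 'a pam" where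
  "x - y = (if y \<le> x then SOME z. x = y + z else (0 :: 'a pam))"

instance ..

end

section \<open>Ordered semiring laws derived from the Peano axioms\<close>

interpretation PS: dstruct UNIV "Df pam_struct" pam_struct
  using dstruct_Df_self[OF is_struct_pam_struct] by simp

abbreviation S :: "'a pam \<Rightarrow> 'a pam" where "S \<equiv> suc pam_struct"

lemma pam_axioms:
  fixes x y :: "'a pam"
  shows "S x \<noteq> 0" "S x = S y \<longleftrightarrow> x = y" "x + 0 = x" "x + S y = S (x + y)"
    "x * 0 = 0" "x * S y = x * y + x" "\<not> x < 0" "x < S y \<longleftrightarrow> x < y \<or> x = y"
  using sat_pam_struct[of "Neg (Eq (Succ (Var 0)) Zero)" "\<lambda>_. x"]
    sat_pam_struct[of "Imp (Eq (Succ (Var 0)) (Succ (Var 1))) (Eq (Var 0) (Var 1))" "\<lambda>i. if i = 0 then x else y"]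
    sat_pam_struct[of "Eq (Plus (Var 0) Zero) (Var 0)" "\<lambda>_. x"]
    sat_pam_struct[of "Eq (Plus (Var 0) (Succ (Var 1))) (Succ (Plus (Var 0) (Var 1)))" "\<lambda>i. if i = 0 then x else y"]
    sat_pam_struct[of "Eq (Times (Var 0) Zero) Zero" "\<lambda>_. x"]
    sat_pam_struct[of "Eq (Times (Var 0) (Succ (Var 1))) (Plus (Times (Var 0) (Var 1)) (Var 0))" "\<lambda>i. if i = 0 then x else y"]
    sat_pam_struct[of "Neg (Less (Var 0) Zero)" "\<lambda>_. x"]
    sat_pam_struct[of "Iff (Less (Var 0) (Succ (Var 1))) (Or (Less (Var 0) (Var 1)) (Eq (Var 0) (Var 1)))" "\<lambda>i. if i = 0 then x else y"]
  by (auto simp: PA_ind_def PA_basic_def Let_def zero_pam_def plus_pam_def times_pam_def less_pam_def)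

lemma pam_induct:
  assumes "Df pam_struct (\<lambda>s. P (s 0))" "P 0" "\<And>x. P x \<Longrightarrow> P (S x)" shows "P (x :: 'a pam)"
proof (rule Df_induct[OF is_struct_pam_struct _ assms(1)])
  show "sat pam_struct s (Induct x p)" for s :: "nat \<Rightarrow> 'a pam" and x p
    by (rule sat_pam_struct) (auto simp: PA_ind_def)
qed (use assms in \<open>simp_all add: zero_pam_def\<close>)

lemmas pam_D = PS.D_eq PS.D_Not PS.D_and PS.D_or PS.D_imp PS.D_iff
  PS.D_bex[simplified] PS.D_ball[simplified] PS.D_app2[OF PS.D_lt, folded less_pam_def]
  PS.Fn_app1[OF PS.Fn_suc] PS.Fn_app2[OF PS.Fn_add, folded plus_pam_def] PS.Fn_app2[OF PS.Fn_mul, folded times_pam_def]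
  PS.Fn_var PS.Fn_const[OF UNIV_I]

lemma pam_add_0: "0 + x = (x :: 'a pam)"
  by (rule pam_induct[where P = "\<lambda>x. 0 + x = x"]) (intro pam_D | simp add: pam_axioms)+

lemma pam_add_S: "S x + y = S (x + y :: 'a pam)"
  by (rule pam_induct[where P = "\<lambda>y. S x + y = S (x + y)"]) (intro pam_D | simp add: pam_axioms)+

lemma pam_add_commute: "x + y = y + (x :: 'a pam)"
  by (rule pam_induct[where P = "\<lambda>y. x + y = y + x"])
    (intro pam_D | simp add: pam_axioms pam_add_0 pam_add_S)+

lemma pam_add_assoc: "x + y + z = x + (y + z :: 'a pam)"
  by (rule pam_induct[where P = "\<lambda>z. x + y + z = x + (y + z)"]) (intro pam_D | simp add: pam_axioms)+

lemma pam_mult_0: "0 * x = (0 :: 'a pam)"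
  by (rule pam_induct[where P = "\<lambda>x. 0 * x = 0"]) (intro pam_D | simp add: pam_axioms)+

lemma pam_mult_S: "S x * y = x * y + (y :: 'a pam)"
proof (rule pam_induct[where P = "\<lambda>y. S x * y = x * y + y"])
  fix y assume IH: "S x * y = x * y + y"
  have "S x * S y = S (x * y + y + x)" by (simp add: pam_axioms IH)
  also have "x * y + y + x = x * y + x + y" by (metis pam_add_assoc pam_add_commute)
  finally show "S x * S y = x * S y + S y" by (simp add: pam_axioms)
qed (intro pam_D | simp add: pam_axioms)+

lemma pam_mult_commute: "x * y = y * (x :: 'a pam)"
  by (rule pam_induct[where P = "\<lambda>y. x * y = y * x"])
    (intro pam_D | simp add: pam_axioms pam_mult_0 pam_mult_S)+

lemma pam_distrib: "x * (y + z) = x * y + x * (z :: 'a pam)"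
  by (rule pam_induct[where P = "\<lambda>z. x * (y + z) = x * y + x * z"])
    (intro pam_D | simp add: pam_axioms pam_add_assoc)+

lemma pam_mult_assoc: "x * y * z = x * (y * z :: 'a pam)"
  by (rule pam_induct[where P = "\<lambda>z. x * y * z = x * (y * z)"])
    (intro pam_D | simp add: pam_axioms pam_distrib)+

lemma pam_add_cancel: "x + z = y + z \<longleftrightarrow> x = (y :: 'a pam)"
  by (rule pam_induct[where P = "\<lambda>z. x + z = y + z \<longleftrightarrow> x = y"]) (intro pam_D | simp add: pam_axioms)+

lemma pam_cases: "x = 0 \<or> (\<exists>y. x = S (y :: 'a pam))"
  by (rule pam_induct[where P = "\<lambda>x. x = 0 \<or> (\<exists>y. x = S y)"]) (intro pam_D | blast)+

lemma pam_S_eq: "S x = x + (1 :: 'a pam)"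
  by (simp add: one_pam_def pam_axioms)

text \<open>The axioms determine \<open><\<close> only by recursion on the right argument.
  Identifying it with the order defined by addition makes the order laws consequences of those of
  addition.\<close>

lemma pam_less_iff: "x < y \<longleftrightarrow> (\<exists>z. y = x + S (z :: 'a pam))"
proof (rule pam_induct[where P = "\<lambda>y. x < y \<longleftrightarrow> (\<exists>z. y = x + S z)"])
  show "Df pam_struct (\<lambda>s. x < s 0 \<longleftrightarrow> (\<exists>z. s 0 = x + S z))" by (intro pam_D)
  show "x < 0 \<longleftrightarrow> (\<exists>z. 0 = x + S z)" by (metis pam_axioms(1,4,7))
  fix y assume IH: "x < y \<longleftrightarrow> (\<exists>z. y = x + S z)"
  have "(\<exists>z. S y = x + S z) \<longleftrightarrow> (\<exists>z. y = x + z)" by (simp add: pam_axioms)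
  also have "\<dots> \<longleftrightarrow> x < y \<or> x = y" unfolding IH using pam_cases by (metis pam_axioms(3))
  finally show "x < S y \<longleftrightarrow> (\<exists>z. S y = x + S z)" by (simp add: pam_axioms)
qed

lemma pam_le_iff: "x \<le> y \<longleftrightarrow> (\<exists>z. y = x + (z :: 'a pam))"
  unfolding less_eq_pam_def pam_less_iff using pam_cases by (metis pam_axioms(3))

lemma pam_add_eq_0: "x + y = 0 \<Longrightarrow> x = (0 :: 'a pam)"
  using pam_cases[of y] by (auto simp: pam_axioms)

lemma pam_antisym: "x \<le> y \<Longrightarrow> y \<le> x \<Longrightarrow> x = (y :: 'a pam)"
proof -
  assume "x \<le> y" "y \<le> x"
  then obtain z w where "y = x + z" "x = y + w" by (auto simp: pam_le_iff)
  then have "(z + w) + x = 0 + x" by (simp add: pam_add_0) (metis pam_add_assoc pam_add_commute)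
  then have "z + w = 0" by (simp only: pam_add_cancel)
  then show "x = y" using \<open>y = x + z\<close> pam_add_eq_0 pam_axioms(3) by metis
qed

lemma pam_linear: "x \<le> y \<or> y \<le> (x :: 'a pam)"
proof (rule pam_induct[where P = "\<lambda>x. x \<le> y \<or> y \<le> x"])
  show "Df pam_struct (\<lambda>s. s 0 \<le> y \<or> y \<le> s 0)" unfolding less_eq_pam_def by (intro pam_D)
  show "0 \<le> y \<or> y \<le> 0" by (metis pam_le_iff pam_add_0)
  fix x assume "x \<le> y \<or> y \<le> x"
  then consider z where "y = x + z" | "y \<le> x" by (auto simp: pam_le_iff)
  then show "S x \<le> y \<or> y \<le> S x"
  proof cases
    case 1
    show ?thesis using pam_cases[of z]
    proof
      assume "z = 0"
      then have "S x = y + S 0" using 1 by (simp add: pam_axioms)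
      then show ?thesis unfolding pam_le_iff by blast
    next
      assume "\<exists>w. z = S w"
      then obtain w where "y = S x + w" using 1 by (auto simp: pam_axioms pam_add_S)
      then show ?thesis unfolding pam_le_iff by blast
    qed
  next
    case 2
    then show ?thesis unfolding pam_le_iff by (metis pam_axioms(4))
  qed
qed

lemma pam_less_le: "x < y \<longleftrightarrow> x \<le> y \<and> \<not> y \<le> (x :: 'a pam)"
proof -
  have irrefl: "\<not> x < x" for x :: "'a pam"
  proof
    assume "x < x"
    then obtain z where "x = x + S z" by (auto simp: pam_less_iff)
    then have "0 + x = S z + x" by (simp add: pam_add_0) (metis pam_add_commute)
    then show False unfolding pam_add_cancel by (metis pam_axioms(1))
  qed
  show ?thesis
  proof
    assume "x < y"
    then have "x \<le> y" by (simp add: less_eq_pam_def)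
    moreover have "\<not> y \<le> x" using pam_antisym[OF \<open>x \<le> y\<close>] \<open>x < y\<close> irrefl by auto
    ultimately show "x \<le> y \<and> \<not> y \<le> x" ..
  next
    assume "x \<le> y \<and> \<not> y \<le> x"
    then show "x < y" by (auto simp: less_eq_pam_def)
  qed
qed

lemma pam_diff: "(x + y) - x = (y :: 'a pam)"
proof -
  have "x + y = x + z \<longleftrightarrow> z = y" for z
    by (metis pam_add_cancel pam_add_commute)
  then show ?thesis by (auto simp: minus_pam_def pam_le_iff)
qed

lemma pam_diff_0: "\<not> y \<le> x \<Longrightarrow> x - y = (0 :: 'a pam)"
  by (simp add: minus_pam_def)

instance pam :: (type) "{discrete_linordered_semidom, canonically_ordered_monoid_add}"
proof
  fix a b c :: "'a pam"
  show "a + b + c = a + (b + c)" by (rule pam_add_assoc)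
  show "a + b = b + a" by (rule pam_add_commute)
  show "0 + a = a" by (rule pam_add_0)
  show "a * b * c = a * (b * c)" by (rule pam_mult_assoc)
  show "a * b = b * a" by (rule pam_mult_commute)
  show one: "1 * a = a" by (simp add: one_pam_def pam_mult_S pam_mult_0 pam_add_0)
  show dist: "(a + b) * c = a * c + b * c" by (simp add: pam_mult_commute[of _ c] pam_distrib)
  show "a * (b + c) = a * b + a * c" by (rule pam_distrib)
  show "0 * a = 0" by (rule pam_mult_0)
  show "a * 0 = 0" by (rule pam_axioms)
  show "0 \<noteq> (1 :: 'a pam)" by (metis one_pam_def pam_axioms(1))
  show "a + b - a = b" by (rule pam_diff)
  show "a - b - c = a - (b + c)"
  proof (cases "b + c \<le> a")
    case True
    then obtain z where z: "a = b + (c + z)" by (auto simp: pam_le_iff pam_add_assoc)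
    have "a - b = c + z" unfolding z by (rule pam_diff)
    moreover have "a - (b + c) = z" unfolding z pam_add_assoc[symmetric] by (rule pam_diff)
    ultimately show ?thesis by (simp add: pam_diff)
  next
    case False
    have "\<not> c \<le> a - b \<or> a - b = 0 \<and> c = 0"
    proof (cases "b \<le> a")
      case True
      then obtain z where z: "a = b + z" by (auto simp: pam_le_iff)
      then have "a - b = z" by (simp add: pam_diff)
      then show ?thesis using False z by (auto simp: pam_le_iff pam_add_assoc)
    next
      case False
      then show ?thesis by (auto simp: pam_diff_0 pam_le_iff dest: pam_add_eq_0 sym)
    qed
    moreover have "(0 :: 'a pam) - 0 = 0" using pam_diff[of 0 "0 :: 'a pam"] by (simp add: pam_axioms)
    ultimately show ?thesis using False by (auto simp: pam_diff_0)
  qed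
  have mono: "c * a \<le> c * b" if "a \<le> b" for a b c :: "'a pam"
    using that by (auto simp: pam_le_iff pam_distrib)
  show "a * (b - c) = a * b - a * c"
  proof (cases "c \<le> b")
    case True
    then obtain z where "b = c + z" by (auto simp: pam_le_iff)
    then show ?thesis by (simp add: pam_diff pam_distrib)
  next
    case False
    then have "b \<le> c" using pam_linear by blast
    then have le: "a * b \<le> a * c" by (rule mono)
    have self: "x - x = 0" for x :: "'a pam" using pam_diff[of x 0] by (simp add: pam_axioms)
    have "a * b - a * c = 0"
    proof (cases "a * c \<le> a * b")
      case True
      then show ?thesis using pam_antisym[OF le True] self by simp
    next
      case False
      then show ?thesis by (rule pam_diff_0)
    qed
    then show ?thesis using False by (simp add: pam_diff_0 pam_axioms)
  qed
  show "a \<noteq> 0 \<Longrightarrow> b \<noteq> 0 \<Longrightarrow> a * b \<noteq> 0"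
    using pam_cases[of a] pam_cases[of b] by (auto simp: pam_axioms)
  show "a < b \<longleftrightarrow> a \<le> b \<and> \<not> b \<le> a" by (rule pam_less_le)
  show "a \<le> a" by (simp add: less_eq_pam_def)
  show "a \<le> b \<Longrightarrow> b \<le> c \<Longrightarrow> a \<le> c" by (auto simp: pam_le_iff pam_add_assoc)
  show "a \<le> b \<Longrightarrow> b \<le> a \<Longrightarrow> a = b" by (rule pam_antisym)
  show "a \<le> b \<or> b \<le> a" by (rule pam_linear)
  show "a \<le> b \<Longrightarrow> c + a \<le> c + b" by (auto simp: pam_le_iff pam_add_assoc)
  show "a < b \<Longrightarrow> 0 < c \<Longrightarrow> c * a < c * b"
  proof -
    assume "a < b" "0 < c"
    then obtain z w where "b = a + S z" "c = S w" by (auto simp: pam_less_iff pam_add_0)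
    then have "c * b = c * a + S (S w * z + w)" by (simp add: pam_distrib pam_axioms pam_add_assoc)
    then show "c * a < c * b" unfolding pam_less_iff by blast
  qed
  show "0 < (1 :: 'a pam)" unfolding pam_less_iff one_pam_def pam_add_0 by blast
  show "b \<le> a \<Longrightarrow> a - b + b = a" by (auto simp: pam_le_iff pam_diff pam_add_commute[of _ b])
  show "a < b \<longleftrightarrow> a + 1 \<le> b"
    unfolding pam_less_iff pam_le_iff pam_S_eq[symmetric] by (simp add: pam_add_S pam_axioms)
  show "a \<le> b \<longleftrightarrow> (\<exists>c. b = a + c)" by (rule pam_le_iff)
qed

lemma pam_struct_eq_mk: "pam_struct = mk (ind pam_struct)"
  by (rule struct.equality)
    (simp_all add: fun_eq_iff pam_S_eq zero_pam_def plus_pam_def times_pam_def less_pam_def)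

interpretation PM: pam "Df pam_struct"
proof
  show "Df pam_struct (\<lambda>s. s 1 < s 0)" using PS.D_lt by (simp add: less_pam_def)
  show "PS.Fn (\<lambda>s. s 1 + s 0)" using PS.Fn_add by (simp add: plus_pam_def)
  show "PS.Fn (\<lambda>s. s 1 * s 0)" using PS.Fn_mul by (simp add: times_pam_def)
  show "P x" if "Df pam_struct (\<lambda>s. P (s 0))" "P 0" "\<And>x. P x \<Longrightarrow> P (x + 1)" for P and x :: "'a pam"
    using that(1,2) by (rule pam_induct) (simp add: pam_S_eq that(3))
qed

lemma not_counterexample_pam_struct: "\<not> counterexample (pam_struct :: 'a pam struct)"
proof
  define I where "I = ind (pam_struct :: 'a pam struct)"
  have mk: "(pam_struct :: 'a pam struct) = mk I" unfolding I_def by (rule pam_struct_eq_mk)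
  assume "counterexample (pam_struct :: 'a pam struct)"
  then obtain d where M: "models (mk I) {Unbounded}" "models (mk I) {alpha}"
    and d: "\<not> models (final_segment (mk I) d) {alpha}"
    unfolding counterexample_def models_Un mk by (auto simp: models_def)
  define J where "J = {x \<in> I. \<not> x < d}"
  have fs: "final_segment (mk I) d = mk J"
    by (simp add: final_segment_def mk_def J_def)
  have unb: "\<exists>y. y \<in> I \<and> x < y" for x
    using M(1) by (auto simp: models_def Unbounded_def)
  have DI: "Df pam_struct (\<lambda>s. s 0 \<in> I)" unfolding I_def by (rule Df_ind)
  have "tarski (sig J)"
  proof (rule PM.tarski_sig_final_segment[OF DI])
    show "tarski (sig I)" using M(2) sat_alpha[of I "\<lambda>_. 0"] by (simp add: models_def)
    show "Df pam_struct (\<lambda>s. s 0 \<in> J)"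
      unfolding J_def mem_Collect_eq by (intro PS.D_and PS.D_Not DI PM.D_less PS.Fn_var PM.Fn_const')
    show "\<exists>y. y \<in> J \<and> x < y" for x
    proof -
      obtain y where "y \<in> I" "max x d < y" using unb by blast
      then show ?thesis by (intro exI[of _ y]) (auto simp: J_def)
    qed
    show "J \<subseteq> I" by (auto simp: J_def)
    show "y \<in> J" if "x \<in> J" "y \<in> I" "x < y" for x y
      using that by (auto simp: J_def)
  qed
  then show False using d unfolding fs by (simp add: models_def is_struct_mk sat_alpha)
qed

lemma final_segment_transport:
  assumes M: "is_struct M" and h: "inj_on h (univ M)" and d: "d \<in> univ M"
  shows "final_segment (transport h M) (h d) = transport h (final_segment M d)"
proof -
  have "{x \<in> h ` ind M. \<not> lt M (inv_into (univ M) h x) (inv_into (univ M) h (h d))} = h ` {x \<in> ind M. \<not> lt M x d}"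
    using M h d by (force simp: is_struct_def)
  then show ?thesis by (simp add: final_segment_def transport_def Let_def)
qed

lemma is_struct_final_segment: "is_struct M \<Longrightarrow> is_struct (final_segment M d)"
  by (auto simp: is_struct_def final_segment_def)

lemma counterexample_transport:
  assumes h: "inj_on h (univ M)" and M: "counterexample M"
  shows "counterexample (transport h M)"
proof -
  obtain d where d: "d \<in> univ M" "\<not> models (final_segment M d) {alpha}"
    using M unfolding counterexample_def by blast
  have st: "is_struct M" using M by (simp add: counterexample_def models_def)
  have "\<not> models (final_segment (transport h M) (h d)) {alpha}"
    unfolding final_segment_transport[OF st h d(1)]
    using d(2) h by (subst models_transport[OF is_struct_final_segment[OF st]]) (simp_all add: final_segment_def)
  moreover have "h d \<in> univ (transport h M)" using d(1) by (simp add: transport_def Let_def)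
  ultimately show ?thesis
    using M models_transport[OF st h] unfolding counterexample_def by blast
qed

text \<open>A counterexample over \<open>'a\<close> would be moved by \<open>Inl\<close> to
  \<open>'a + nat\<close>, which would force the chosen model, and with it
  \<open>pam_struct\<close>, to be a counterexample.\<close>

theorem models_final_segment_alpha:
  assumes "models (M :: 'a struct) (PA_ind \<union> {Unbounded, alpha})" "d \<in> univ M"
  shows "models (final_segment M d) {alpha}"
proof (rule ccontr)
  assume "\<not> models (final_segment M d) {alpha}"
  then have "counterexample M" using assms unfolding counterexample_def by blast
  then have "counterexample (transport Inl M :: ('a + nat) struct)" by (intro counterexample_transport) simp_all
  then have "counterexample (chosen_model :: ('a + nat) struct)" by (rule chosen_model(2))
  then have "counterexample (pam_struct :: 'a pam struct)"
    unfolding pam_struct_def by (intro counterexample_transport inj_on_Abs_pam)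
  then show False using not_counterexample_pam_struct by blast
qed

section \<open>Removing the least element of \<open>I\<close>\<close>

lemma sat_arith: "arith p \<Longrightarrow> sat (M\<lparr>ind := J\<rparr>) s p \<longleftrightarrow> sat M s p"
proof -
  have [simp]: "val (M\<lparr>ind := J\<rparr>) s t = val M s t" for s t by (induction t) simp_all
  show "arith p \<Longrightarrow> sat (M\<lparr>ind := J\<rparr>) s p \<longleftrightarrow> sat M s p"
    by (induction p arbitrary: s) simp_all
qed

lemma arith_shift [simp]: "arith (shift n p) \<longleftrightarrow> arith p"
  by (induction p) simp_all

lemma arith_PA_basic: "p \<in> PA_basic \<Longrightarrow> arith p"
  by (auto simp: PA_basic_def Let_def Iff_def Imp_def And_def)

lemma models_arith:
  assumes "models M A" "\<And>p. p \<in> A \<Longrightarrow> arith p" "J \<subseteq> univ M"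
  shows "models (M\<lparr>ind := J\<rparr>) A"
  using assms by (simp add: models_def sat_arith is_struct_def)

lemma models_PA_ind_expansion:
  assumes M: "models M PA_ind" and J: "J \<subseteq> univ M" "Df M (\<lambda>s. s 0 \<in> J)"
  shows "models (M\<lparr>ind := J\<rparr>) PA_ind"
proof -
  have st: "is_struct M" using M by (simp add: models_def)
  have Ind: "sat M s (Induct x p)" if "range s \<subseteq> univ M" for x p s
    using M that unfolding models_def PA_ind_def by blast
  have "models (M\<lparr>ind := J\<rparr>) PA_basic"
    using M by (intro models_arith arith_PA_basic J) (simp_all add: PA_ind_def models_Un)
  moreover have "models (M\<lparr>ind := J\<rparr>) {Induct x p | x p. True}"
    using sat_Induct_expansion[OF st Ind J] st J by (auto simp: models_def is_struct_def)
  ultimately show ?thesis unfolding PA_ind_def models_Un by blast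
qed

context
  fixes M :: "'a struct"
  assumes M: "models M PA_ind"
begin

lemma struct_M: "is_struct M"
  using M by (simp add: models_def)

interpretation dstruct "univ M" "Df M" M
  by (rule dstruct_Df_self[OF struct_M])

lemma PA_ind_sat: "p \<in> PA_ind \<Longrightarrow> range s \<subseteq> univ M \<Longrightarrow> sat M s p"
  using M by (simp add: models_def)

lemma PA_zer: "zer M \<in> univ M" and PA_suc: "x \<in> univ M \<Longrightarrow> suc M x \<in> univ M"
  using struct_M by (auto simp: is_struct_def)

lemma PA_not_less_zer: "x \<in> univ M \<Longrightarrow> \<not> lt M x (zer M)"
  using PA_ind_sat[of "Neg (Less (Var 0) Zero)" "\<lambda>_. x"]
  by (auto simp: PA_ind_def PA_basic_def Let_def)

lemma PA_less_suc: "x \<in> univ M \<Longrightarrow> y \<in> univ M \<Longrightarrow> lt M x (suc M y) \<longleftrightarrow> lt M x y \<or> x = y"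
  using PA_ind_sat[of "Iff (Less (Var 0) (Succ (Var 1))) (Or (Less (Var 0) (Var 1)) (Eq (Var 0) (Var 1)))"
      "\<lambda>i. if i = 0 then x else y"]
  by (auto simp: PA_ind_def PA_basic_def Let_def image_subset_iff)

lemma PA_induct:
  assumes "Df M (\<lambda>s. P (s 0))" "P (zer M)" "\<And>x. x \<in> univ M \<Longrightarrow> P x \<Longrightarrow> P (suc M x)" "x \<in> univ M"
  shows "P x"
proof (rule Df_induct[OF struct_M _ assms(1)])
  show "sat M s (Induct x p)" if "range s \<subseteq> univ M" for s x p
    using that by (intro PA_ind_sat) (auto simp: PA_ind_def)
qed (use assms in auto)

lemma PA_less_trans:
  assumes "x \<in> univ M" "y \<in> univ M" "z \<in> univ M" "lt M x y" "lt M y z" shows "lt M x z"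
proof -
  have "\<forall>x\<in>univ M. \<forall>y\<in>univ M. lt M x y \<longrightarrow> lt M y z \<longrightarrow> lt M x z"
  proof (rule PA_induct[where P = "\<lambda>z. \<forall>x\<in>univ M. \<forall>y\<in>univ M. lt M x y \<longrightarrow> lt M y z \<longrightarrow> lt M x z", OF _ _ _ assms(3)])
    show "Df M (\<lambda>s. \<forall>x\<in>univ M. \<forall>y\<in>univ M. lt M x y \<longrightarrow> lt M y (s 0) \<longrightarrow> lt M x (s 0))"
      by (intro D_ball D_imp D_app2[OF D_lt] Fn_var)
    show "\<forall>x\<in>univ M. \<forall>y\<in>univ M. lt M x y \<longrightarrow> lt M y (zer M) \<longrightarrow> lt M x (zer M)"
      using PA_not_less_zer by blast
    show "\<forall>x\<in>univ M. \<forall>y\<in>univ M. lt M x y \<longrightarrow> lt M y (suc M z) \<longrightarrow> lt M x (suc M z)"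
      if "z \<in> univ M" "\<forall>x\<in>univ M. \<forall>y\<in>univ M. lt M x y \<longrightarrow> lt M y z \<longrightarrow> lt M x z" for z
      using that PA_less_suc[OF _ that(1)] by blast
  qed
  then show ?thesis using assms by blast
qed

lemma least_ind:
  assumes "a \<in> ind M" obtains c where "c \<in> ind M" "\<And>x. x \<in> ind M \<Longrightarrow> \<not> lt M x c"
proof -
  have sub: "ind M \<subseteq> univ M" using struct_M by (simp add: is_struct_def)
  have "\<exists>c\<in>ind M. \<forall>x\<in>ind M. \<not> lt M x c"
  proof (rule ccontr)
    assume no: "\<not> ?thesis"
    have "\<forall>x\<in>univ M. x \<in> ind M \<longrightarrow> \<not> lt M x (suc M a)"
    proof (rule PA_induct[where P = "\<lambda>z. \<forall>x\<in>univ M. x \<in> ind M \<longrightarrow> \<not> lt M x z"])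
      show "Df M (\<lambda>s. \<forall>x\<in>univ M. x \<in> ind M \<longrightarrow> \<not> lt M x (s 0))"
        by (intro D_ball D_imp D_Not D_app2[OF D_lt] D_app1[where R = "\<lambda>x. x \<in> ind M", OF D_ind] Fn_var)
      show "suc M a \<in> univ M" using assms sub PA_suc by auto
      show "\<forall>x\<in>univ M. x \<in> ind M \<longrightarrow> \<not> lt M x (suc M z)"
        if z: "z \<in> univ M" and IH: "\<forall>x\<in>univ M. x \<in> ind M \<longrightarrow> \<not> lt M x z" for z
      proof (intro ballI impI notI)
        fix x assume x: "x \<in> univ M" "x \<in> ind M" "lt M x (suc M z)"
        then have "z \<in> ind M" using IH PA_less_suc[OF x(1) z] by blast
        then show False using no IH sub by blast
      qed
    qed (use PA_not_less_zer in auto)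
    then show False using assms sub PA_less_suc[of a a] by auto
  qed
  then show ?thesis using that by blast
qed

lemma definable_iso_eq_id:
  assumes f: "isomorphism M (M\<lparr>ind := J\<rparr>) f" "definable M 2 (\<lambda>xs. xs ! 1 = f (xs ! 0))" and x: "x \<in> univ M"
  shows "f x = x"
proof -
  obtain p q where q: "range q \<subseteq> univ M"
    and p: "\<And>xs. length xs = 2 \<Longrightarrow> set xs \<subseteq> univ M \<Longrightarrow>
      xs ! 1 = f (xs ! 0) \<longleftrightarrow> sat M (\<lambda>i. if i < 2 then xs ! i else q i) p"
    using f(2) unfolding definable_def by blast
  have eq: "f a = a \<longleftrightarrow> sat M (\<lambda>i. if i < 2 then a else q i) p" if "a \<in> univ M" for a
  proof -
    have "(\<lambda>i. if i < 2 then [a, a] ! i else q i) = (\<lambda>i. if i < 2 then a else q i)"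
      by (auto simp: fun_eq_iff less_2_cases_iff)
    then show ?thesis using p[of "[a, a]"] that by auto
  qed
  \<comment> \<open>The graph of \<open>f\<close> is restricted to the diagonal. Its parameters
    \<open>q i\<close> enter as constant functions, of which the formula \<open>p\<close> involves
    finitely many.\<close>
  have "Df M (\<lambda>s. sat M (\<lambda>i. (if i < 2 then (\<lambda>s. s 0) else (\<lambda>s. q i)) s) p)"
    using q by (intro D_sat) (auto intro: Fn_var Fn_const)
  then have "Df M (\<lambda>s. sat M (\<lambda>i. if i < 2 then s 0 else q i) p)"
    by (rule D_cong[rotated]) (auto intro!: arg_cong[where f = "\<lambda>s. sat M s p"])
  then have "Df M (\<lambda>s. f (s 0) = s 0)"
    by (rule D_cong[rotated]) (use eq in auto)
  then show ?thesis
    by (rule PA_induct[where P = "\<lambda>x. f x = x", OF _ _ _ x]) (use f(1) in \<open>auto simp: isomorphism_def\<close>)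
qed

end

lemma definable_I:
  assumes "range q \<subseteq> univ M"
    "\<And>xs. length xs = k \<Longrightarrow> set xs \<subseteq> univ M \<Longrightarrow> R xs \<longleftrightarrow> sat M (\<lambda>i. if i < k then xs ! i else q i) p"
  shows "definable M k R"
  using assms unfolding definable_def by blast

lemma definable_cong:
  assumes R: "definable M k R" and eq: "\<And>xs. length xs = k \<Longrightarrow> set xs \<subseteq> univ M \<Longrightarrow> R' xs \<longleftrightarrow> R xs"
  shows "definable M k R'"
proof -
  obtain p q where q: "range q \<subseteq> univ M" and p: "\<forall>xs. length xs = k \<and> set xs \<subseteq> univ M \<longrightarrow>
      (R xs \<longleftrightarrow> sat M (\<lambda>i. if i < k then xs ! i else q i) p)"
    using R unfolding definable_def by blast
  show ?thesis by (rule definable_I[OF q, where p = p]) (simp add: p eq)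
qed

lemma interprets_expansion:
  assumes M: "is_struct M" and J: "J \<subseteq> univ M" "definable M 1 (\<lambda>xs. xs ! 0 \<in> J)"
  shows "M \<unrhd> M\<lparr>ind := J\<rparr>"
proof -
  have z: "range (\<lambda>_. zer M) \<subseteq> univ M" using M by (auto simp: is_struct_def)
  have "definable M 1 (\<lambda>xs. set xs \<subseteq> univ M \<and> xs ! 0 \<in> J)"
    by (rule definable_cong[OF J(2)]) simp
  moreover have "definable M 1 (\<lambda>xs. xs ! 0 \<in> univ M)"
    by (rule definable_I[OF z, where p = "Eq (Var 0) (Var 0)"]) (auto simp: length_Suc_conv)
  moreover have "definable M 1 (\<lambda>xs. xs ! 0 = zer M)"
    by (rule definable_I[OF z, where p = "Eq (Var 0) Zero"]) simp
  moreover have "definable M 2 (\<lambda>xs. set xs \<subseteq> univ M \<and> xs ! 1 = suc M (xs ! 0))"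
    by (rule definable_I[OF z, where p = "Eq (Var 1) (Succ (Var 0))"]) simp
  moreover have "definable M 3 (\<lambda>xs. set xs \<subseteq> univ M \<and> xs ! 2 = add M (xs ! 0) (xs ! 1))"
    by (rule definable_I[OF z, where p = "Eq (Var 2) (Plus (Var 0) (Var 1))"]) simp
  moreover have "definable M 3 (\<lambda>xs. set xs \<subseteq> univ M \<and> xs ! 2 = mul M (xs ! 0) (xs ! 1))"
    by (rule definable_I[OF z, where p = "Eq (Var 2) (Times (Var 0) (Var 1))"]) simp
  moreover have "definable M 2 (\<lambda>xs. set xs \<subseteq> univ M \<and> lt M (xs ! 0) (xs ! 1))"
    by (rule definable_I[OF z, where p = "Less (Var 0) (Var 1)"]) simp
  ultimately show ?thesis by (simp add: interprets_def)
qed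

lemma definably_iso_refl:
  assumes M: "is_struct M" shows "definably_iso M M"
proof -
  have z: "range (\<lambda>_. zer M) \<subseteq> univ M" using M by (auto simp: is_struct_def)
  have "definable M 2 (\<lambda>xs. xs ! 1 = id (xs ! 0))"
    by (rule definable_I[OF z, where p = "Eq (Var 1) (Var 0)"]) simp
  moreover have "isomorphism M M id" by (simp add: isomorphism_def)
  ultimately show ?thesis unfolding definably_iso_def by blast
qed

lemma PAI_eq: "PAI = PA_ind \<union> {Unbounded} \<union> {Indisc m p | m p. arith p \<and> fv p \<subseteq> {..m}}"
  and PAI0_eq: "PAI0 = PA_ind \<union> {Unbounded} \<union> {Indisc0 m p | m p. arith p \<and> fv p \<subseteq> {..m}}"
  by (auto simp: PAI_def PAI0_def PA_ind_def)

lemma models_mono: "models M U \<Longrightarrow> A \<subseteq> U \<Longrightarrow> models M A"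
  by (auto simp: models_def)

lemma PA_ind_subset: "PA_ind \<union> {Unbounded} \<subseteq> PAI" "PA_ind \<union> {Unbounded} \<subseteq> PAI0"
  by (auto simp: PAI_eq PAI0_eq)

lemma sat_IncrI_mono:
  "sat (M\<lparr>ind := J\<rparr>) s (IncrI i m) \<Longrightarrow> J \<subseteq> ind M \<Longrightarrow> sat M s (IncrI i m)"
  by (auto simp: sat_IncrI)

text \<open>Tuples from \<open>J\<close> are tuples from \<open>ind M\<close>, and the formulae of
  the indiscernibility scheme do not mention \<open>I\<close>, so the scheme passes to subsets.
  Induction carries over because \<open>J\<close> is definable.\<close>

lemma models_PAI_expansion:
  assumes M: "models M U" and U: "U = PAI \<or> U = PAI0" and J: "J \<subseteq> ind M" "Df M (\<lambda>s. s 0 \<in> J)"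
    and unb: "models (M\<lparr>ind := J\<rparr>) {Unbounded}"
  shows "models (M\<lparr>ind := J\<rparr>) U"
proof -
  have PA: "models M PA_ind" using models_mono[OF M] U PA_ind_subset by blast
  have J': "J \<subseteq> univ M" using PA J(1) by (auto simp: models_def is_struct_def)
  have Indisc: "sat (M\<lparr>ind := J\<rparr>) s (Indisc m p)" if "sat M s (Indisc m p)" "arith p" for s m p
    using that sat_IncrI_mono[OF _ J(1)] by (auto simp: Indisc_def sat_arith)
  have Indisc0: "sat (M\<lparr>ind := J\<rparr>) s (Indisc0 m p)" if "sat M s (Indisc0 m p)" "arith p" for s m p
  proof -
    have "val (M\<lparr>ind := J\<rparr>) s (num k) = val M s (num k)" for k by (induction k) auto
    then show ?thesis using that sat_IncrI_mono[OF _ J(1)] by (auto simp: Indisc0_def sat_arith)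
  qed
  have PA': "models (M\<lparr>ind := J\<rparr>) PA_ind" by (rule models_PA_ind_expansion[OF PA J' J(2)])
  have "sat (M\<lparr>ind := J\<rparr>) s p" if s: "range s \<subseteq> univ M" and p: "p \<in> U" for s p
  proof -
    have sat: "sat M s p" using M s p by (simp add: models_def)
    consider "p \<in> PA_ind" | "p = Unbounded" | m q where "p = Indisc m q" "arith q"
      | m q where "p = Indisc0 m q" "arith q"
      using U p by (auto simp: PAI_eq PAI0_eq)
    then show ?thesis
      by cases (use PA' unb s sat Indisc Indisc0 in \<open>auto simp: models_def\<close>)
  qed
  moreover have "is_struct (M\<lparr>ind := J\<rparr>)" using unb by (simp add: models_def)
  ultimately show ?thesis by (simp add: models_def)
qed

theorem nowhere_solid:
  assumes U: "U \<in> {PAI0, PAI, PAI \<union> {alpha}}"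
  shows "nowhere_solid TYPE('a) U"
  unfolding nowhere_solid_def
proof (intro allI impI)
  fix M :: "'a struct" assume MU: "models M U"
  have "models M PAI" if "models M (PAI \<union> {alpha})" using that by (rule models_mono) blast
  then obtain U0 where U0: "U0 = PAI \<or> U0 = PAI0" "models M U0" and U_cases: "U = U0 \<or> U = U0 \<union> {alpha}"
    using U MU by (metis insertE empty_iff)
  have PA: "models M PA_ind" and unb: "models M {Unbounded}"
    using models_mono[OF U0(2)] U0(1) PA_ind_subset by blast+
  have st: "is_struct M" using PA by (simp add: models_def)
  have sub: "ind M \<subseteq> univ M" using st by (simp add: is_struct_def)
  have unbM: "\<exists>y\<in>univ M. lt M x y \<and> y \<in> ind M" if "x \<in> univ M" for x
  proof -
    have "sat M (\<lambda>_. x) Unbounded" using unb that by (auto simp: models_def)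
    then show ?thesis using that by (auto simp: Unbounded_def)
  qed
  obtain a where "a \<in> ind M" using unbM PA_zer[OF PA] by blast
  then obtain c where c: "c \<in> ind M" "\<And>x. x \<in> ind M \<Longrightarrow> \<not> lt M x c" using least_ind[OF PA] by blast
  define N where "N = M\<lparr>ind := ind M - {c}\<rparr>"
  have cU: "c \<in> univ M" using c(1) sub by blast
  \<comment> \<open>Removing the least element is cutting \<open>I\<close> off at
    \<open>suc M c\<close>, so \<alpha> survives by the result on final segments.\<close>
  have "{x \<in> ind M. \<not> lt M x (suc M c)} = ind M - {c}"
    using c(2) sub PA_less_suc[OF PA _ cU] by blast
  then have "final_segment M (suc M c) = N"
    by (simp add: final_segment_def N_def)
  moreover have "models (final_segment M (suc M c)) {alpha}" if "models M {alpha}"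
  proof (rule models_final_segment_alpha[OF _ PA_suc[OF PA cU]])
    have "models M (PA_ind \<union> {Unbounded} \<union> {alpha})" using PA unb that by (simp only: models_Un)
    then show "models M (PA_ind \<union> {Unbounded, alpha})" by (rule models_mono) blast
  qed
  ultimately have alphaN: "models N {alpha}" if "models M {alpha}" using that by simp
  interpret dstruct "univ M" "Df M" M by (rule dstruct_Df_self[OF st])
  have DJ: "Df M (\<lambda>s. s 0 \<in> ind M - {c})"
    unfolding Diff_iff singleton_iff by (intro D_and D_Not D_ind D_eq Fn_var Fn_const cU)
  have "models N {Unbounded}"
  proof -
    have "\<exists>z\<in>univ M. lt M x z \<and> z \<in> ind M - {c}" if x: "x \<in> univ M" for x
    proof -
      obtain y where y: "y \<in> univ M" "lt M x y" "y \<in> ind M" using unbM[OF x] by blast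
      \<comment> \<open>\<open>y\<close> itself might be \<open>c\<close>. A second element
        \<open>z\<close> of \<open>I\<close> above \<open>y\<close> is not the least one.\<close>
      obtain z where z: "z \<in> univ M" "lt M y z" "z \<in> ind M" using unbM[OF y(1)] by blast
      have "z \<noteq> c" using c(2)[OF y(3)] z(2) by blast
      then show ?thesis using z PA_less_trans[OF PA x y(1) z(1) y(2) z(2)] by blast
    qed
    then show ?thesis using st by (auto simp: models_def N_def Unbounded_def is_struct_def)
  qed
  then have "models N U0" using models_PAI_expansion[OF U0(2,1) _ DJ] unfolding N_def by blast
  then have NU: "models N U" using U_cases alphaN MU models_Un[of M U0 "{alpha}"] models_Un[of N U0 "{alpha}"] by metis
  have q: "range (\<lambda>_. c) \<subseteq> univ M" using cU by auto
  have MN: "M \<unrhd> N" unfolding N_def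
  proof (rule interprets_expansion[OF st])
    show "definable M 1 (\<lambda>xs. xs ! 0 \<in> ind M - {c})"
      by (rule definable_I[OF q, where p = "And (InI (Var 0)) (Neg (Eq (Var 0) (Var 1)))"]) simp
  qed (use sub in blast)
  have M: "M = N\<lparr>ind := ind M\<rparr>" by (simp add: N_def)
  have "N \<unrhd> N\<lparr>ind := ind M\<rparr>"
  proof (rule interprets_expansion)
    show "is_struct N" using NU by (simp add: models_def)
    show "ind M \<subseteq> univ N" using sub by (simp add: N_def)
    show "definable N 1 (\<lambda>xs. xs ! 0 \<in> ind M)"
      by (rule definable_I[where q = "\<lambda>_. c" and p = "Or (InI (Var 0)) (Eq (Var 0) (Var 1))"])
        (use cU c in \<open>auto simp: N_def\<close>)
  qed
  then have NM: "N \<unrhd> M" unfolding M[symmetric] .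
  have "\<not> definably_iso M N"
  proof
    assume "definably_iso M N"
    then obtain f where f: "isomorphism M (M\<lparr>ind := ind M - {c}\<rparr>) f"
      "definable M 2 (\<lambda>xs. xs ! 1 = f (xs ! 0))"
      unfolding definably_iso_def N_def by blast
    have "f c = c" by (rule definable_iso_eq_id[OF PA f cU])
    moreover have "c \<in> ind M \<longleftrightarrow> f c \<in> ind (M\<lparr>ind := ind M - {c}\<rparr>)"
      using f(1) cU unfolding isomorphism_def by blast
    ultimately show False using c(1) by simp
  qed
  then show "\<exists>M' N. models M' U \<and> models N U \<and> M \<unrhd> N \<and> N \<unrhd> M' \<and> definably_iso M M' \<and> \<not> definably_iso M N"
    using MU NU MN NM definably_iso_refl[OF st] by (intro exI[of _ M] exI[of _ N] conjI)
qed

section \<open>The standard model with sparse indiscernibles\<close>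

abbreviation std :: "nat struct" where "std \<equiv> mk {}"

interpretation NP: pam "\<lambda>_ :: (nat \<Rightarrow> nat) \<Rightarrow> bool. True"
  rewrites "dclass.Fn UNIV (\<lambda>_ :: (nat \<Rightarrow> nat) \<Rightarrow> bool. True) = (\<lambda>_. True)"
proof -
  interpret dclass UNIV "\<lambda>_ :: (nat \<Rightarrow> nat) \<Rightarrow> bool. True" by standard simp_all
  show "pam (\<lambda>_ :: (nat \<Rightarrow> nat) \<Rightarrow> bool. True)"
  proof
    show "P x" if "P 0" "\<And>x. P x \<Longrightarrow> P (x + 1)" for P and x :: nat
      using that by (induction x) simp_all
  qed (simp_all add: Fn_def)
  show "dclass.Fn UNIV (\<lambda>_ :: (nat \<Rightarrow> nat) \<Rightarrow> bool. True) = (\<lambda>_. True)"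
    by (simp add: Fn_def fun_eq_iff)
qed

lemma npair_eq_pr: "npair = pr"
  by (simp add: npair_def pr_def fun_eq_iff)

section \<open>Codes and truth in the standard model\<close>

lemma inj_gn_tm: "gn_tm t = gn_tm u \<longleftrightarrow> t = u"
proof (induction t arbitrary: u)
  case (Var x)
  then show ?case by (cases u) (simp_all add: npair_eq_pr)
next
  case Zero
  then show ?case by (cases u) (simp_all add: npair_eq_pr)
next
  case (Succ t)
  then show ?case by (cases u) (simp_all add: npair_eq_pr)
next
  case (Plus t1 t2)
  then show ?case by (cases u) (simp_all add: npair_eq_pr)
next
  case (Times t1 t2)
  then show ?case by (cases u) (simp_all add: npair_eq_pr)
qed

lemma inj_gn: "gn p = gn q \<longleftrightarrow> p = q"
proof (induction p arbitrary: q)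
  case (Eq t u)
  then show ?case by (cases q) (simp_all add: npair_eq_pr inj_gn_tm)
next
  case (Less t u)
  then show ?case by (cases q) (simp_all add: npair_eq_pr inj_gn_tm)
next
  case (InI t)
  then show ?case by (cases q) (simp_all add: npair_eq_pr inj_gn_tm)
next
  case (Neg p)
  then show ?case by (cases q) (simp_all add: npair_eq_pr)
next
  case (Or p1 p2)
  then show ?case by (cases q) (simp_all add: npair_eq_pr)
next
  case (Ex i p)
  then show ?case by (cases q) (simp_all add: npair_eq_pr)
qed

lemma fv_tm_less_gn: "i \<in> fv_tm t \<Longrightarrow> i < gn_tm t"
  by (induction t) (auto simp: npair_eq_pr intro: less_pr)

lemma fv_less_gn: "i \<in> fv p \<Longrightarrow> i < gn p"
  by (induction p) (auto simp: npair_eq_pr dest!: fv_tm_less_gn intro: less_pr)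

lemma finite_gn_less: "finite {p. gn p < j}"
  by (rule finite_imageD[of gn]) (auto simp: inj_on_def inj_gn intro: finite_subset[of _ "{..<j}"])

lemma isT_gn_tm: "isT n x \<Longrightarrow> \<exists>t. gn_tm t = x \<and> fv_tm t \<subseteq> {..<n}"
proof (rule NP.isT_induct[where P = "\<lambda>x. \<exists>t. gn_tm t = x \<and> fv_tm t \<subseteq> {..<n}"])
  show "\<exists>t. gn_tm t = kVar i \<and> fv_tm t \<subseteq> {..<n}" if "i < n" for i
    using that by (intro exI[of _ "Var i"]) (simp add: npair_eq_pr)
  show "\<exists>t. gn_tm t = kZero \<and> fv_tm t \<subseteq> {..<n}"
    by (intro exI[of _ Zero]) (simp add: npair_eq_pr)
  fix s t assume "\<exists>t. gn_tm t = s \<and> fv_tm t \<subseteq> {..<n}"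
  then obtain s' where s: "gn_tm s' = s" "fv_tm s' \<subseteq> {..<n}" by blast
  then show "\<exists>t. gn_tm t = kSucc s \<and> fv_tm t \<subseteq> {..<n}"
    by (intro exI[of _ "Succ s'"]) (simp add: npair_eq_pr)
  assume "\<exists>t'. gn_tm t' = t \<and> fv_tm t' \<subseteq> {..<n}"
  then obtain t' where "gn_tm t' = t" "fv_tm t' \<subseteq> {..<n}" by blast
  then show "\<exists>u. gn_tm u = kPlus s t \<and> fv_tm u \<subseteq> {..<n}" "\<exists>u. gn_tm u = kTimes s t \<and> fv_tm u \<subseteq> {..<n}"
    using s by (intro exI[of _ "Plus s' t'"] exI[of _ "Times s' t'"], simp add: npair_eq_pr)+
qed simp_all

lemma isF_gn: "isF n x \<Longrightarrow> \<exists>p. gn p = x \<and> arith p"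
proof (rule NP.isF_induct[where P = "\<lambda>x. \<exists>p. gn p = x \<and> arith p"])
  fix s t assume "isT n s" "isT n t"
  then obtain s' t' where "gn_tm s' = s" "gn_tm t' = t" using isT_gn_tm by blast
  then show "\<exists>p. gn p = kEq s t \<and> arith p" "\<exists>p. gn p = kLess s t \<and> arith p"
    by (intro exI[of _ "Eq s' t'"] exI[of _ "Less s' t'"], simp add: npair_eq_pr)+
next
  fix p assume "\<exists>p'. gn p' = p \<and> arith p'"
  then obtain p' where p': "gn p' = p" "arith p'" by blast
  then show "\<exists>p'. gn p' = kNeg p \<and> arith p'"
    by (intro exI[of _ "Neg p'"]) (simp add: npair_eq_pr)
  show "\<exists>p'. gn p' = kEx i p \<and> arith p'" for i
    using p' by (intro exI[of _ "Ex i p'"]) (simp add: npair_eq_pr)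
next
  fix p q assume "\<exists>p'. gn p' = p \<and> arith p'" "\<exists>p'. gn p' = q \<and> arith p'"
  then obtain p' q' where "gn p' = p" "arith p'" "gn q' = q" "arith q'" by blast
  then show "\<exists>p'. gn p' = kOr p q \<and> arith p'"
    by (intro exI[of _ "Or p' q'"]) (simp add: npair_eq_pr)
qed simp_all

text \<open>Positions beyond the length get the default 0, which is below every \<open>j\<close>
  that exceeds a formula, so the bound on the entries extends to the whole assignment.\<close>

definition ent :: "nat \<Rightarrow> nat \<Rightarrow> nat" where
  "ent a i = (if \<exists>x. entry a i x then THE x. entry a i x else 0)"

lemma ent_eq:
  assumes x: "entry a i x" shows "ent a i = x"
proof -
  have "(THE x. entry a i x) = x" using x entry_unique by blast
  then show ?thesis using x unfolding ent_def by auto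
qed

lemma ent_upd:
  assumes u: "upd a i y b" shows "ent b = (ent a)(i := y)"
proof
  fix k
  show "ent b k = ((ent a)(i := y)) k"
  proof (cases "k = i")
    case True
    then show ?thesis using ent_eq[of b i y] NP.upd_entry[OF u] by simp
  next
    case False
    then have "entry b k = entry a k" using NP.upd_entry[OF u] by (simp add: fun_eq_iff)
    then show ?thesis using False by (simp add: ent_def)
  qed
qed

lemma eval_gn_tm:
  "seq a n \<Longrightarrow> fv_tm t \<subseteq> {..<n} \<Longrightarrow> eval (gn_tm t) a v \<longleftrightarrow> v = val std (ent a) t"
proof (induction t arbitrary: v)
  case (Var i)
  then have "i < n" by simp
  then obtain x where "entry a i x" using NP.entry_ex[OF Var(1)] by blast
  then show ?case using ent_eq entry_unique by (auto simp: npair_eq_pr)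
next
  case Zero
  then show ?case using NP.eval_Zero[of a v] by (simp add: npair_eq_pr)
qed (simp_all add: npair_eq_pr)

definition Tr :: "nat \<Rightarrow> bool" where
  "Tr w \<longleftrightarrow> (\<exists>p a. arith p \<and> w = pr (gn p) a \<and> sat std (ent a) p)"

lemma Tr_gn: "arith p \<Longrightarrow> Tr (pr (gn p) a) \<longleftrightarrow> sat std (ent a) p"
  by (auto simp: Tr_def inj_gn)

lemma tarski_Tr: "tarski Tr"
  unfolding tarski_def
proof (intro allI impI conjI; (elim conjE)?)
  fix n a s t :: nat assume a: "seq a n" and "isT n s" "isT n t"
  then obtain s' t' where st: "s = gn_tm s'" "fv_tm s' \<subseteq> {..<n}" "t = gn_tm t'" "fv_tm t' \<subseteq> {..<n}"
    using isT_gn_tm by metis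
  show "Tr (pr (kEq s t) a) \<longleftrightarrow> (\<exists>y z. eval s a y \<and> eval t a z \<and> y = z)"
    using Tr_gn[of "Eq s' t'" a] by (simp add: st eval_gn_tm[OF a] npair_eq_pr)
  show "Tr (pr (kLess s t) a) \<longleftrightarrow> (\<exists>y z. eval s a y \<and> eval t a z \<and> y < z)"
    using Tr_gn[of "Less s' t'" a] by (simp add: st eval_gn_tm[OF a] npair_eq_pr)
next
  fix n a p :: nat assume "isF n p"
  then obtain p' where "p = gn p'" "arith p'" using isF_gn by blast
  then show "Tr (pr (kNeg p) a) \<longleftrightarrow> \<not> Tr (pr p a)"
    using Tr_gn[of "Neg p'" a] Tr_gn[of p' a] by (simp add: npair_eq_pr)
next
  fix n a p q :: nat assume "isF n p" "isF n q"
  then obtain p' q' where "p = gn p'" "arith p'" "q = gn q'" "arith q'" using isF_gn by metis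
  then show "Tr (pr (kOr p q) a) \<longleftrightarrow> Tr (pr p a) \<or> Tr (pr q a)"
    using Tr_gn[of "Or p' q'" a] Tr_gn[of p' a] Tr_gn[of q' a] by (simp add: npair_eq_pr)
next
  fix n a i p :: nat assume a: "seq a n" and i: "i < n" and "isF n p"
  then obtain p' where p': "p = gn p'" "arith p'" using isF_gn by blast
  have "Tr (pr (kEx i p) a) \<longleftrightarrow> (\<exists>y. sat std ((ent a)(i := y)) p')"
    using Tr_gn[of "Ex i p'" a] p' by (simp add: npair_eq_pr)
  also have "\<dots> \<longleftrightarrow> (\<exists>y b. upd a i y b \<and> Tr (pr p b))"
    using NP.upd_ex[OF a i] Tr_gn[OF p'(2)] ent_upd unfolding p'(1) by metis
  finally show "Tr (pr (kEx i p) a) \<longleftrightarrow> (\<exists>y b. upd a i y b \<and> Tr (pr p b))" .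
qed

section \<open>Sparse and homogeneous sets of natural numbers\<close>

lemma finite_witness_bound:
  assumes "finite X" shows "\<exists>B::nat. \<forall>x\<in>X. (\<exists>y. Q x y) \<longrightarrow> (\<exists>y<B. Q x y)"
  using assms
proof induction
  case (insert x X)
  then obtain B where B: "\<forall>x\<in>X. (\<exists>y. Q x y) \<longrightarrow> (\<exists>y<B. Q x y)" by blast
  define B' where "B' = max B (Suc (SOME y. Q x y))"
  have "\<exists>y<B'. Q x y" if "Q x y" for y
    using someI[of "Q x", OF that] by (intro exI[of _ "SOME y. Q x y"]) (auto simp: B'_def)
  moreover have "\<exists>y<B'. Q x' y" if "x' \<in> X" "Q x' y" for x' y
    using B that by (metis B'_def less_max_iff_disj)
  ultimately show ?case by blast
qed simp

text \<open>Finitely many formulae have a code below \<open>j\<close>, and their free variables are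
  below \<open>j\<close> as well. So only the values of the assignment at these variables count, and
  values below \<open>j\<close> leave finitely many cases, for which one bound on the witnesses
  exists.\<close>

lemma witness_bound:
  "\<exists>B. \<forall>i p s y. gn (Ex i p) < j \<longrightarrow> (\<forall>k. s k < j) \<longrightarrow> sat std (s(i := y)) p \<longrightarrow>
     (\<exists>y<B. sat std (s(i := y)) p)"
proof -
  define X where "X = {p. gn p < j} \<times> {..<j} \<times> {s. \<forall>k. (k \<in> {..<j} \<longrightarrow> s k \<in> {..<j}) \<and> (k \<notin> {..<j} \<longrightarrow> s k = 0)}"
  have "finite X" unfolding X_def
    by (intro finite_cartesian_product finite_gn_less finite_set_of_finite_funs) simp_all
  from finite_witness_bound[OF this, of "\<lambda>(p, i, s) y. sat std (s(i := y)) p"]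
  obtain B where B0: "\<forall>x\<in>X. (\<exists>y. (case x of (p, i, s) \<Rightarrow> \<lambda>y. sat std (s(i := y)) p) y) \<longrightarrow>
      (\<exists>y<B. (case x of (p, i, s) \<Rightarrow> \<lambda>y. sat std (s(i := y)) p) y)" ..
  have B: "\<exists>y<B. sat std (s(i := y)) p" if "(p, i, s) \<in> X" "sat std (s(i := y)) p" for p i s y
    using bspec[OF B0 that(1)] that(2) by (simp only: prod.case) blast
  have "\<exists>y<B. sat std (s(i := y)) p"
    if gn: "gn (Ex i p) < j" and s: "\<forall>k. s k < j" and sat: "sat std (s(i := y)) p" for i p s y
  proof -
    define s' where "s' k = (if k < j then s k else 0)" for k
    have "i < gn (Ex i p)" "gn p < gn (Ex i p)" by (simp_all add: npair_eq_pr less_pr)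
    then have j: "i < j" "gn p < j" using gn by simp_all
    have eq: "sat std (s(i := z)) p \<longleftrightarrow> sat std (s'(i := z)) p" for z
      using j(2) by (intro sat_cong) (auto simp: s'_def dest: fv_less_gn)
    have "(p, i, s') \<in> X" using j s by (simp add: X_def s'_def)
    then show ?thesis using B sat eq by blast
  qed
  then show ?thesis by blast
qed

lemma ex_growth:
  obtains g where "\<And>j i p s y. gn (Ex i p) < j \<Longrightarrow> (\<And>k. s k < j) \<Longrightarrow> sat std (s(i := y)) p \<Longrightarrow>
     \<exists>y<g j. sat std (s(i := y)) p"
  using witness_bound by metis

text \<open>The element of \<open>range h\<close> after \<open>j\<close> is at least
  \<open>g j\<close>, and \<open>g j\<close> bounds a witness of every true existential formula that
  \<open>j\<close> exceeds. This is the hypothesis \<open>witness\<close> of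
  \<open>represents\<close>.\<close>

theorem tarski_sig_sparse:
  assumes g: "\<And>j i p s y. gn (Ex i p) < j \<Longrightarrow> (\<And>k. s k < j) \<Longrightarrow> sat std (s(i := y)) p \<Longrightarrow>
     \<exists>y<g j. sat std (s(i := y)) p"
    and mono: "strict_mono (h :: nat \<Rightarrow> nat)" and gap: "\<And>n. g (h n) \<le> h (Suc n)"
  shows "tarski (sig (range h))"
proof (rule NP.tarski_sig)
  show "\<exists>y. y \<in> range h \<and> x < y" for x
    using strict_mono_imp_increasing[OF mono, of "Suc x"] by (intro exI[of _ "h (Suc x)"]) auto
  show "tarski Tr" by (rule tarski_Tr)
  fix n p :: nat assume p: "isF n p"
  show "represents (range h) n Tr p"
  proof (rule NP.represents[OF _ _ tarski_Tr p])
    fix i p a j j'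
    assume p: "isF n p" and i: "i < n" and a: "seq a n" and j: "j \<in> range h" and ex: "exceed j (kEx i p) a"
      and nx: "next_in (range h) j j'" and S: "Tr (pr (kEx i p) a)"
    obtain k l where k: "j = h k" "j' = h l" using j nx by (auto simp: next_in_def)
    then have "k < l" using nx strict_mono_less[OF mono] by (simp add: next_in_def)
    then have "h (Suc k) \<le> j'" using k strict_mono_less_eq[OF mono] by simp
    then have gj: "g j \<le> j'" using gap[of k] k by simp
    obtain p' where p': "p = gn p'" "arith p'" using isF_gn[OF p] by blast
    have "sat std (ent a) (Ex i p')" using S Tr_gn[of "Ex i p'" a] p' by (simp add: npair_eq_pr)
    then obtain y where y: "sat std ((ent a)(i := y)) p'" by auto
    have "gn (Ex i p') < j" using ex by (simp add: exceed_def npair_eq_pr p')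
    moreover have "ent a k < j" for k
      using ex by (cases "\<exists>x. entry a k x") (auto simp: exceed_def ent_eq, simp add: ent_def)
    ultimately obtain z where z: "z < g j" "sat std ((ent a)(i := z)) p'" using g y by blast
    obtain b where b: "upd a i z b" using NP.upd_ex[OF a i] by blast
    then have "Tr (pr p b)" using z(2) Tr_gn[OF p'(2)] ent_upd[OF b] by (simp add: p'(1))
    then show "\<exists>y a'. y < j' \<and> upd a i y a' \<and> Tr (pr p a')" using z(1) gj b by (meson less_le_trans)
  qed simp_all
qed simp_all

definition homogeneous :: "fm \<Rightarrow> nat \<Rightarrow> nat set \<Rightarrow> bool" where
  "homogeneous p m H \<longleftrightarrow> (\<forall>s s'. (\<forall>k\<le>m. s k \<in> H \<and> s' k \<in> H) \<longrightarrow>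
     (\<forall>k<m. s k < s (Suc k) \<and> s' k < s' (Suc k)) \<longrightarrow> (sat std s p \<longleftrightarrow> sat std s' p))"

lemma homogeneous_subset: "homogeneous p m H \<Longrightarrow> H' \<subseteq> H \<Longrightarrow> homogeneous p m H'"
  unfolding homogeneous_def by blast

text \<open>Ramsey's theorem colours finite sets, whereas homogeneity speaks of increasing tuples;
  sorting translates between the two.\<close>

lemma increasing_sorted_list:
  assumes "\<forall>k<m. s k < (s (Suc k) :: nat)"
  shows "sorted_list_of_set (s ` {..m}) = map s [0..<Suc m]" "card (s ` {..m}) = Suc m"
proof -
  have lt: "s i < s j" if "i < j" "j \<le> m" for i j
    using that by (induction j) (use assms in \<open>auto simp: less_Suc_eq intro: less_trans\<close>)
  then have inj: "inj_on s {..m}"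
    by (auto simp: inj_on_def) (metis nat_neq_iff less_irrefl)
  then show "card (s ` {..m}) = Suc m" by (simp add: card_image)
  have "sorted_wrt (<) (map s [0..<Suc m])"
    by (auto simp: sorted_wrt_iff_nth_less lt simp del: upt_Suc)
  moreover have "set (map s [0..<Suc m]) = s ` {..m}"
    by (simp add: atLeast0LessThan lessThan_Suc_atMost del: upt_Suc)
  ultimately show "sorted_list_of_set (s ` {..m}) = map s [0..<Suc m]"
    by (metis sorted_list_of_set.idem_if_sorted_distinct strict_sorted_iff)
qed

lemma ex_homogeneous:
  assumes fv: "fv p \<subseteq> {..m}" and H: "infinite (H :: nat set)"
  shows "\<exists>H'\<subseteq>H. infinite H' \<and> homogeneous p m H'"
proof -
  define f where "f X = (if sat std (\<lambda>i. sorted_list_of_set X ! i) p then 1 else 0 :: nat)" for X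
  have "\<forall>X. X \<subseteq> H \<and> finite X \<and> card X = Suc m \<longrightarrow> f X < 2" by (simp add: f_def)
  from Ramsey[OF H this] obtain Y t where Y: "Y \<subseteq> H" "infinite Y"
    "\<forall>X. X \<subseteq> Y \<and> finite X \<and> card X = Suc m \<longrightarrow> f X = t" by (elim exE conjE)
  have f: "f (s ` {..m}) = t \<and> (sat std s p \<longleftrightarrow> f (s ` {..m}) = 1)"
    if s: "\<forall>k\<le>m. s k \<in> Y" "\<forall>k<m. s k < s (Suc k)" for s
  proof
    show "f (s ` {..m}) = t"
      by (rule Y(3)[rule_format]) (use s(1) increasing_sorted_list(2)[OF s(2)] in auto)
    have "sat std (\<lambda>i. sorted_list_of_set (s ` {..m}) ! i) p \<longleftrightarrow> sat std s p"
      unfolding increasing_sorted_list(1)[OF s(2)]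
      by (rule sat_cong) (use fv in \<open>auto simp: nth_map simp del: upt_Suc\<close>)
    then show "sat std s p \<longleftrightarrow> f (s ` {..m}) = 1" by (simp add: f_def)
  qed
  have "homogeneous p m Y" unfolding homogeneous_def using f by metis
  then show ?thesis using Y by blast
qed

lemma infinite_subsequence:
  assumes s: "strict_mono (s :: nat \<Rightarrow> nat)" and Y: "infinite Y" "Y \<subseteq> range s"
  shows "\<exists>r. strict_mono (r :: nat \<Rightarrow> nat) \<and> range (s \<circ> r) \<subseteq> Y"
proof -
  have "infinite (s -` Y)"
  proof
    assume "finite (s -` Y)"
    then have "finite (s ` (s -` Y))" by (rule finite_imageI)
    moreover have "s ` (s -` Y) = Y" using Y(2) by auto
    ultimately show False using Y(1) by simp
  qed
  then have "strict_mono (enumerate (s -` Y))" "\<And>n. enumerate (s -` Y) n \<in> s -` Y"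
    by (rule strict_mono_enumerate, rule enumerate_in_set)
  then show ?thesis by (intro exI[of _ "enumerate (s -` Y)"]) auto
qed

text \<open>Along a diagonal subsequence, homogeneity for each pair of a formula and a number of
  variables holds from some index on, which is the origin of \<open>K\<close>. Sparseness is imposed
  afterwards: the required gaps depend on the elements already chosen, and thinning out preserves
  homogeneity.\<close>

theorem sparse_indiscernibles:
  obtains I where "tarski (sig I)" "infinite (I :: nat set)"
    "\<And>p m. fv p \<subseteq> {..m} \<Longrightarrow> \<exists>K. homogeneous p m {x \<in> I. K < x}"
proof -
  obtain g where g: "\<And>j i p s y. gn (Ex i p) < j \<Longrightarrow> (\<And>k. s k < j) \<Longrightarrow> sat std (s(i := y)) p \<Longrightarrow>
     \<exists>y<g j. sat std (s(i := y)) p" using ex_growth by blast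
  define P where "P k r \<longleftrightarrow> (\<forall>p m. k = prod_encode (gn p, m) \<longrightarrow> fv p \<subseteq> {..m} \<longrightarrow> homogeneous p m (range r))" for k and r :: "nat \<Rightarrow> nat"
  interpret subseqs P
  proof
    fix n and s :: "nat \<Rightarrow> nat" assume s: "strict_mono s"
    show "\<exists>r'. strict_mono r' \<and> P n (s \<circ> r')"
    proof (cases "\<exists>p m. n = prod_encode (gn p, m) \<and> fv p \<subseteq> {..m}")
      case True
      then obtain p m where pm: "n = prod_encode (gn p, m)" "fv p \<subseteq> {..m}" by blast
      have "infinite (range s)" by (rule range_inj_infinite[OF strict_mono_imp_inj_on[OF s]])
      from ex_homogeneous[OF pm(2) this] obtain H where H: "H \<subseteq> range s" "infinite H" "homogeneous p m H" by blast
      obtain r :: "nat \<Rightarrow> nat" where r: "strict_mono r" "range (s \<circ> r) \<subseteq> H" using infinite_subsequence[OF s H(2,1)] by blast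
      have "P n (s \<circ> r)" unfolding P_def pm(1) using homogeneous_subset[OF H(3) r(2)] by (auto simp: inj_gn)
      then show ?thesis using r(1) by blast
    next
      case False
      then show ?thesis using strict_mono_id unfolding P_def by blast
    qed
  qed
  have P: "P k (diagseq \<circ> ((+) (Suc k)))" for k
  proof (rule diagseq_holds)
    show "P n (s \<circ> r)" if "P n s" for r s n
      unfolding P_def
    proof (intro allI impI)
      fix p m assume "n = prod_encode (gn p, m)" "fv p \<subseteq> {..m}"
      then have "homogeneous p m (range s)" using that unfolding P_def by blast
      then show "homogeneous p m (range (s \<circ> r))" by (rule homogeneous_subset) auto
    qed
  qed
  \<comment> \<open>Each index exceeds \<open>g\<close> of the element chosen before. Since
    \<open>diagseq n\<close> is at least \<open>n\<close>, the gap between indices becomes a gap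
    between elements.\<close>
  define h where "h = rec_nat 0 (\<lambda>_ k. Suc k + g (diagseq k))"
  have h: "h (Suc n) = Suc (h n) + g (diagseq (h n))" for n by (simp add: h_def)
  have mono: "strict_mono (diagseq \<circ> h)"
    by (intro strict_mono_o subseq_diagseq) (simp add: strict_mono_Suc_iff h)
  have gap: "g ((diagseq \<circ> h) n) \<le> (diagseq \<circ> h) (Suc n)" for n
    using strict_mono_imp_increasing[OF subseq_diagseq, of "h (Suc n)"] by (simp add: h)
  show ?thesis
  proof
    show "tarski (sig (range (diagseq \<circ> h)))" by (rule tarski_sig_sparse[OF g mono gap])
    show "infinite (range (diagseq \<circ> h))" 
      by (rule range_inj_infinite[OF strict_mono_imp_inj_on[OF mono]])
    fix p m assume pm: "fv p \<subseteq> {..m}"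
    define k where "k = prod_encode (gn p, m)"
    have "homogeneous p m (range (diagseq \<circ> ((+) (Suc k))))" using P[of k] pm unfolding P_def k_def by blast
    moreover have "{x \<in> range (diagseq \<circ> h). diagseq (Suc k) < x} \<subseteq> range (diagseq \<circ> ((+) (Suc k)))"
    proof
      fix x assume "x \<in> {x \<in> range (diagseq \<circ> h). diagseq (Suc k) < x}"
      then obtain n where n: "x = diagseq n" "diagseq (Suc k) < diagseq n" by auto
      then have "Suc k < n" using strict_mono_less[OF subseq_diagseq] by blast
      then show "x \<in> range (diagseq \<circ> ((+) (Suc k)))"
        using n(1) by (intro image_eqI[of _ _ "n - Suc k"]) auto
    qed
    ultimately show "\<exists>K. homogeneous p m {x \<in> range (diagseq \<circ> h). K < x}"
      using homogeneous_subset by blast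
  qed
qed

section \<open>A countable definable ultrapower\<close>

instance tm :: countable by countable_datatype
instance fm :: countable by countable_datatype

lemma pam_Df_mk: "pam (Df (mk I :: nat struct))"
proof -
  interpret dstruct UNIV "Df (mk I)" "mk I :: nat struct"
    using dstruct_Df_self[OF is_struct_mk] by simp
  show ?thesis
  proof
    show "Df (mk I) (\<lambda>s. s 1 < (s 0 :: nat))" using D_lt by simp
    show "Fn (\<lambda>s. s 1 + s 0)" "Fn (\<lambda>s. s 1 * s 0)" using Fn_add Fn_mul by simp_all
    show "P x" if "P 0" "\<And>x. P x \<Longrightarrow> P (x + 1)" for P and x :: nat
      using that by (induction x) simp_all
  qed
qed

text \<open>Countability serves twice: all definable sets can be handled along one diagonal
  sequence, and the ultrapower can live on \<open>nat\<close>.\<close>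

lemma countable_Df: "countable {P. Df (mk I :: nat struct) P}"
proof -
  have "{P. Df (mk I :: nat struct) P} \<subseteq> range (\<lambda>(cs, p). \<lambda>s. sat (mk I) (env cs s) p)"
  proof
    fix P assume "P \<in> {P. Df (mk I :: nat struct) P}"
    then obtain cs p where "P = (\<lambda>s. sat (mk I) (env cs s) p)" by (auto simp: Df_def fun_eq_iff)
    then show "P \<in> range (\<lambda>(cs, p). \<lambda>s. sat (mk I) (env cs s) p)" by (intro range_eqI[of _ _ "(cs, p)"]) simp
  qed
  then show ?thesis by (rule countable_subset) simp
qed

text \<open>Along a sequence that every definable set eventually contains or eventually avoids, the
  definable functions modulo eventual equality form a structure that behaves like an ultrapower.\<close>

lemma cohesive_sequence:
  obtains c where "strict_mono (c :: nat \<Rightarrow> nat)"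
    "\<And>A. Df (mk I :: nat struct) (\<lambda>s. A (s 0)) \<Longrightarrow>
      (\<forall>\<^sub>F n in sequentially. A (c n)) \<or> (\<forall>\<^sub>F n in sequentially. \<not> A (c n))"
proof -
  define DS where "DS = {A. Df (mk I :: nat struct) (\<lambda>s. A (s 0))}"
  have "inj_on (\<lambda>A (s :: nat \<Rightarrow> nat). A (s 0)) DS"
  proof (rule inj_onI, rule ext)
    fix A B :: "nat \<Rightarrow> bool" and n
    assume "(\<lambda>s :: nat \<Rightarrow> nat. A (s 0)) = (\<lambda>s. B (s 0))"
    from fun_cong[OF this, of "\<lambda>_. n"] show "A n = B n" .
  qed
  then have DS: "countable DS"
    by (rule countable_image_inj_on[rotated])
      (rule countable_subset[OF _ countable_Df[of I]], auto simp: DS_def)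
  define P where "P k r \<longleftrightarrow> (\<forall>n. from_nat_into DS k (r n)) \<or> (\<forall>n. \<not> from_nat_into DS k (r n))"
    for k and r :: "nat \<Rightarrow> nat"
  interpret subseqs P
  proof
    fix k and s :: "nat \<Rightarrow> nat" assume s: "strict_mono s"
    let ?A = "from_nat_into DS k"
    have "infinite (range s)" by (rule range_inj_infinite[OF strict_mono_imp_inj_on[OF s]])
    moreover have "range s = {x \<in> range s. ?A x} \<union> {x \<in> range s. \<not> ?A x}" by blast
    ultimately have "infinite {x \<in> range s. ?A x} \<or> infinite {x \<in> range s. \<not> ?A x}"
      by (metis finite_UnI)
    then obtain Y where Y: "infinite Y" "Y \<subseteq> range s" "(\<forall>x\<in>Y. ?A x) \<or> (\<forall>x\<in>Y. \<not> ?A x)"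
      by (metis (no_types, lifting) mem_Collect_eq subsetI)
    obtain r :: "nat \<Rightarrow> nat" where "strict_mono r" "range (s \<circ> r) \<subseteq> Y" using infinite_subsequence[OF s Y(1,2)] by blast
    then show "\<exists>r'. strict_mono r' \<and> P k (s \<circ> r')" using Y(3) unfolding P_def by blast
  qed
  have P: "P k (diagseq \<circ> ((+) (Suc k)))" for k
    by (rule diagseq_holds) (auto simp: P_def)
  show ?thesis
  proof
    show "strict_mono diagseq" by (rule subseq_diagseq)
    fix A assume A: "Df (mk I :: nat struct) (\<lambda>s. A (s 0))"
    define k where "k = to_nat_on DS A"
    have "from_nat_into DS k = A" using DS A by (simp add: k_def DS_def)
    then have alt: "(\<forall>n. A (diagseq (Suc k + n))) \<or> (\<forall>n. \<not> A (diagseq (Suc k + n)))"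
      using P[of k] by (simp add: P_def)
    have ev: "(\<forall>\<^sub>F n in sequentially. Q (diagseq n))" if "\<forall>n. Q (diagseq (Suc k + n))" for Q
      unfolding eventually_sequentially using that by (metis le_add_diff_inverse)
    show "(\<forall>\<^sub>F n in sequentially. A (diagseq n)) \<or> (\<forall>\<^sub>F n in sequentially. \<not> A (diagseq n))"
      using alt ev[of A] ev[of "\<lambda>n. \<not> A n"] by blast
  qed
qed

locale ultrapower =
  fixes I :: "nat set" and c :: "nat \<Rightarrow> nat"
  assumes c_mono: "strict_mono c"
    and cohesive: "\<And>A. Df (mk I) (\<lambda>s. A (s 0)) \<Longrightarrow>
      (\<forall>\<^sub>F n in sequentially. A (c n)) \<or> (\<forall>\<^sub>F n in sequentially. \<not> A (c n))"
begin

abbreviation "M0 \<equiv> mk I"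

text \<open>By cohesiveness this acts as an ultrafilter on the definable sets. No more is required
  of it, as every function involved is definable.\<close>

abbreviation Ev :: "(nat \<Rightarrow> bool) \<Rightarrow> bool" where
  "Ev A \<equiv> \<forall>\<^sub>F n in sequentially. A (c n)"

sublocale pam "Df M0" by (rule pam_Df_mk)

sublocale M: dstruct UNIV "Df M0" M0
  using dstruct_Df_self[OF is_struct_mk] by simp

lemma Ev_not: "Df M0 (\<lambda>s. A (s 0)) \<Longrightarrow> Ev (\<lambda>n. \<not> A n) \<longleftrightarrow> \<not> Ev A"
proof -
  assume "Df M0 (\<lambda>s. A (s 0))"
  moreover have False if "Ev A" "Ev (\<lambda>n. \<not> A n)"
    using eventually_conj[OF that] by simp
  ultimately show ?thesis using cohesive by blast
qed

definition F :: "(nat \<Rightarrow> nat) set" where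
  "F = {f. Df M0 (\<lambda>s. s 1 = f (s 0))}"

lemma countable_F: "countable F"
proof (rule countable_image_inj_on)
  show "inj_on (\<lambda>f (s :: nat \<Rightarrow> nat). s 1 = f (s 0)) F"
  proof (rule inj_onI, rule ext)
    fix f g :: "nat \<Rightarrow> nat" and n
    assume "(\<lambda>s. s 1 = f (s 0)) = (\<lambda>s :: nat \<Rightarrow> nat. s 1 = g (s 0))"
    from fun_cong[OF this, of "\<lambda>i. if i = 0 then n else f n"] show "f n = g n" by simp
  qed
  show "countable ((\<lambda>f (s :: nat \<Rightarrow> nat). s 1 = f (s 0)) ` F)"
    by (rule countable_subset[OF _ countable_Df[of I]]) (auto simp: F_def)
qed

lemma F_I: "Df M0 (\<lambda>s. s 1 = f (s 0)) \<Longrightarrow> f \<in> F"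
  by (simp add: F_def)

lemma Fn_F: assumes f: "f \<in> F" and g: "Fn g" shows "Fn (\<lambda>s. f (g s))"
proof (rule Fn_app1[OF _ g])
  have "Df M0 (\<lambda>s. s 1 = f (s 0))" using f by (simp add: F_def)
  from D_app2[where R = "\<lambda>x y. x = f y", OF this Fn_var[of 0] Fn_var[of 1]]
  show "Fn (\<lambda>s. f (s 0))" by (simp add: Fn_def)
qed

text \<open>The choice depends only on the class of \<open>f\<close> modulo eventual equality along
  \<open>c\<close>, so equality of classes becomes equality of natural numbers.\<close>

definition code :: "(nat \<Rightarrow> nat) \<Rightarrow> nat" where
  "code f = to_nat_on F (SOME g. g \<in> F \<and> Ev (\<lambda>n. g n = f n))"

abbreviation rep :: "nat \<Rightarrow> nat \<Rightarrow> nat" where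
  "rep \<equiv> from_nat_into F"

lemma rep_code:
  assumes "f \<in> F" shows "rep (code f) \<in> F" "Ev (\<lambda>n. rep (code f) n = f n)"
proof -
  define g where "g = (SOME g. g \<in> F \<and> Ev (\<lambda>n. g n = f n))"
  have "g \<in> F \<and> Ev (\<lambda>n. g n = f n)"
    unfolding g_def by (rule someI[of _ f]) (use assms in simp)
  moreover from this have "rep (code f) = g"
    using countable_F by (simp add: code_def g_def)
  ultimately show "rep (code f) \<in> F" "Ev (\<lambda>n. rep (code f) n = f n)" by auto
qed

lemma code_eq:
  assumes "Ev (\<lambda>n. f n = g n)" shows "code f = code g"
proof -
  have "Ev (\<lambda>n. h n = f n) \<longleftrightarrow> Ev (\<lambda>n. h n = g n)" for h
    using assms by (auto elim: eventually_elim2)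
  then show ?thesis by (simp add: code_def)
qed

definition W :: "nat struct" where
  "W = \<lparr>univ = code ` F, zer = code (\<lambda>n. 0), suc = (\<lambda>k. code (\<lambda>n. rep k n + 1)),
    add = (\<lambda>k l. code (\<lambda>n. rep k n + rep l n)), mul = (\<lambda>k l. code (\<lambda>n. rep k n * rep l n)),
    lt = (\<lambda>k l. Ev (\<lambda>n. rep k n < rep l n)), ind = {k \<in> code ` F. Ev (\<lambda>n. rep k n \<in> I)}\<rparr>"

lemma W_univ: "univ W = code ` F"
  by (simp add: W_def)

lemma rep_F: "k \<in> univ W \<Longrightarrow> rep k \<in> F"
  using rep_code by (auto simp: W_def)

lemma Fn_rep [D_intros]: "k \<in> univ W \<Longrightarrow> Fn g \<Longrightarrow> Fn (\<lambda>s. rep k (g s))"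
  by (rule Fn_F[OF rep_F])

lemma code_rep:
  assumes "k \<in> univ W" shows "code (rep k) = k"
proof -
  from assms obtain f where f: "f \<in> F" "k = code f" by (auto simp: W_univ)
  show ?thesis unfolding f(2) by (rule code_eq[OF rep_code(2)[OF f(1)]])
qed

lemma eq_iff: "k \<in> univ W \<Longrightarrow> l \<in> univ W \<Longrightarrow> k = l \<longleftrightarrow> Ev (\<lambda>n. rep k n = rep l n)"
  using code_eq[of "rep k" "rep l"] code_rep by auto

lemma F_val:
  assumes "\<And>i. s i \<in> univ W" shows "(\<lambda>n. val M0 (\<lambda>i. rep (s i) n) t) \<in> F"
proof (rule F_I)
  have "Fn (\<lambda>s'. val M0 (\<lambda>i. rep (s i) (s' 0)) t)"
    by (rule M.Fn_val) (intro D_intros assms)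
  from D_eq[OF Fn_var[of 1] this]
  show "Df M0 (\<lambda>s'. s' 1 = val M0 (\<lambda>i. rep (s i) (s' 0)) t)" .
qed

lemma D_sat_rep:
  assumes "\<And>i. s i \<in> univ W" shows "Df M0 (\<lambda>s'. sat M0 (\<lambda>i. rep (s i) (s' 0)) p)"
  by (rule M.D_sat) (intro D_intros assms)

lemma is_struct_W: "is_struct W"
proof -
  have 0: "(\<lambda>n. 0) \<in> F" by (rule F_I) (intro D_intros)
  have 1: "(\<lambda>n. rep k n + 1) \<in> F" if "k \<in> univ W" for k
    by (rule F_I) (intro D_intros that)
  have 2: "(\<lambda>n. rep k n + rep l n) \<in> F" "(\<lambda>n. rep k n * rep l n) \<in> F"
    if "k \<in> univ W" "l \<in> univ W" for k l
    by (rule F_I, intro D_intros that)+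
  show ?thesis
    using 0 1 2 unfolding is_struct_def by (auto simp: W_def)
qed

lemma val_W:
  assumes s: "\<And>i. s i \<in> univ W"
  shows "val W s t = code (\<lambda>n. val M0 (\<lambda>i. rep (s i) n) t)"
proof (induction t)
  case (Var i)
  then show ?case using code_rep[OF s] by simp
next
  case Zero
  then show ?case by (simp add: W_def)
next
  case (Succ t)
  have "Ev (\<lambda>n. rep (val W s t) n = val M0 (\<lambda>i. rep (s i) n) t)"
    unfolding Succ by (rule rep_code(2)[OF F_val[OF s]])
  then show ?case by (auto simp: W_def intro!: code_eq elim: eventually_mono)
next
  case (Plus t u)
  have "Ev (\<lambda>n. rep (val W s t) n = val M0 (\<lambda>i. rep (s i) n) t)"
    "Ev (\<lambda>n. rep (val W s u) n = val M0 (\<lambda>i. rep (s i) n) u)"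
    unfolding Plus by (rule rep_code(2)[OF F_val[OF s]])+
  then show ?case by (auto simp: W_def intro!: code_eq elim: eventually_elim2)
next
  case (Times t u)
  have "Ev (\<lambda>n. rep (val W s t) n = val M0 (\<lambda>i. rep (s i) n) t)"
    "Ev (\<lambda>n. rep (val W s u) n = val M0 (\<lambda>i. rep (s i) n) u)"
    unfolding Times by (rule rep_code(2)[OF F_val[OF s]])+
  then show ?case by (auto simp: W_def intro!: code_eq elim: eventually_elim2)
qed

lemma rep_val_W:
  assumes s: "\<And>i. s i \<in> univ W"
  shows "Ev (\<lambda>n. rep (val W s t) n = val M0 (\<lambda>i. rep (s i) n) t)"
  unfolding val_W[OF s] by (rule rep_code(2)[OF F_val[OF s]])

text \<open>Negation and disjunction use that \<open>Ev\<close> decides every definable set, by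
  \<open>Ev_not\<close>. The existential case calls for a witness function in \<open>F\<close>, that
  is, for a definable Skolem function.\<close>

theorem Los:
  "(\<And>i. s i \<in> univ W) \<Longrightarrow> sat W s p \<longleftrightarrow> Ev (\<lambda>n. sat M0 (\<lambda>i. rep (s i) n) p)"
proof (induction p arbitrary: s)
  case (Eq t u)
  have *: "val W s t \<in> univ W" "val W s u \<in> univ W"
    using Eq by (auto intro!: val_in_univ is_struct_W)
  show ?case unfolding sat.simps eq_iff[OF *]
    using rep_val_W[of s t, OF Eq] rep_val_W[of s u, OF Eq]
    by (intro eventually_subst) (auto elim: eventually_elim2)
next
  case (Less t u)
  have "Ev (\<lambda>n. rep (val W s t) n < rep (val W s u) n \<longleftrightarrow>
      val M0 (\<lambda>i. rep (s i) n) t < val M0 (\<lambda>i. rep (s i) n) u)"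
    using rep_val_W[of s t, OF Less] rep_val_W[of s u, OF Less] by (rule eventually_elim2) simp
  then show ?case by (simp add: eventually_subst W_def[THEN arg_cong[where f = lt]])
next
  case (InI t)
  have *: "val W s t \<in> univ W" using InI by (auto intro!: val_in_univ is_struct_W)
  have "Ev (\<lambda>n. rep (val W s t) n \<in> I \<longleftrightarrow> val M0 (\<lambda>i. rep (s i) n) t \<in> I)"
    using rep_val_W[of s t, OF InI] by (rule eventually_mono) simp
  then show ?case using * by (simp add: eventually_subst W_def[THEN arg_cong[where f = ind]] W_univ)
next
  case (Neg p)
  show ?case using Neg.IH[OF Neg.prems] Ev_not[OF D_sat_rep[OF Neg.prems]] by simp
next
  case (Or p q)
  let ?P = "\<lambda>n. sat M0 (\<lambda>i. rep (s i) n) p" and ?Q = "\<lambda>n. sat M0 (\<lambda>i. rep (s i) n) q"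
  have P: "Ev (\<lambda>n. \<not> ?P n) \<longleftrightarrow> \<not> Ev ?P"
    by (rule Ev_not[OF D_sat_rep]) (rule Or.prems)
  have "Ev (\<lambda>n. ?P n \<or> ?Q n) \<longleftrightarrow> Ev ?P \<or> Ev ?Q"
  proof
    assume *: "Ev (\<lambda>n. ?P n \<or> ?Q n)"
    show "Ev ?P \<or> Ev ?Q"
    proof (cases "Ev ?P")
      case False
      then have "Ev (\<lambda>n. \<not> ?P n)" using P by simp
      with * have "Ev ?Q" by (rule eventually_elim2) blast
      then show ?thesis ..
    qed simp
  qed (auto elim: eventually_mono)
  then show ?case using Or.IH[OF Or.prems] by simp
next
  case (Ex v p)
  have upd: "(\<lambda>i. rep ((s(v := a)) i) n) = (\<lambda>i. rep (s i) n)(v := rep a n)" for a n by auto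
  have IH: "sat W (s(v := a)) p \<longleftrightarrow> Ev (\<lambda>n. sat M0 ((\<lambda>i. rep (s i) n)(v := rep a n)) p)"
    if "a \<in> univ W" for a
  proof -
    have "(s(v := a)) i \<in> univ W" for i using Ex.prems that by simp
    from Ex.IH[of "s(v := a)", OF this] show ?thesis unfolding upd .
  qed
  define Q where "Q n y \<longleftrightarrow> sat M0 ((\<lambda>i. rep (s i) n)(v := y)) p" for n y
  have "Df M0 (\<lambda>s'. sat M0 (\<lambda>i. (if i = v then (\<lambda>s'. s' 0) else (\<lambda>s'. rep (s i) (s' 1))) s') p)"
    by (rule M.D_sat) (use Ex.prems in \<open>auto intro!: D_intros\<close>)
  moreover have "(\<lambda>i. (if i = v then (\<lambda>s'. s' 0) else (\<lambda>s'. rep (s i) (s' 1))) s') =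
      (\<lambda>i. rep (s i) (s' 1))(v := s' 0)" for s' :: "nat \<Rightarrow> nat" by auto
  ultimately have "Df M0 (\<lambda>s'. Q (s' 1) (s' 0))" unfolding Q_def by (simp only:)
  note [D_intros] = D_app2[where R = Q, OF this]
  \<comment> \<open>Taking the least witness keeps \<open>h\<close> definable, so that it represents
    an element of \<open>W\<close>; the default 0 makes it total.\<close>
  define h where "h n = (if \<exists>y. Q n y then LEAST y. Q n y else 0)" for n
  have h: "m = h n \<longleftrightarrow> Q n m \<and> (\<forall>z. z < m \<longrightarrow> \<not> Q n z) \<or> \<not> (\<exists>y. Q n y) \<and> m = 0" for m n
  proof (cases "\<exists>y. Q n y")
    case True
    then have "Q n (h n)" by (auto simp: h_def intro: LeastI)
    moreover have "\<not> Q n z" if "z < h n" for z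
      using that not_less_Least[of z "Q n"] True by (auto simp: h_def)
    ultimately show ?thesis using True by (metis nat_neq_iff)
  qed (auto simp: h_def)
  have hF: "h \<in> F" by (rule F_I, unfold h, intro D_intros)
  show ?case
  proof
    assume "sat W s (Ex v p)"
    then obtain a where "a \<in> univ W" "sat W (s(v := a)) p" by auto
    then have "Ev (\<lambda>n. sat M0 ((\<lambda>i. rep (s i) n)(v := rep a n)) p)" using IH by blast
    then show "Ev (\<lambda>n. sat M0 (\<lambda>i. rep (s i) n) (Ex v p))"
      by (rule eventually_mono) (simp del: fun_upd_apply, blast)
  next
    assume "Ev (\<lambda>n. sat M0 (\<lambda>i. rep (s i) n) (Ex v p))"
    then have "Ev (\<lambda>n. \<exists>y. Q n y)" by (simp add: Q_def)
    moreover have "Q n (h n)" if "\<exists>y. Q n y" for n using that h[of "h n" n] by blast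
    ultimately have "Ev (\<lambda>n. Q n (h n))" by (rule eventually_mono)
    then have "Ev (\<lambda>n. Q n (rep (code h) n))"
      using rep_code(2)[OF hF] by (rule eventually_elim2) simp
    then have "sat W (s(v := code h)) p" using IH[of "code h"] hF by (simp add: Q_def W_univ)
    then show "sat W s (Ex v p)" using hF by (auto simp: W_univ)
  qed
qed

lemma models_W: "models M0 U \<Longrightarrow> models W U"
  unfolding models_def using is_struct_W Los by (auto simp: image_subset_iff)

definition infinite_element :: nat where
  "infinite_element = code (\<lambda>n. n)"

lemma infinite_element: "infinite_element \<in> univ W" "Ev (\<lambda>n. rep infinite_element n = n)"
proof -
  have "(\<lambda>n. n) \<in> F" by (rule F_I) (intro D_intros)
  then show "infinite_element \<in> univ W" "Ev (\<lambda>n. rep infinite_element n = n)"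
    using rep_code(2) by (auto simp: infinite_element_def W_univ)
qed

abbreviation "W' \<equiv> final_segment W infinite_element"

text \<open>The infinite element is the class of the identity, so an element of \<open>W'\<close>'s
  set \<open>I\<close> is represented by a function that is eventually at least \<open>n\<close>
  along \<open>c\<close>, and thus eventually above any fixed threshold.\<close>

lemma ind_W': "k \<in> ind W' \<Longrightarrow> k \<in> univ W \<and> Ev (\<lambda>n. rep k n \<in> I \<and> n \<le> rep k n)"
proof -
  assume k: "k \<in> ind W'"
  then have k': "k \<in> univ W" "Ev (\<lambda>n. rep k n \<in> I)" "\<not> Ev (\<lambda>n. rep k n < rep infinite_element n)"
    by (simp_all add: final_segment_def W_def)
  have "Df M0 (\<lambda>s. rep k (s 0) < rep infinite_element (s 0))"
    by (intro D_intros k'(1) infinite_element(1))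
  then have "Ev (\<lambda>n. \<not> rep k n < rep infinite_element n)" using Ev_not[of "\<lambda>n. rep k n < rep infinite_element n"] k'(3) by simp
  then have "Ev (\<lambda>n. n \<le> rep k n)"
    using infinite_element(2) by (rule eventually_elim2) simp
  then show ?thesis using k' eventually_conj by blast
qed

text \<open>By \<open>Los\<close>, \<alpha> holds in \<open>W\<close>, and it passes to
  \<open>W'\<close> as to a final segment. For indiscernibility, the two tuples of an instance are,
  at almost all \<open>c n\<close>, increasing tuples of \<open>I\<close> with entries at least
  \<open>c n\<close>, hence beyond the threshold \<open>K\<close> of the formula.\<close>

lemma models_PAI_W':
  assumes M0: "models M0 (PA_ind \<union> {Unbounded, alpha})" and inf: "infinite I"
    and hom: "\<And>p m. fv p \<subseteq> {..m} \<Longrightarrow> \<exists>K. homogeneous p m {x \<in> I. K < x}"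
  shows "models W' (PAI \<union> {alpha})"
proof -
  let ?d = infinite_element
  have W: "models W (PA_ind \<union> {Unbounded, alpha})" by (rule models_W[OF M0])
  have alpha: "models W' {alpha}" by (rule models_final_segment_alpha[OF W infinite_element(1)])
  have PA: "models W PA_ind" using W by (rule models_mono) blast
  interpret W: dstruct "univ W" "Df W" W by (rule dstruct_Df_self[OF is_struct_W])
  define J where "J = {x \<in> ind W. \<not> lt W x ?d}"
  have W'_eq: "W' = W\<lparr>ind := J\<rparr>" by (simp add: final_segment_def J_def)
  have J: "J \<subseteq> univ W" using is_struct_W by (auto simp: J_def is_struct_def)
  have DJ: "Df W (\<lambda>s. s 0 \<in> J)"
    unfolding J_def mem_Collect_eq
    by (intro W.D_and W.D_Not W.D_ind W.D_app2[OF W.D_lt] W.Fn_var W.Fn_const infinite_element(1))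
  have "models W' PA_ind" unfolding W'_eq by (rule models_PA_ind_expansion[OF PA J DJ])
  moreover have "models W' {Unbounded}"
  proof -
    \<comment> \<open>Unboundedness of the final segment is put into one formula, with variable 1 as
      the cut, so that it transfers to \<open>W\<close> and can be instantiated there with the
      infinite element.\<close>
    have "sat M0 s (Ex 2 (And (And (InI (Var 2)) (Less (Var 0) (Var 2))) (Neg (Less (Var 2) (Var 1)))))" for s
    proof -
      obtain y where "y \<in> I" "max (s 0) (s 1) < y" using inf by (meson infinite_nat_iff_unbounded)
      then show ?thesis by (simp, intro exI[of _ y]) simp
    qed
    then have "models M0 {Ex 2 (And (And (InI (Var 2)) (Less (Var 0) (Var 2))) (Neg (Less (Var 2) (Var 1))))}"
      by (simp add: models_def is_struct_mk)
    from models_W[OF this] have *: "sat W s (Ex 2 (And (And (InI (Var 2)) (Less (Var 0) (Var 2))) (Neg (Less (Var 2) (Var 1)))))"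
      if "range s \<subseteq> univ W" for s using that by (simp add: models_def)
    have "\<exists>y\<in>univ W. lt W x y \<and> y \<in> J" if "x \<in> univ W" for x
      using *[of "\<lambda>i. if i = 0 then x else ?d"] that infinite_element(1)
      by (auto simp: J_def image_subset_iff)
    then show ?thesis
      using is_struct_final_segment[OF is_struct_W, of ?d] unfolding W'_eq by (auto simp: models_def Unbounded_def)
  qed
  moreover have "sat W' s (Indisc m p)" if s: "range s \<subseteq> univ W" and p: "arith p" "fv p \<subseteq> {..m}" for s m p
  proof -
    have "sat W' s p \<longleftrightarrow> sat W' s (shift (Suc m) p)"
      if x: "sat W' s (IncrI 0 m)" and y: "sat W' s (IncrI (Suc m) m)"
    proof -
      have sU: "s i \<in> univ W" for i using s by auto
      have ltW: "lt W' = lt W" by (simp add: final_segment_def)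
      have lt_Ev: "Ev (\<lambda>n. rep k n < rep l n)" if "lt W k l" for k l using that by (simp add: W_def)
      obtain K where K: "homogeneous p m {x \<in> I. K < x}" using hom[OF p(2)] by blast
      have ind: "\<forall>k\<in>{..m}. Ev (\<lambda>n. rep (s (i + k)) n \<in> I \<and> n \<le> rep (s (i + k)) n)"
        if "sat W' s (IncrI i m)" for i
        using that ind_W' unfolding sat_IncrI by blast
      have inc: "\<forall>k\<in>{..<m}. Ev (\<lambda>n. rep (s (i + k)) n < rep (s (i + Suc k)) n)"
        if "sat W' s (IncrI i m)" for i
        using that lt_Ev unfolding sat_IncrI ltW by blast
      have "\<forall>\<^sub>F n in sequentially. K < c n"
        using seq_suble[OF c_mono] by (intro eventually_sequentiallyI[of "Suc K"]) (meson Suc_le_lessD le_trans)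
      moreover have "Ev (\<lambda>n. \<forall>k\<in>{..m}. rep (s (0 + k)) n \<in> I \<and> n \<le> rep (s (0 + k)) n)"
        "Ev (\<lambda>n. \<forall>k\<in>{..m}. rep (s (Suc m + k)) n \<in> I \<and> n \<le> rep (s (Suc m + k)) n)"
        "Ev (\<lambda>n. \<forall>k\<in>{..<m}. rep (s (0 + k)) n < rep (s (0 + Suc k)) n)"
        "Ev (\<lambda>n. \<forall>k\<in>{..<m}. rep (s (Suc m + k)) n < rep (s (Suc m + Suc k)) n)"
        using ind[OF x] ind[OF y] inc[OF x] inc[OF y] by (simp_all only: eventually_ball_finite_distrib finite_atMost finite_lessThan)
      ultimately have "Ev (\<lambda>n. sat M0 (\<lambda>i. rep (s i) n) p \<longleftrightarrow> sat M0 (\<lambda>i. rep (s i) n) (shift (Suc m) p))"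
      proof eventually_elim
        case (elim n)
        have "sat std (\<lambda>i. rep (s i) (c n)) p \<longleftrightarrow> sat std (\<lambda>i. rep (s (Suc m + i)) (c n)) p"
          by (rule K[unfolded homogeneous_def, rule_format]) (use elim in \<open>auto intro: less_le_trans\<close>)
        \<comment> \<open>Homogeneity is stated for \<open>std\<close>, where \<open>I\<close> is
          empty; an arithmetical \<open>p\<close> has the same truth value in both
          structures.\<close>
        moreover have "sat M0 s p \<longleftrightarrow> sat std s p" for s
          using sat_arith[OF p(1), where M = std and J = I and s = s] by (simp add: mk_def)
        ultimately show ?case by (simp add: sat_shift)
      qed
      then have "sat W s p \<longleftrightarrow> sat W s (shift (Suc m) p)"
        unfolding Los[of s, OF sU] by (rule eventually_subst)
      then show ?thesis using p(1) unfolding W'_eq by (simp add: sat_arith)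
    qed
    then show ?thesis by (simp add: Indisc_def)
  qed
  then have "models W' {Indisc m p | m p. arith p \<and> fv p \<subseteq> {..m}}"
    using is_struct_final_segment[OF is_struct_W, of ?d] unfolding W'_eq by (auto simp: models_def)
  ultimately show ?thesis unfolding PAI_eq models_Un using alpha by blast
qed

end

theorem consistent_PAI_alpha: "\<exists>M :: nat struct. models M (PAI \<union> {alpha})"
proof -
  obtain I where I: "tarski (sig I)" "infinite (I :: nat set)"
    "\<And>p m. fv p \<subseteq> {..m} \<Longrightarrow> \<exists>K. homogeneous p m {x \<in> I. K < x}"
    using sparse_indiscernibles by blast
  obtain c where c: "strict_mono (c :: nat \<Rightarrow> nat)"
    "\<And>A. Df (mk I :: nat struct) (\<lambda>s. A (s 0)) \<Longrightarrow>
      (\<forall>\<^sub>F n in sequentially. A (c n)) \<or> (\<forall>\<^sub>F n in sequentially. \<not> A (c n))"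
    using cohesive_sequence by blast
  interpret ultrapower I c by standard (fact c)+
  have "models (mk I) {Unbounded}"
    using I(2) by (auto simp: models_def is_struct_mk Unbounded_def infinite_nat_iff_unbounded)
  moreover have "models (mk I) {alpha}" using I(1) by (simp add: models_def is_struct_mk sat_alpha)
  ultimately have "models (mk I) (PA_ind \<union> {Unbounded} \<union> {alpha})"
    using models_mk_nat by (simp only: models_Un)
  then have "models M0 (PA_ind \<union> {Unbounded, alpha})" by (rule models_mono) blast
  from models_PAI_W'[OF this I(2,3)] show ?thesis by blast
qed

lemma models_PAI0: "models M PAI \<Longrightarrow> models M PAI0"
proof -
  assume M: "models M PAI"
  have "sat M s (Indisc0 m p)" if "range s \<subseteq> univ M" "arith p" "fv p \<subseteq> {..m}" for s m p
  proof -
    have "Indisc m p \<in> PAI" using that by (auto simp: PAI_eq)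
    then have "sat M s (Indisc m p)" using M that by (simp add: models_def)
    then show ?thesis by (simp add: Indisc_def Indisc0_def)
  qed
  then have "models M {Indisc0 m p | m p. arith p \<and> fv p \<subseteq> {..m}}"
    using M by (auto simp: models_def)
  moreover have "models M (PA_ind \<union> {Unbounded})" using M PA_ind_subset(1) by (rule models_mono)
  ultimately show ?thesis unfolding PAI0_eq models_Un by blast
qed

lemma not_solid:
  assumes "nowhere_solid TYPE('a) U" "models (M :: 'a struct) U" shows "\<not> solid TYPE('a) U"
  using assms unfolding nowhere_solid_def solid_def by blast

theorem theorem5p5:
  shows "\<forall>U \<in> {PAI0, PAI, PAI \<union> {alpha}}.
           nowhere_solid TYPE('a) U \<and> \<not> solid TYPE(nat) U"
proof
  fix U assume U: "U \<in> {PAI0, PAI, PAI \<union> {alpha}}"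
  obtain M :: "nat struct" where M: "models M (PAI \<union> {alpha})" using consistent_PAI_alpha by blast
  then have "models M PAI" by (rule models_mono) blast
  then have "models M U" using U M models_PAI0 by blast
  then show "nowhere_solid TYPE('a) U \<and> \<not> solid TYPE(nat) U"
    using nowhere_solid[OF U] not_solid[OF nowhere_solid[OF U]] by blast
qed

end
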